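(* Let $\Omega\subset\mathbb R^N$ ($N\le 3$) be a smooth bounded domain, $\Lambda_1$ the principal eigenvalue of $-\Delta$ on $H_0^1(\Omega)$, $n\ge2$, $a_1,\dots,a_n,\beta\in\mathbb R$ and $\mu_1\le\mu_2\le\dots\le\mu_n$ real. Consider the system $$-\Delta u_j+a_ju_j=\mu_ju_j^3+\beta\sum_{k\ne j}u_k^2u_j,\quad u_j>0\text{ in }\Omega,\quad u_j=0\text{ on }\partial\Omega,\qquad j=1,\dots,n.$$ This system has no positive solution $(u_1,\dots,u_n)\in[H_0^1(\Omega)]^n$ in each of the following cases: (i) $a_j\le-\Lambda_1$ and $\mu_j>0$ for some $j\in\{1,\dots,n\}$, and $\beta\ge0$; (ii) $a_j\le a_i$ and $\mu_i\le\beta\le\mu_j$ for some $i<j$, and at least one of these inequalities is strict; (iii) in the focusing case, $a_j\le-\Lambda_1$ for all $j=1,\dots,n$ and $\beta\ge\bar\beta$, and at least one of these inequalities is strict; (iv) in the mixed cases, $a_n\le a_1\le-\Lambda_1$ and $\beta\ge\mu_1$, and at least one of these inequalities is strict.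
   Context: The system is called focusing if $0<\mu_1\le\dots\le\mu_n$, defocusing if $\mu_1\le\dots\le\mu_n<0$, and mixed in all other cases. Let $g(\beta)=1+\beta\sum_{j=1}^n\frac1{\mu_j-\beta}$; in the focusing case $\bar\beta$ denotes the unique zero of $g$ in $(-\infty,0)$. *)

theory Defs
  imports "HOL-Analysis.Analysis"
begin

text \<open>Infinitely differentiable real functions on an open set U of R^N (N = CARD('n)):
  there is a family D of all iterated partial derivatives (D [] = f) such that each member
  is (Frechet) differentiable with gradient given by the next-order partial derivatives.\<close>
definition smooth_on :: "(real^'n) set \<Rightarrow> (real^'n \<Rightarrow> real) \<Rightarrow> bool" where
  "smooth_on U f \<longleftrightarrow> (\<exists>D :: 'n list \<Rightarrow> real^'n \<Rightarrow> real.
      (\<forall>x\<in>U. D [] x = f x) \<and>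
      (\<forall>ks. \<forall>x\<in>U. (D ks has_derivative (\<lambda>h. \<Sum>i\<in>UNIV. h $ i * D (i # ks) x)) (at x within U)))"

definition smooth_bounded_domain :: "(real^'n) set \<Rightarrow> bool" where
  "smooth_bounded_domain \<Omega> \<longleftrightarrow> open \<Omega> \<and> bounded \<Omega> \<and> connected \<Omega> \<and> \<Omega> \<noteq> {} \<and>
     (\<forall>x\<in>frontier \<Omega>. \<exists>U \<rho> L. open U \<and> x \<in> U \<and> smooth_on U \<rho> \<and>
         (\<rho> has_derivative L) (at x) \<and> L \<noteq> (\<lambda>h. 0) \<and>
         \<Omega> \<inter> U = {y\<in>U. \<rho> y < 0})"

definition test_fun :: "(real^'n) set \<Rightarrow> (real^'n \<Rightarrow> real) \<Rightarrow> bool" where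
  "test_fun \<Omega> \<phi> \<longleftrightarrow> smooth_on UNIV \<phi> \<and> compact (closure {x. \<phi> x \<noteq> 0})
      \<and> closure {x. \<phi> x \<noteq> 0} \<subseteq> \<Omega>"

text \<open>H01 Omega u g: u belongs to H_0^1(Omega) with weak gradient g, i.e. (u,g) is the
  H^1(Omega)-limit of (phi_k, grad phi_k) with phi_k test functions.\<close>
definition H01 :: "(real^'n) set \<Rightarrow> (real^'n \<Rightarrow> real) \<Rightarrow> (real^'n \<Rightarrow> real^'n) \<Rightarrow> bool" where
  "H01 \<Omega> u g \<longleftrightarrow> u \<in> borel_measurable lebesgue \<and> g \<in> borel_measurable lebesgue \<and>
     set_integrable lebesgue \<Omega> (\<lambda>x. (u x)\<^sup>2) \<and> set_integrable lebesgue \<Omega> (\<lambda>x. (norm (g x))\<^sup>2) \<and>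
     (\<exists>\<phi> \<psi>. (\<forall>k. test_fun \<Omega> (\<phi> k) \<and> (\<forall>x. (\<phi> k has_derivative (\<lambda>h. \<psi> k x \<bullet> h)) (at x))) \<and>
        ((\<lambda>k. LINT x:\<Omega>|lebesgue. (\<phi> k x - u x)\<^sup>2) \<longlonglongrightarrow> 0) \<and>
        ((\<lambda>k. LINT x:\<Omega>|lebesgue. (norm (\<psi> k x - g x))\<^sup>2) \<longlonglongrightarrow> 0))"

definition dirichlet_eigenvalue :: "(real^'n) set \<Rightarrow> real \<Rightarrow> bool" where
  "dirichlet_eigenvalue \<Omega> lam \<longleftrightarrow> (\<exists>u g. H01 \<Omega> u g \<and>
      \<not> (AE x in lebesgue. x \<in> \<Omega> \<longrightarrow> u x = 0) \<and>
      (\<forall>\<phi> \<psi>. test_fun \<Omega> \<phi> \<and> (\<forall>x. (\<phi> has_derivative (\<lambda>h. \<psi> x \<bullet> h)) (at x)) \<longrightarrow>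
         (LINT x:\<Omega>|lebesgue. g x \<bullet> \<psi> x) = lam * (LINT x:\<Omega>|lebesgue. u x * \<phi> x)))"

definition principal_eigenvalue :: "(real^'n) set \<Rightarrow> real" where
  "principal_eigenvalue \<Omega> = Inf {lam. dirichlet_eigenvalue \<Omega> lam}"

definition positive_solution ::
  "(real^'n) set \<Rightarrow> nat \<Rightarrow> (nat \<Rightarrow> real) \<Rightarrow> (nat \<Rightarrow> real) \<Rightarrow> real \<Rightarrow> (nat \<Rightarrow> real^'n \<Rightarrow> real) \<Rightarrow> bool" where
  "positive_solution \<Omega> n a \<mu> \<beta> u \<longleftrightarrow> (\<exists>g :: nat \<Rightarrow> real^'n \<Rightarrow> real^'n. \<forall>j\<in>{1..n}.
      H01 \<Omega> (u j) (g j) \<and> (AE x in lebesgue. x \<in> \<Omega> \<longrightarrow> u j x > 0) \<and>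
      (\<forall>\<phi> \<psi>. test_fun \<Omega> \<phi> \<and> (\<forall>x. (\<phi> has_derivative (\<lambda>h. \<psi> x \<bullet> h)) (at x)) \<longrightarrow>
         (LINT x:\<Omega>|lebesgue. g j x \<bullet> \<psi> x + a j * u j x * \<phi> x) =
         (LINT x:\<Omega>|lebesgue. (\<mu> j * (u j x)^3 + \<beta> * (\<Sum>k\<in>{1..n}-{j}. (u k x)\<^sup>2) * u j x) * \<phi> x)))"

definition focusing :: "nat \<Rightarrow> (nat \<Rightarrow> real) \<Rightarrow> bool" where
  "focusing n \<mu> \<longleftrightarrow> (\<forall>j\<in>{1..n}. 0 < \<mu> j)"

definition defocusing :: "nat \<Rightarrow> (nat \<Rightarrow> real) \<Rightarrow> bool" where
  "defocusing n \<mu> \<longleftrightarrow> (\<forall>j\<in>{1..n}. \<mu> j < 0)"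

definition mixed :: "nat \<Rightarrow> (nat \<Rightarrow> real) \<Rightarrow> bool" where
  "mixed n \<mu> \<longleftrightarrow> \<not> focusing n \<mu> \<and> \<not> defocusing n \<mu>"

definition gfun :: "nat \<Rightarrow> (nat \<Rightarrow> real) \<Rightarrow> real \<Rightarrow> real" where
  "gfun n \<mu> b = 1 + b * (\<Sum>j=1..n. 1 / (\<mu> j - b))"

definition beta_bar :: "nat \<Rightarrow> (nat \<Rightarrow> real) \<Rightarrow> real" where
  "beta_bar n \<mu> = (THE b. b < 0 \<and> gfun n \<mu> b = 0)"

end

theory Submission
  imports Defs "HOL-Library.Diagonal_Subsequence"
begin

text \<open>
  Every component solves \<open>-\<Delta>u\<^sub>j = c\<^sub>j u\<^sub>j\<close> with
  \<open>c\<^sub>j = \<mu>\<^sub>j u\<^sub>j\<^sup>2 + \<beta> (\<Sum>k \<noteq> j. u\<^sub>k\<^sup>2) - a\<^sub>j\<close>, and \<open>c\<^sub>j \<in> L\<^sup>2\<close> because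
  \<open>H\<^sub>0\<^sup>1\<close> embeds into \<open>L\<^sup>4\<close> in dimension at most three.

  Testing equation \<open>i\<close> with \<open>u\<^sub>j\<close> and equation \<open>j\<close> with \<open>u\<^sub>i\<close> gives
  \<open>\<integral> (c\<^sub>j - c\<^sub>i) u\<^sub>i u\<^sub>j = 0\<close>, which is impossible in case (ii), where \<open>c\<^sub>j > c\<^sub>i\<close> almost everywhere.

  Testing equation \<open>j\<close> with \<open>\<phi>\<^sup>2 / u\<^sub>j\<close> (Picone's inequality) gives
  \<open>\<integral> c\<^sub>j \<phi>\<^sup>2 \<le> \<integral> |\<nabla>\<phi>|\<^sup>2\<close> for every test function, hence for a normalised minimiser \<open>e\<close> of the Rayleigh
  quotient. With \<open>U\<^sub>j = \<integral> u\<^sub>j\<^sup>2 e\<^sup>2 > 0\<close> this reads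
  \<open>(\<mu>\<^sub>j - \<beta>) U\<^sub>j + \<beta> (\<Sum>k. U\<^sub>k) \<le> \<Lambda>\<^sub>1 + a\<^sub>j\<close>. A single such inequality excludes case (i); in
  case (iii) with \<open>\<beta> < 0\<close> dividing by \<open>\<mu>\<^sub>j - \<beta>\<close> and summing yields \<open>g(\<beta>) (\<Sum>k. U\<^sub>k) \<le> 0\<close>, with
  strict inequality if some \<open>a\<^sub>j < -\<Lambda>\<^sub>1\<close>; case (iv) reduces to these two arguments.

  The principal eigenvalue is only known as an infimum of eigenvalues, so the minimiser is also needed to
  see that this set is nonempty. It comes from Rellich's theorem; the nonzero test function that
  starts the minimisation is an approximation of the hypothetical solution.
\<close>

section \<open>Square-integrable functions\<close>

text \<open>Testing with the ground state \<open>e\<close> itself would produce integrals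
  \<open>\<integral> u_k^2 u_j e\<close>, which differ from one equation to the next. The quotient
  \<open>\<phi>^2 / u_j\<close> removes the weight \<open>u_j\<close>: all inequalities become
  linear in the same unknowns \<open>U_1, ..., U_n\<close>, with \<open>\<mu>_j\<close> on the
  diagonal and \<open>\<beta>\<close> elsewhere. When \<open>\<beta>\<close> differs from all
  \<open>\<mu>_j\<close>, the determinant of this matrix is \<open>g(\<beta>)\<close> times the
  product of the \<open>\<mu>_j - \<beta>\<close>, which explains the threshold in the focusing
  case. Since only \<open>e^2\<close> appears, neither sign nor regularity of \<open>e\<close>
  matters. The obstacle is that solutions are merely in \<open>H_0^1\<close>, while the equation may
  be tested with smooth compactly supported functions only. Every other test is a limit, and as
  \<open>c_j\<close> is only square integrable, products of two factors must converge in
  \<open>L^2\<close>. That is the role of the \<open>L^4\<close> bound; membership in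
  \<open>L^4\<close> is expressed by squares lying in \<open>L2\<close>. Gradients of a minimising
  sequence converge strongly by the parallelogram law, so no weak convergence occurs.\<close>

definition L2 :: "'a measure \<Rightarrow> ('a \<Rightarrow> 'b::euclidean_space) set" where
  "L2 M = {f \<in> borel_measurable M. integrable M (\<lambda>x. (norm (f x))\<^sup>2)}"

text \<open>Membership is part of the notion because the integral of a non-integrable function is 0,
  so the limit alone could hold vacuously. Functions are not identified almost everywhere; Euclidean
  values let functions and gradients share one theory.\<close>

definition L2_tendsto :: "'a measure \<Rightarrow> (nat \<Rightarrow> 'a \<Rightarrow> 'b::euclidean_space) \<Rightarrow> ('a \<Rightarrow> 'b) \<Rightarrow> bool" where
  "L2_tendsto M f g \<longleftrightarrow> (\<forall>k. f k \<in> L2 M) \<and> g \<in> L2 M \<and>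
     (\<lambda>k. \<integral>x. (norm (f k x - g x))\<^sup>2 \<partial>M) \<longlonglongrightarrow> 0"

lemma L2_measurable[measurable_dest]: "f \<in> L2 M \<Longrightarrow> f \<in> borel_measurable M"
  by (simp add: L2_def)

lemma L2_integrable_norm: "f \<in> L2 M \<Longrightarrow> integrable M (\<lambda>x. (norm (f x))\<^sup>2)"
  by (simp add: L2_def)

lemma L2_I:
  fixes f :: "'a \<Rightarrow> 'b::euclidean_space"
  shows "f \<in> borel_measurable M \<Longrightarrow> integrable M (\<lambda>x. (norm (f x))\<^sup>2) \<Longrightarrow> f \<in> L2 M"
  by (simp add: L2_def)

lemma norm_add_sq_le:
  fixes a b :: "'b::real_inner"
  shows "(norm (a + b))\<^sup>2 \<le> 2 * (norm a)\<^sup>2 + 2 * (norm b)\<^sup>2"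
proof -
  have "0 \<le> (norm (a - b))\<^sup>2" by simp
  then show ?thesis
    by (simp add: power2_norm_eq_inner algebra_simps inner_commute)
qed

lemma norm_diff_sq_le:
  fixes a b :: "'b::real_inner"
  shows "(norm (a - b))\<^sup>2 \<le> 2 * (norm a)\<^sup>2 + 2 * (norm b)\<^sup>2"
  using norm_add_sq_le[of a "-b"] by simp

lemma abs_inner_le_sum_sq:
  fixes a b :: "'b::real_inner"
  shows "\<bar>a \<bullet> b\<bar> \<le> (norm a)\<^sup>2 + (norm b)\<^sup>2"
proof -
  have "\<bar>a \<bullet> b\<bar> \<le> norm a * norm b" by (rule Cauchy_Schwarz_ineq2)
  moreover have "2 * norm a * norm b \<le> (norm a)\<^sup>2 + (norm b)\<^sup>2" by (rule sum_squares_bound)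
  moreover have "0 \<le> norm a * norm b" by simp
  ultimately show ?thesis by linarith
qed

lemma L2_add[intro]:
  assumes "f \<in> L2 M" "g \<in> L2 M" shows "(\<lambda>x. f x + g x) \<in> L2 M"
proof (rule L2_I)
  note [measurable] = assms[THEN L2_measurable]
  show "integrable M (\<lambda>x. (norm (f x + g x))\<^sup>2)"
    by (rule Bochner_Integration.integrable_bound
          [where f="\<lambda>x. 2 * (norm (f x))\<^sup>2 + 2 * (norm (g x))\<^sup>2"])
       (use assms[THEN L2_integrable_norm] norm_add_sq_le in auto)
  show "(\<lambda>x. f x + g x) \<in> borel_measurable M" by measurable
qed

lemma L2_scaleR[intro]:
  assumes "f \<in> L2 M" shows "(\<lambda>x. c *\<^sub>R f x) \<in> L2 M"
proof (rule L2_I)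
  note [measurable] = assms[THEN L2_measurable]
  show "integrable M (\<lambda>x. (norm (c *\<^sub>R f x))\<^sup>2)"
    using assms[THEN L2_integrable_norm] by (simp add: power_mult_distrib)
  show "(\<lambda>x. c *\<^sub>R f x) \<in> borel_measurable M" by measurable
qed

lemma L2_diff[intro]:
  assumes "f \<in> L2 M" "g \<in> L2 M" shows "(\<lambda>x. f x - g x) \<in> L2 M"
  using L2_add[OF assms(1) L2_scaleR[OF assms(2), of "-1"]] by simp

lemma L2_bounded_mult:
  fixes f :: "'a \<Rightarrow> 'b::euclidean_space" and b :: "'a \<Rightarrow> real"
  assumes f: "f \<in> L2 M" and b[measurable]: "b \<in> borel_measurable M" and C: "\<And>x. \<bar>b x\<bar> \<le> C"
  shows "(\<lambda>x. b x *\<^sub>R f x) \<in> L2 M"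
proof (rule L2_I)
  note [measurable] = f[THEN L2_measurable]
  show "integrable M (\<lambda>x. (norm (b x *\<^sub>R f x))\<^sup>2)"
  proof (rule Bochner_Integration.integrable_bound[where f="\<lambda>x. C\<^sup>2 * (norm (f x))\<^sup>2"])
    show "AE x in M. norm ((norm (b x *\<^sub>R f x))\<^sup>2) \<le> norm (C\<^sup>2 * (norm (f x))\<^sup>2)"
    proof (rule AE_I2)
      fix x
      have "(b x)\<^sup>2 \<le> C\<^sup>2" using C[of x] by (simp add: abs_le_square_iff[symmetric])
      then show "norm ((norm (b x *\<^sub>R f x))\<^sup>2) \<le> norm (C\<^sup>2 * (norm (f x))\<^sup>2)"
        by (simp add: power_mult_distrib mult_right_mono)
    qed
  qed (use f[THEN L2_integrable_norm] in auto)
  show "(\<lambda>x. b x *\<^sub>R f x) \<in> borel_measurable M" by measurable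
qed

lemma L2_integrable_inner:
  assumes "f \<in> L2 M" "g \<in> L2 M" shows "integrable M (\<lambda>x. f x \<bullet> g x)"
proof -
  note [measurable] = assms[THEN L2_measurable]
  show ?thesis
    by (rule Bochner_Integration.integrable_bound
          [where f="\<lambda>x. (norm (f x))\<^sup>2 + (norm (g x))\<^sup>2"])
       (use assms[THEN L2_integrable_norm] abs_inner_le_sum_sq in auto)
qed

text \<open>The quadratic polynomial \<open>\<integral> |f - t g|^2\<close> in \<open>t\<close> is
  nonnegative; a suitable \<open>t\<close> gives the bound.\<close>

lemma L2_Cauchy_Schwarz:
  assumes f: "f \<in> L2 M" and g: "g \<in> L2 M"
  shows "(\<integral>x. f x \<bullet> g x \<partial>M)\<^sup>2 \<le> (\<integral>x. (norm (f x))\<^sup>2 \<partial>M) * (\<integral>x. (norm (g x))\<^sup>2 \<partial>M)"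
proof -
  define A B C where "A = (\<integral>x. (norm (f x))\<^sup>2 \<partial>M)" and "B = (\<integral>x. f x \<bullet> g x \<partial>M)"
    and "C = (\<integral>x. (norm (g x))\<^sup>2 \<partial>M)"
  have quad: "0 \<le> A - 2 * t * B + t\<^sup>2 * C" for t
  proof -
    have "0 \<le> (\<integral>x. (norm (f x - t *\<^sub>R g x))\<^sup>2 \<partial>M)" by simp
    also have "\<dots> = (\<integral>x. (norm (f x))\<^sup>2 - 2 * t * (f x \<bullet> g x) + t\<^sup>2 * (norm (g x))\<^sup>2 \<partial>M)"
      by (rule arg_cong[where f="integral\<^sup>L M"])
         (auto simp: fun_eq_iff power2_norm_eq_inner algebra_simps inner_commute, simp add: power2_eq_square)
    also have "\<dots> = A - 2 * t * B + t\<^sup>2 * C"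
      unfolding A_def B_def C_def
      using f[THEN L2_integrable_norm] g[THEN L2_integrable_norm] L2_integrable_inner[OF f g]
      by simp
    finally show ?thesis .
  qed
  have "0 \<le> C" "0 \<le> A" unfolding A_def C_def by auto
  show ?thesis
  proof (cases "C = 0")
    case True
    have "B = 0"
    proof (rule ccontr)
      assume "B \<noteq> 0"
      \<comment> \<open>For \<open>C = 0\<close> the polynomial is linear, and this \<open>t\<close>
        gives it the value -1.\<close>
      with quad[of "(A + 1) / (2 * B)"] True show False by simp
    qed
    then show ?thesis using \<open>0 \<le> C\<close> \<open>0 \<le> A\<close> unfolding A_def B_def C_def by simp
  next
    case False
    with \<open>0 \<le> C\<close> have "0 < C" by simp
    \<comment> \<open>\<open>B / C\<close> minimises the polynomial.\<close>
    have "0 \<le> A - B\<^sup>2 / C"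
      using quad[of "B / C"] \<open>0 < C\<close> by (simp add: power2_eq_square field_simps)
    then have "B\<^sup>2 \<le> A * C" using \<open>0 < C\<close> by (simp add: field_simps)
    then show ?thesis unfolding A_def B_def C_def .
  qed
qed

lemma L2_tendstoD:
  assumes "L2_tendsto M f g"
  shows "\<And>k. f k \<in> L2 M" "g \<in> L2 M" "(\<lambda>k. \<integral>x. (norm (f k x - g x))\<^sup>2 \<partial>M) \<longlonglongrightarrow> 0"
  using assms by (auto simp: L2_tendsto_def)

lemma L2_tendsto_subseq:
  assumes "L2_tendsto M f g" "strict_mono r"
  shows "L2_tendsto M (\<lambda>k. f (r k)) g"
  using assms LIMSEQ_subseq_LIMSEQ[OF L2_tendstoD(3)[OF assms(1)] assms(2)]
  by (auto simp: L2_tendsto_def o_def)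

lemma L2_tendsto_const: "f \<in> L2 M \<Longrightarrow> L2_tendsto M (\<lambda>k. f) f"
  by (simp add: L2_tendsto_def)

lemma L2_tendsto_squeeze:
  assumes "\<And>k. f k \<in> L2 M" "g \<in> L2 M"
    and "\<And>k. (\<integral>x. (norm (f k x - g x))\<^sup>2 \<partial>M) \<le> e k" "e \<longlonglongrightarrow> 0"
  shows "L2_tendsto M f g"
  unfolding L2_tendsto_def
  by (intro conjI allI assms(1,2) tendsto_sandwich[OF _ _ tendsto_const assms(4)])
     (use assms(3) in auto)

lemma L2_tendsto_add:
  assumes f: "L2_tendsto M f f'" and g: "L2_tendsto M g g'"
  shows "L2_tendsto M (\<lambda>k x. f k x + g k x) (\<lambda>x. f' x + g' x)"
proof (rule L2_tendsto_squeeze)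
  note fD = L2_tendstoD[OF f] and gD = L2_tendstoD[OF g]
  show "(\<lambda>x. f k x + g k x) \<in> L2 M" "(\<lambda>x. f' x + g' x) \<in> L2 M" for k
    using fD gD by auto
  show "(\<lambda>k. 2 * (\<integral>x. (norm (f k x - f' x))\<^sup>2 \<partial>M) + 2 * (\<integral>x. (norm (g k x - g' x))\<^sup>2 \<partial>M)) \<longlonglongrightarrow> 0"
    using tendsto_add[OF tendsto_mult_right_zero[OF fD(3), of 2] tendsto_mult_right_zero[OF gD(3), of 2]] by simp
  fix k
  have i: "integrable M (\<lambda>x. (norm (f k x - f' x))\<^sup>2)" "integrable M (\<lambda>x. (norm (g k x - g' x))\<^sup>2)"
    using fD gD by (auto intro!: L2_integrable_norm)
  have "(\<integral>x. (norm (f k x + g k x - (f' x + g' x)))\<^sup>2 \<partial>M)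
    \<le> (\<integral>x. 2 * (norm (f k x - f' x))\<^sup>2 + 2 * (norm (g k x - g' x))\<^sup>2 \<partial>M)"
  proof (rule integral_mono)
    show "integrable M (\<lambda>x. (norm (f k x + g k x - (f' x + g' x)))\<^sup>2)"
      using fD gD by (intro L2_integrable_norm L2_diff L2_add) auto
    show "(norm (f k x + g k x - (f' x + g' x)))\<^sup>2 \<le> 2 * (norm (f k x - f' x))\<^sup>2 + 2 * (norm (g k x - g' x))\<^sup>2" for x
      using norm_add_sq_le[of "f k x - f' x" "g k x - g' x"] by (simp add: algebra_simps)
  qed (use i in auto)
  also have "\<dots> = 2 * (\<integral>x. (norm (f k x - f' x))\<^sup>2 \<partial>M) + 2 * (\<integral>x. (norm (g k x - g' x))\<^sup>2 \<partial>M)"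
    using i by simp
  finally show "(\<integral>x. (norm (f k x + g k x - (f' x + g' x)))\<^sup>2 \<partial>M) \<le> \<dots>" .
qed

lemma L2_tendsto_inner:
  assumes f: "L2_tendsto M f f'" and g: "L2_tendsto M g g'"
  shows "(\<lambda>k. \<integral>x. f k x \<bullet> g k x \<partial>M) \<longlonglongrightarrow> (\<integral>x. f' x \<bullet> g' x \<partial>M)"
proof -
  note fD = L2_tendstoD[OF f] and gD = L2_tendstoD[OF g]
  let ?F = "\<lambda>k x. f k x - f' x" and ?G = "\<lambda>k x. g k x - g' x"
  have FL: "?F k \<in> L2 M" and GL: "?G k \<in> L2 M" for k using fD gD by auto
  have to0: "(\<lambda>k. \<integral>x. p k x \<bullet> q k x \<partial>M) \<longlonglongrightarrow> 0"
    if "\<And>k. p k \<in> L2 M" "\<And>k. q k \<in> L2 M"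
      "(\<lambda>k. (\<integral>x. (norm (p k x))\<^sup>2 \<partial>M) * (\<integral>x. (norm (q k x))\<^sup>2 \<partial>M)) \<longlonglongrightarrow> 0"
    for p q :: "nat \<Rightarrow> 'a \<Rightarrow> 'b"
  proof -
    have "(\<lambda>k. (\<integral>x. p k x \<bullet> q k x \<partial>M)\<^sup>2) \<longlonglongrightarrow> 0"
      by (rule tendsto_sandwich[OF _ _ tendsto_const that(3)])
         (auto intro!: always_eventually L2_Cauchy_Schwarz that)
    then show ?thesis by (subst (asm) power_tendsto_0_iff) auto
  qed
  have 1: "(\<lambda>k. \<integral>x. ?F k x \<bullet> ?G k x \<partial>M) \<longlonglongrightarrow> 0"
    by (rule to0[OF FL GL]) (use tendsto_mult[OF fD(3) gD(3)] in simp)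
  have 2: "(\<lambda>k. \<integral>x. ?F k x \<bullet> g' x \<partial>M) \<longlonglongrightarrow> 0"
    by (rule to0[OF FL gD(2)]) (rule tendsto_mult_left_zero[OF fD(3)])
  have 3: "(\<lambda>k. \<integral>x. f' x \<bullet> ?G k x \<partial>M) \<longlonglongrightarrow> 0"
    by (rule to0[OF fD(2) GL]) (rule tendsto_mult_right_zero[OF gD(3)])
  have eq: "(\<integral>x. f k x \<bullet> g k x \<partial>M) = (\<integral>x. ?F k x \<bullet> ?G k x \<partial>M) + (\<integral>x. ?F k x \<bullet> g' x \<partial>M)
      + (\<integral>x. f' x \<bullet> ?G k x \<partial>M) + (\<integral>x. f' x \<bullet> g' x \<partial>M)" for k
  proof -
    have "f k x \<bullet> g k x = ?F k x \<bullet> ?G k x + ?F k x \<bullet> g' x + f' x \<bullet> ?G k x + f' x \<bullet> g' x" for x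
      by (simp add: algebra_simps)
    then show ?thesis
      using L2_integrable_inner[OF FL GL] L2_integrable_inner[OF FL gD(2)]
        L2_integrable_inner[OF fD(2) GL] L2_integrable_inner[OF fD(2) gD(2)]
      by (simp del: inner_diff_left inner_diff_right)
  qed
  show ?thesis unfolding eq
    using tendsto_add[OF tendsto_add[OF tendsto_add[OF 1 2] 3] tendsto_const[of "\<integral>x. f' x \<bullet> g' x \<partial>M"]]
    by simp
qed

lemma L2_tendsto_norm:
  assumes f: "L2_tendsto M f f'"
  shows "(\<lambda>k. \<integral>x. (norm (f k x))\<^sup>2 \<partial>M) \<longlonglongrightarrow> (\<integral>x. (norm (f' x))\<^sup>2 \<partial>M)"
  using L2_tendsto_inner[OF f f] by (simp add: power2_norm_eq_inner)

lemma L2_tendsto_AE_subseq: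
  assumes f: "L2_tendsto M f g"
  obtains r where "strict_mono r" "AE x in M. (\<lambda>k. f (r k) x) \<longlonglongrightarrow> g x"
proof -
  note fD = L2_tendstoD[OF f]
  have "\<exists>r::nat\<Rightarrow>nat. strict_mono r \<and> (AE x in M. (\<lambda>n. (norm (f (r n) x - g x))\<^sup>2) \<longlonglongrightarrow> 0)"
    by (rule tendsto_L1_AE_subseq)
       (use fD in \<open>auto intro!: L2_integrable_norm\<close>)
  then obtain r where r: "strict_mono r" "AE x in M. (\<lambda>n. (norm (f (r n) x - g x))\<^sup>2) \<longlonglongrightarrow> 0"
    by auto
  have "AE x in M. (\<lambda>k. f (r k) x) \<longlonglongrightarrow> g x"
    using r(2)
  proof eventually_elim
    case (elim x)
    then have "(\<lambda>n. norm (f (r n) x - g x)) \<longlonglongrightarrow> 0"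
      by (subst (asm) power_tendsto_0_iff) auto
    then show ?case by (rule LIM_zero_cancel[OF tendsto_norm_zero_cancel])
  qed
  with r(1) show ?thesis using that by blast
qed

text \<open>Write \<open>b_k f_k - b' f' = b_k (f_k - f') + (b_k - b') f'\<close>: the first part is
  small by the uniform bound, the second by dominated convergence with majorant
  \<open>4 C^2 |f'|^2\<close>. This is the tool for passing to the limit in the nonlinear test
  functions of Picone's inequality.\<close>

lemma L2_tendsto_bounded_mult:
  fixes f :: "nat \<Rightarrow> 'a \<Rightarrow> 'b::euclidean_space" and b :: "nat \<Rightarrow> 'a \<Rightarrow> real"
  assumes f: "L2_tendsto M f f'"
    and b[measurable]: "\<And>k. b k \<in> borel_measurable M" "b' \<in> borel_measurable M"
    and C: "\<And>k x. \<bar>b k x\<bar> \<le> C" "\<And>x. \<bar>b' x\<bar> \<le> C"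
    and lim: "AE x in M. (\<lambda>k. b k x) \<longlonglongrightarrow> b' x"
  shows "L2_tendsto M (\<lambda>k x. b k x *\<^sub>R f k x) (\<lambda>x. b' x *\<^sub>R f' x)"
proof (rule L2_tendsto_squeeze)
  note fD = L2_tendstoD[OF f]
  note [measurable] = fD(1,2)[THEN L2_measurable]
  show L: "(\<lambda>x. b k x *\<^sub>R f k x) \<in> L2 M" "(\<lambda>x. b' x *\<^sub>R f' x) \<in> L2 M" for k
    using fD C by (auto intro!: L2_bounded_mult)
  have sq: "\<bar>b k x\<bar>\<^sup>2 \<le> C\<^sup>2" "\<bar>b' x\<bar>\<^sup>2 \<le> C\<^sup>2" for k x
    using C by (meson power_mono abs_ge_zero)+
  have bd: "(b k x - b' x)\<^sup>2 \<le> 4 * C\<^sup>2" for k x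
    using norm_diff_sq_le[of "b k x" "b' x"] sq(1)[of k x] sq(2)[of x] by simp
  have if1: "integrable M (\<lambda>x. (norm (f k x - f' x))\<^sup>2)" for k
    using fD by (auto intro!: L2_integrable_norm)
  have if2: "integrable M (\<lambda>x. (b k x - b' x)\<^sup>2 * (norm (f' x))\<^sup>2)" for k
    by (rule Bochner_Integration.integrable_bound[where f="\<lambda>x. 4 * C\<^sup>2 * (norm (f' x))\<^sup>2"])
       (use fD(2)[THEN L2_integrable_norm] bd in \<open>auto intro!: mult_right_mono simp: abs_mult\<close>)
  have "(\<lambda>k. \<integral>x. (b k x - b' x)\<^sup>2 * (norm (f' x))\<^sup>2 \<partial>M) \<longlonglongrightarrow> (\<integral>x. 0 \<partial>M)"
  proof (rule integral_dominated_convergence[where w="\<lambda>x. 4 * C\<^sup>2 * (norm (f' x))\<^sup>2"])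
    show "integrable M (\<lambda>x. 4 * C\<^sup>2 * (norm (f' x))\<^sup>2)"
      using fD(2)[THEN L2_integrable_norm] by simp
    show "AE x in M. (\<lambda>k. (b k x - b' x)\<^sup>2 * (norm (f' x))\<^sup>2) \<longlonglongrightarrow> 0"
      using lim by eventually_elim
        (auto intro!: tendsto_eq_intros)
    show "AE x in M. norm ((b k x - b' x)\<^sup>2 * (norm (f' x))\<^sup>2) \<le> 4 * C\<^sup>2 * (norm (f' x))\<^sup>2" for k
      using bd by (auto intro!: mult_right_mono simp: abs_mult)
  qed measurable
  then show "(\<lambda>k. 2 * C\<^sup>2 * (\<integral>x. (norm (f k x - f' x))\<^sup>2 \<partial>M)
      + 2 * (\<integral>x. (b k x - b' x)\<^sup>2 * (norm (f' x))\<^sup>2 \<partial>M)) \<longlonglongrightarrow> 0"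
    using tendsto_add[OF tendsto_mult_right_zero[OF fD(3), of "2 * C\<^sup>2"] tendsto_mult_right_zero[of _ _ 2]] by simp
  fix k
  have "(\<integral>x. (norm (b k x *\<^sub>R f k x - b' x *\<^sub>R f' x))\<^sup>2 \<partial>M)
    \<le> (\<integral>x. 2 * C\<^sup>2 * (norm (f k x - f' x))\<^sup>2 + 2 * ((b k x - b' x)\<^sup>2 * (norm (f' x))\<^sup>2) \<partial>M)"
  proof (rule integral_mono)
    show "integrable M (\<lambda>x. (norm (b k x *\<^sub>R f k x - b' x *\<^sub>R f' x))\<^sup>2)"
      using L by (auto intro!: L2_integrable_norm)
    fix x
    have "(norm (b k x *\<^sub>R f k x - b' x *\<^sub>R f' x))\<^sup>2
      = (norm (b k x *\<^sub>R (f k x - f' x) + (b k x - b' x) *\<^sub>R f' x))\<^sup>2"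
      by (simp add: algebra_simps)
    also have "\<dots> \<le> 2 * (\<bar>b k x\<bar>\<^sup>2 * (norm (f k x - f' x))\<^sup>2) + 2 * ((b k x - b' x)\<^sup>2 * (norm (f' x))\<^sup>2)"
      using norm_add_sq_le[of "b k x *\<^sub>R (f k x - f' x)" "(b k x - b' x) *\<^sub>R f' x"]
      by (simp add: power_mult_distrib)
    also have "\<dots> \<le> 2 * (C\<^sup>2 * (norm (f k x - f' x))\<^sup>2) + 2 * ((b k x - b' x)\<^sup>2 * (norm (f' x))\<^sup>2)"
      by (intro add_right_mono mult_left_mono mult_right_mono sq) auto
    finally show "(norm (b k x *\<^sub>R f k x - b' x *\<^sub>R f' x))\<^sup>2 \<le>
      2 * C\<^sup>2 * (norm (f k x - f' x))\<^sup>2 + 2 * ((b k x - b' x)\<^sup>2 * (norm (f' x))\<^sup>2)" by simp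
  qed (use if1 if2 in auto)
  also have "\<dots> = 2 * C\<^sup>2 * (\<integral>x. (norm (f k x - f' x))\<^sup>2 \<partial>M)
      + 2 * (\<integral>x. (b k x - b' x)\<^sup>2 * (norm (f' x))\<^sup>2 \<partial>M)"
    using if1 if2 by simp
  finally show "(\<integral>x. (norm (b k x *\<^sub>R f k x - b' x *\<^sub>R f' x))\<^sup>2 \<partial>M) \<le> \<dots>" .
qed

section \<open>Completeness of the space of square-integrable functions\<close>

lemma strict_mono_choice:
  fixes P :: "nat \<Rightarrow> nat \<Rightarrow> bool"
  assumes "\<And>k. \<exists>N. \<forall>n\<ge>N. P k n"
  obtains r :: "nat \<Rightarrow> nat" where "strict_mono r" "\<And>k. \<forall>n\<ge>r k. P k n"
proof -
  have "\<exists>r. \<forall>k. (\<forall>n\<ge>r k. P k n) \<and> r k < r (Suc k)"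
  proof (rule dependent_nat_choice)
    show "\<exists>x. \<forall>n\<ge>x. P 0 n" by (rule assms)
  next
    fix x k
    obtain N where "\<forall>n\<ge>N. P (Suc k) n" using assms by blast
    then show "\<exists>y. (\<forall>n\<ge>y. P (Suc k) n) \<and> x < y"
      by (intro exI[of _ "max N (Suc x)"]) auto
  qed
  then show ?thesis using that by (metis strict_mono_Suc_iff)
qed

text \<open>The Riesz-Fischer argument: along a subsequence with squared increments below
  \<open>(1/4)^k\<close> the increments are summable almost everywhere, and Fatou's lemma carries
  the Cauchy condition to the pointwise limit.\<close>

lemma L2_complete:
  fixes f :: "nat \<Rightarrow> 'a \<Rightarrow> 'b::euclidean_space"
  assumes "finite_measure M" and fL: "\<And>k. f k \<in> L2 M"
    and cauchy: "\<And>e. e > 0 \<Longrightarrow> \<exists>N. \<forall>k\<ge>N. \<forall>l\<ge>N. (\<integral>x. (norm (f k x - f l x))\<^sup>2 \<partial>M) < e"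
  obtains g where "L2_tendsto M f g"
proof -
  interpret finite_measure M by fact
  note [measurable] = fL[THEN L2_measurable]
  have "\<exists>N. \<forall>n\<ge>N. \<forall>m\<ge>n. (\<integral>x. (norm (f n x - f m x))\<^sup>2 \<partial>M) < (1/4)^k" for k :: nat
  proof -
    obtain N where "\<forall>n\<ge>N. \<forall>m\<ge>N. (\<integral>x. (norm (f n x - f m x))\<^sup>2 \<partial>M) < (1/4)^k"
      using cauchy[of "(1/4)^k"] by auto
    then show ?thesis using le_trans by (intro exI[of _ N] allI impI) blast
  qed
  then obtain r where r: "strict_mono r"
    and rk: "\<And>k. \<forall>n\<ge>r k. \<forall>m\<ge>n. (\<integral>x. (norm (f n x - f m x))\<^sup>2 \<partial>M) < (1/4)^k"
    by (rule strict_mono_choice[of "\<lambda>k n. \<forall>m\<ge>n. (\<integral>x. (norm (f n x - f m x))\<^sup>2 \<partial>M) < (1/4)^k"]) blast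
  define d where "d k x = norm (f (r (Suc k)) x - f (r k) x)" for k x
  have [measurable]: "d k \<in> borel_measurable M" for k unfolding d_def by measurable
  have d0: "0 \<le> d k x" for k x by (simp add: d_def)
  have dsq: "(\<integral>x. (d k x)\<^sup>2 \<partial>M) < (1/4)^k" for k
    using rk[of k] r by (auto simp: d_def norm_minus_commute strict_mono_less_eq)
  have dint: "integrable M (\<lambda>x. (d k x)\<^sup>2)" for k
    unfolding d_def using fL by (auto intro!: L2_integrable_norm)
  \<comment> \<open>Trades squares for first powers: the constant \<open>(1/2)^k\<close> has
    integral \<open>(1/2)^k V\<close> by finiteness of the measure, and the weight
    \<open>2^k\<close> against \<open>(1/4)^k\<close> leaves another \<open>(1/2)^k\<close>.\<close>
  have d1: "d k x \<le> (1/2)^k + 2^k * (d k x)\<^sup>2" for k x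
  proof -
    have "0 \<le> (1/2)^k * (2^k * d k x - 1)\<^sup>2 + d k x" by (simp add: d_def)
    also have "\<dots> = (1/2)^k + 2^k * (d k x)\<^sup>2 - d k x"
      by (simp add: power2_eq_square algebra_simps power_one_over)
    finally show ?thesis by simp
  qed
  have dint1: "integrable M (d k)" for k
    by (rule Bochner_Integration.integrable_bound[where f="\<lambda>x. (1/2)^k + 2^k * (d k x)\<^sup>2"])
       (use dint d1 in \<open>auto simp: d_def\<close>)
  define V where "V = measure M (space M)"
  have dI: "(\<integral>x. d k x \<partial>M) \<le> (1/2)^k * (V + 1)" for k
  proof -
    have "(\<integral>x. d k x \<partial>M) \<le> (\<integral>x. (1/2)^k + 2^k * (d k x)\<^sup>2 \<partial>M)"
      by (rule integral_mono) (use dint dint1 d1 in auto)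
    also have "\<dots> = (1/2)^k * V + 2^k * (\<integral>x. (d k x)\<^sup>2 \<partial>M)"
      using dint by (simp add: V_def)
    also have "\<dots> \<le> (1/2)^k * V + 2^k * (1/4)^k"
      using dsq[of k] by (intro add_left_mono mult_left_mono) auto
    also have "\<dots> = (1/2)^k * (V + 1)"
    proof -
      have "2^k * (1/4::real)^k = (1/2)^k" by (simp only: power_mult_distrib[symmetric]) simp
      then show ?thesis by (simp add: distrib_left)
    qed
    finally show ?thesis .
  qed
  have "(\<integral>\<^sup>+x. (\<Sum>k. ennreal (d k x)) \<partial>M) = (\<Sum>k. \<integral>\<^sup>+x. ennreal (d k x) \<partial>M)"
    by (rule nn_integral_suminf) measurable
  also have "\<dots> \<le> (\<Sum>k. ennreal ((1/2)^k * (V + 1)))"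
  proof (intro suminf_le)
    fix k
    have "(\<integral>\<^sup>+x. ennreal (d k x) \<partial>M) = ennreal (\<integral>x. d k x \<partial>M)"
      using dint1 d0 by (intro nn_integral_eq_integral) auto
    then show "(\<integral>\<^sup>+x. ennreal (d k x) \<partial>M) \<le> ennreal ((1/2)^k * (V + 1))"
      using dI[of k] by (simp add: ennreal_leI)
  qed auto
  also have "\<dots> < \<infinity>"
  proof -
    have "summable (\<lambda>k. (1/2::real)^k * (V + 1))"
      by (intro summable_mult2 summable_geometric) simp
    then show ?thesis
      by (subst suminf_ennreal2) (auto simp: V_def)
  qed
  finally have "(\<integral>\<^sup>+x. (\<Sum>k. ennreal (d k x)) \<partial>M) \<noteq> \<infinity>" by simp
  then have "AE x in M. (\<Sum>k. ennreal (d k x)) \<noteq> \<infinity>"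
    by (intro nn_integral_PInf_AE) measurable
  then have conv: "AE x in M. convergent (\<lambda>k. f (r k) x)"
  proof eventually_elim
    case (elim x)
    then have "summable (\<lambda>k. d k x)"
      by (intro summable_suminf_not_top) (auto simp: d_def)
    then have "summable (\<lambda>k. f (r (Suc k)) x - f (r k) x)"
      unfolding d_def by (rule summable_norm_cancel)
    then have "convergent (\<lambda>n. \<Sum>k<n. f (r (Suc k)) x - f (r k) x)"
      by (simp add: summable_iff_convergent)
    then have "convergent (\<lambda>n. (f (r n) x - f (r 0) x) + f (r 0) x)"
      by (subst (asm) sum_lessThan_telescope) (intro convergent_add convergent_const)
    then show ?case by simp
  qed
  define g where "g x = lim (\<lambda>k. f (r k) x)" for x
  have [measurable]: "g \<in> borel_measurable M"
    unfolding g_def by (rule borel_measurable_lim_metric) measurable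
  have lim: "AE x in M. (\<lambda>k. f (r k) x) \<longlonglongrightarrow> g x"
    using conv by eventually_elim (simp add: g_def convergent_LIMSEQ_iff)
  \<comment> \<open>Letting the second index run through the subsequence bounds the distance to
    \<open>g\<close> for every \<open>k\<close>, so the whole sequence converges and not only the
    subsequence.\<close>
  have fatou: "(\<integral>\<^sup>+x. ennreal ((norm (f k x - g x))\<^sup>2) \<partial>M) \<le> ennreal e"
    if "\<forall>l\<ge>N. (\<integral>x. (norm (f k x - f l x))\<^sup>2 \<partial>M) < e" for k N e
  proof -
    have "(\<integral>\<^sup>+x. ennreal ((norm (f k x - g x))\<^sup>2) \<partial>M)
      = (\<integral>\<^sup>+x. liminf (\<lambda>l. ennreal ((norm (f k x - f (r l) x))\<^sup>2)) \<partial>M)"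
    proof (rule nn_integral_cong_AE)
      show "AE x in M. ennreal ((norm (f k x - g x))\<^sup>2)
        = liminf (\<lambda>l. ennreal ((norm (f k x - f (r l) x))\<^sup>2))"
        using lim
      proof eventually_elim
        case (elim x)
        then have "(\<lambda>l. ennreal ((norm (f k x - f (r l) x))\<^sup>2)) \<longlonglongrightarrow> ennreal ((norm (f k x - g x))\<^sup>2)"
          by (intro tendsto_intros tendsto_ennrealI)
        then show ?case by (intro lim_imp_Liminf[symmetric]) auto
      qed
    qed
    also have "\<dots> \<le> liminf (\<lambda>l. \<integral>\<^sup>+x. ennreal ((norm (f k x - f (r l) x))\<^sup>2) \<partial>M)"
      by (rule nn_integral_liminf) measurable
    also have "\<dots> \<le> liminf (\<lambda>l. ennreal e)"
    proof (rule Liminf_mono, rule eventually_sequentiallyI[of N])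
      fix l assume "l \<ge> N"
      then have "r l \<ge> N" using seq_suble[OF r, of l] by linarith
      have "(\<integral>\<^sup>+x. ennreal ((norm (f k x - f (r l) x))\<^sup>2) \<partial>M) = ennreal (\<integral>x. (norm (f k x - f (r l) x))\<^sup>2 \<partial>M)"
        using fL by (intro nn_integral_eq_integral) (auto intro!: L2_integrable_norm)
      then show "(\<integral>\<^sup>+x. ennreal ((norm (f k x - f (r l) x))\<^sup>2) \<partial>M) \<le> ennreal e"
        using that[rule_format, OF \<open>r l \<ge> N\<close>] by (simp add: ennreal_leI)
    qed
    also have "\<dots> = ennreal e" by (simp add: Liminf_const)
    finally show ?thesis .
  qed
  obtain N1 where N1: "\<forall>k\<ge>N1. \<forall>l\<ge>N1. (\<integral>x. (norm (f k x - f l x))\<^sup>2 \<partial>M) < 1"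
    using cauchy[of 1] by auto
  have "(\<lambda>x. f N1 x - g x) \<in> L2 M"
  proof (rule L2_I)
    show "integrable M (\<lambda>x. (norm (f N1 x - g x))\<^sup>2)"
      using fatou[where N=N1 and k=N1 and e=1] N1
      by (intro integrableI_bounded) (auto elim!: le_less_trans)
  qed measurable
  then have gL: "g \<in> L2 M" using L2_diff[OF fL[of N1]] by fastforce
  have "(\<lambda>k. \<integral>x. (norm (f k x - g x))\<^sup>2 \<partial>M) \<longlonglongrightarrow> 0"
  proof (rule LIMSEQ_I)
    fix e :: real assume "0 < e"
    obtain N where N: "\<forall>k\<ge>N. \<forall>l\<ge>N. (\<integral>x. (norm (f k x - f l x))\<^sup>2 \<partial>M) < e/2"
      using cauchy[of "e/2"] \<open>0 < e\<close> by auto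
    show "\<exists>no. \<forall>n\<ge>no. norm ((\<integral>x. (norm (f n x - g x))\<^sup>2 \<partial>M) - 0) < e"
    proof (intro exI allI impI)
      fix n assume "n \<ge> N"
      have "ennreal (\<integral>x. (norm (f n x - g x))\<^sup>2 \<partial>M) = (\<integral>\<^sup>+x. ennreal ((norm (f n x - g x))\<^sup>2) \<partial>M)"
        using fL gL by (intro nn_integral_eq_integral[symmetric]) (auto intro!: L2_integrable_norm)
      also have "\<dots> \<le> ennreal (e/2)" using fatou[where N=N and k=n and e="e/2"] N \<open>n \<ge> N\<close> by auto
      finally have "(\<integral>x. (norm (f n x - g x))\<^sup>2 \<partial>M) \<le> e/2" using \<open>0 < e\<close> by (simp add: ennreal_le_iff)
      then show "norm ((\<integral>x. (norm (f n x - g x))\<^sup>2 \<partial>M) - 0) < e" using \<open>0 < e\<close> by simp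
    qed
  qed
  then have "L2_tendsto M f g" using fL gL by (simp add: L2_tendsto_def)
  then show ?thesis using that by simp
qed

section \<open>Smooth functions and test functions\<close>

definition has_partials :: "(real^'n \<Rightarrow> real) \<Rightarrow> ('n \<Rightarrow> real^'n \<Rightarrow> real) \<Rightarrow> bool" where
  "has_partials f d \<longleftrightarrow> (\<forall>x. (f has_derivative (\<lambda>h. \<Sum>i\<in>UNIV. h $ i * d i x)) (at x))"

text \<open>Smoothness as a greatest fixed point: a choice of partials inside \<open>S\<close> can
  be iterated along any index list, which builds the family \<open>D\<close> without explicit
  formulas for higher derivatives.\<close>

lemma smooth_on_UNIV_coinduct:
  fixes f :: "real^'n \<Rightarrow> real"
  assumes "f \<in> S" and step: "\<And>f. f \<in> S \<Longrightarrow> \<exists>d. has_partials f d \<and> (\<forall>i. d i \<in> S)"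
  shows "smooth_on UNIV f"
proof -
  obtain del where del: "\<And>f. f \<in> S \<Longrightarrow> has_partials f (del f) \<and> (\<forall>i. del f i \<in> S)"
    using step by metis
  define D where "D = rec_list f (\<lambda>i _ g. del g i)"
  have DS: "D ks \<in> S" for ks
    by (induction ks) (use assms(1) del in \<open>auto simp: D_def\<close>)
  show ?thesis
    unfolding smooth_on_def
  proof (intro exI[of _ D] conjI allI ballI)
    show "D [] x = f x" for x by (simp add: D_def)
    show "(D ks has_derivative (\<lambda>h. \<Sum>i\<in>UNIV. h $ i * D (i # ks) x)) (at x)" for ks x
      using del[OF DS[of ks]] by (simp add: has_partials_def D_def)
  qed
qed

lemma smooth_on_UNIV_partials:
  fixes f :: "real^'n \<Rightarrow> real"
  assumes "smooth_on UNIV f"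
  obtains d where "has_partials f d" "\<And>i. smooth_on UNIV (d i)"
proof -
  obtain D where D0: "\<And>x. D [] x = f x"
    and D: "\<And>ks x. (D ks has_derivative (\<lambda>h. \<Sum>i\<in>UNIV. h $ i * D (i # ks) x)) (at x)"
    using assms unfolding smooth_on_def by auto
  have "D [] = f" using D0 by auto
  then have "has_partials f (\<lambda>i. D [i])"
    using D[of "[]"] by (simp add: has_partials_def)
  moreover have "smooth_on UNIV (D [i])" for i
    unfolding smooth_on_def
    \<comment> \<open>The latest derivative stands at the head of the list, so the one taken first
      belongs at the end.\<close>
    by (rule exI[of _ "\<lambda>ks. D (ks @ [i])"]) (use D[of "_ @ [i]"] in simp)
  ultimately show ?thesis using that by blast
qed

text \<open>A class closed under partial derivatives, made for the coinduction above. Powers with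
  real exponent cover both the square root and the reciprocal. Their base is required to be smooth
  rather than in the closure, so that its partials come from \<open>base\<close>; nested powers are
  obtained by applying the resulting closure property twice.\<close>

inductive_set smooth_closure :: "(real^'n \<Rightarrow> real) set" where
  base: "smooth_on UNIV f \<Longrightarrow> f \<in> smooth_closure"
| const: "(\<lambda>x. c) \<in> smooth_closure"
| add: "f \<in> smooth_closure \<Longrightarrow> g \<in> smooth_closure \<Longrightarrow> (\<lambda>x. f x + g x) \<in> smooth_closure"
| mult: "f \<in> smooth_closure \<Longrightarrow> g \<in> smooth_closure \<Longrightarrow> (\<lambda>x. f x * g x) \<in> smooth_closure"
| powr: "smooth_on UNIV f \<Longrightarrow> (\<And>x. f x > 0) \<Longrightarrow> (\<lambda>x. f x powr r) \<in> smooth_closure"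

lemma smooth_closure_partials:
  "f \<in> smooth_closure \<Longrightarrow> \<exists>d. has_partials f d \<and> (\<forall>i. d i \<in> smooth_closure)"
proof (induction rule: smooth_closure.induct)
  case (base f)
  then obtain d where "has_partials f d" "\<And>i. smooth_on UNIV (d i)"
    by (rule smooth_on_UNIV_partials) blast
  then show ?case using smooth_closure.base by blast
next
  case (const c)
  show ?case
    by (rule exI[of _ "\<lambda>i x. 0"]) (auto simp: has_partials_def intro: smooth_closure.const)
next
  case (add f g)
  then obtain d e where "has_partials f d" "has_partials g e"
    and S: "\<And>i. d i \<in> smooth_closure" "\<And>i. e i \<in> smooth_closure" by blast
  then have "has_partials (\<lambda>x. f x + g x) (\<lambda>i x. d i x + e i x)"
    unfolding has_partials_def
    by (auto intro!: derivative_eq_intros simp: fun_eq_iff sum.distrib algebra_simps)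
  then show ?case using S smooth_closure.add by blast
next
  case (mult f g)
  then obtain d e where "has_partials f d" "has_partials g e"
    and S: "\<And>i. d i \<in> smooth_closure" "\<And>i. e i \<in> smooth_closure" by blast
  then have "has_partials (\<lambda>x. f x * g x) (\<lambda>i x. f x * e i x + d i x * g x)"
    unfolding has_partials_def
    by (auto intro!: derivative_eq_intros simp: fun_eq_iff sum.distrib sum_distrib_left sum_distrib_right algebra_simps)
  then show ?case using S mult.hyps smooth_closure.add smooth_closure.mult by blast
next
  case (powr f r)
  then obtain d where d: "has_partials f d" "\<And>i. smooth_on UNIV (d i)"
    by (elim smooth_on_UNIV_partials) blast
  have "has_partials (\<lambda>x. f x powr r) (\<lambda>i x. (r * f x powr (r - 1)) * d i x)"
    unfolding has_partials_def
  proof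
    fix x
    have "((\<lambda>y. y powr r) has_derivative (\<lambda>h. (r * f x powr (r - 1)) * h)) (at (f x))"
      using has_real_derivative_powr[OF powr.hyps(2)[of x], of r]
      by (simp add: has_field_derivative_def)
    from has_derivative_compose[OF d(1)[unfolded has_partials_def, rule_format] this]
    show "((\<lambda>x. f x powr r) has_derivative (\<lambda>h. \<Sum>i\<in>UNIV. h $ i * (r * f x powr (r - 1) * d i x))) (at x)"
      by (simp add: sum_distrib_left algebra_simps)
  qed
  moreover have "(\<lambda>x. (r * f x powr (r - 1)) * d i x) \<in> smooth_closure" for i
    using powr.hyps d(2) by (intro smooth_closure.intros)
  ultimately show ?case by (intro exI[of _ "\<lambda>i x. (r * f x powr (r - 1)) * d i x"] conjI allI)
qed

lemma smooth_closure_smooth: "f \<in> smooth_closure \<Longrightarrow> smooth_on UNIV f"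
  by (rule smooth_on_UNIV_coinduct[OF _ smooth_closure_partials])

lemma smooth_on_UNIV_const: "smooth_on UNIV (\<lambda>x. c)"
  by (rule smooth_closure_smooth[OF smooth_closure.const])

lemma smooth_on_UNIV_add:
  "smooth_on UNIV f \<Longrightarrow> smooth_on UNIV g \<Longrightarrow> smooth_on UNIV (\<lambda>x. f x + g x)"
  by (rule smooth_closure_smooth[OF smooth_closure.add[OF smooth_closure.base smooth_closure.base]])

lemma smooth_on_UNIV_mult:
  "smooth_on UNIV f \<Longrightarrow> smooth_on UNIV g \<Longrightarrow> smooth_on UNIV (\<lambda>x. f x * g x)"
  by (rule smooth_closure_smooth[OF smooth_closure.mult[OF smooth_closure.base smooth_closure.base]])

lemma smooth_on_UNIV_powr:
  "smooth_on UNIV f \<Longrightarrow> (\<And>x. f x > 0) \<Longrightarrow> smooth_on UNIV (\<lambda>x. f x powr r)"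
  by (rule smooth_closure_smooth[OF smooth_closure.powr])

section \<open>Test functions together with their gradients\<close>

definition test_pair :: "(real^'n) set \<Rightarrow> (real^'n \<Rightarrow> real) \<Rightarrow> (real^'n \<Rightarrow> real^'n) \<Rightarrow> bool" where
  "test_pair \<Omega> \<phi> \<psi> \<longleftrightarrow> test_fun \<Omega> \<phi> \<and> (\<forall>x. (\<phi> has_derivative (\<lambda>h. \<psi> x \<bullet> h)) (at x))"

lemma test_pairD:
  assumes "test_pair \<Omega> \<phi> \<psi>"
  shows "test_fun \<Omega> \<phi>" "\<And>x. (\<phi> has_derivative (\<lambda>h. \<psi> x \<bullet> h)) (at x)"
  using assms by (auto simp: test_pair_def)

lemma test_fun_mult_smooth:
  assumes "test_fun \<Omega> \<phi>" "smooth_on UNIV f"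
  shows "test_fun \<Omega> (\<lambda>x. \<phi> x * f x)"
proof -
  have sub: "closure {x. \<phi> x * f x \<noteq> 0} \<subseteq> closure {x. \<phi> x \<noteq> 0}" by (intro closure_mono) auto
  then have "compact (closure {x. \<phi> x * f x \<noteq> 0})"
    using assms(1) unfolding test_fun_def compact_eq_bounded_closed
    by (meson bounded_subset closed_closure)
  then show ?thesis using assms sub smooth_on_UNIV_mult[of \<phi> f] by (auto simp: test_fun_def)
qed

lemma test_fun_add:
  assumes "test_fun \<Omega> \<phi>" "test_fun \<Omega> \<eta>"
  shows "test_fun \<Omega> (\<lambda>x. \<phi> x + \<eta> x)"
proof -
  let ?K = "closure {x. \<phi> x \<noteq> 0} \<union> closure {x. \<eta> x \<noteq> 0}"
  have sub: "closure {x. \<phi> x + \<eta> x \<noteq> 0} \<subseteq> ?K"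
    unfolding closure_Un[symmetric] by (intro closure_mono) auto
  have "compact ?K" using assms by (auto simp: test_fun_def)
  then have "compact (closure {x. \<phi> x + \<eta> x \<noteq> 0})"
    using sub unfolding compact_eq_bounded_closed by (meson bounded_subset closed_closure)
  then show ?thesis using assms sub smooth_on_UNIV_add[of \<phi> \<eta>] by (auto simp: test_fun_def)
qed

lemma test_pair_add:
  assumes "test_pair \<Omega> \<phi> \<psi>" "test_pair \<Omega> \<eta> \<xi>"
  shows "test_pair \<Omega> (\<lambda>x. \<phi> x + \<eta> x) (\<lambda>x. \<psi> x + \<xi> x)"
  using assms by (auto simp: test_pair_def inner_add_left intro!: test_fun_add has_derivative_add)

lemma test_pair_scale:
  assumes "test_pair \<Omega> \<phi> \<psi>"
  shows "test_pair \<Omega> (\<lambda>x. c * \<phi> x) (\<lambda>x. c *\<^sub>R \<psi> x)"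
  using test_fun_mult_smooth[OF test_pairD(1)[OF assms] smooth_on_UNIV_const[of c]]
    has_derivative_mult_right[OF test_pairD(2)[OF assms], of c]
  by (auto simp: test_pair_def mult.commute)

lemma test_pair_diff:
  assumes "test_pair \<Omega> \<phi> \<psi>" "test_pair \<Omega> \<eta> \<xi>"
  shows "test_pair \<Omega> (\<lambda>x. \<phi> x - \<eta> x) (\<lambda>x. \<psi> x - \<xi> x)"
  using test_pair_add[OF assms(1) test_pair_scale[OF assms(2), of "-1"]] by simp

text \<open>Uniqueness of the derivative identifies the coordinates of \<open>\<psi>\<close> with
  the partials supplied by smoothness; these are differentiable themselves, hence
  continuous.\<close>

lemma test_pair_continuous:
  assumes "test_pair \<Omega> \<phi> \<psi>"
  shows "continuous_on UNIV \<phi>" "continuous_on UNIV \<psi>"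
proof -
  note D = test_pairD[OF assms]
  show "continuous_on UNIV \<phi>"
    by (rule continuous_at_imp_continuous_on) (use D(2) has_derivative_continuous in blast)
  obtain d where d: "has_partials \<phi> d" "\<And>i. smooth_on UNIV (d i)"
    using D(1) smooth_on_UNIV_partials unfolding test_fun_def by metis
  have "\<psi> x $ i = d i x" for x i
  proof -
    have eq: "(\<lambda>h. \<psi> x \<bullet> h) = (\<lambda>h. \<Sum>i\<in>UNIV. h $ i * d i x)"
      by (rule has_derivative_unique[OF D(2)]) (use d(1) in \<open>simp add: has_partials_def\<close>)
    have s: "(\<Sum>j\<in>UNIV. (axis i 1 :: real^'a) $ j * d j x) = d i x"
      by (simp add: axis_def if_distrib[where f="\<lambda>a. a * _"] cong: if_cong)
    have "\<psi> x \<bullet> axis i 1 = d i x" using fun_cong[OF eq, of "axis i 1"] s by (rule trans)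
    then show ?thesis by (simp add: inner_axis)
  qed
  moreover have "continuous_on UNIV (d i)" for i
  proof -
    obtain e where "has_partials (d i) e" using d(2) smooth_on_UNIV_partials by blast
    then show ?thesis
      by (intro continuous_at_imp_continuous_on) (auto simp: has_partials_def intro: has_derivative_continuous)
  qed
  ultimately have "continuous_on UNIV (\<lambda>x. \<chi> i. \<psi> x $ i)"
    by (intro continuous_on_vec_lambda) simp
  then show "continuous_on UNIV \<psi>" by simp
qed

lemma test_pair_vanish:
  assumes "test_pair \<Omega> \<phi> \<psi>" "x \<notin> closure {x. \<phi> x \<noteq> 0}"
  shows "\<phi> x = 0" "\<psi> x = 0"
proof -
  show "\<phi> x = 0" using assms(2) closure_subset[of "{x. \<phi> x \<noteq> 0}"] by auto
  have "(\<phi> has_derivative (\<lambda>h. 0)) (at x)"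
  proof (rule has_derivative_transform_within_open[of "\<lambda>x. 0" _ _ _ "- closure {x. \<phi> x \<noteq> 0}"])
    show "0 = \<phi> y" if "y \<in> - closure {x. \<phi> x \<noteq> 0}" for y
      using that closure_subset[of "{x. \<phi> x \<noteq> 0}"] by auto
  qed (use assms(2) in auto)
  then have "(\<lambda>h. \<psi> x \<bullet> h) = (\<lambda>h. 0)"
    by (rule has_derivative_unique[OF test_pairD(2)[OF assms(1)]])
  from fun_cong[OF this, of "\<psi> x"] show "\<psi> x = 0" by simp
qed

lemma test_pair_vanish_outside:
  assumes "test_pair \<Omega> \<phi> \<psi>" "x \<notin> \<Omega>"
  shows "\<phi> x = 0" "\<psi> x = 0"
  using test_pair_vanish[OF assms(1), of x] assms by (auto simp: test_pair_def test_fun_def)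

lemma test_pair_bounded:
  assumes "test_pair \<Omega> \<phi> \<psi>"
  obtains B where "\<And>x. \<bar>\<phi> x\<bar> \<le> B" "\<And>x. norm (\<psi> x) \<le> B" "0 \<le> B"
proof -
  let ?K = "closure {x. \<phi> x \<noteq> 0}"
  have K: "compact ?K" using assms by (simp add: test_pair_def test_fun_def)
  note c = test_pair_continuous[OF assms]
  have "bounded (\<phi> ` ?K)" "bounded (\<psi> ` ?K)"
    using K c by (auto intro!: compact_imp_bounded compact_continuous_image elim: continuous_on_subset)
  then obtain B1 B2 where B: "\<And>x. x \<in> ?K \<Longrightarrow> \<bar>\<phi> x\<bar> \<le> B1" "\<And>x. x \<in> ?K \<Longrightarrow> norm (\<psi> x) \<le> B2"
    by (auto simp: bounded_iff)
  have b1: "\<bar>\<phi> x\<bar> \<le> max 0 (max B1 B2)" for x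
    using B(1)[of x] test_pair_vanish(1)[OF assms, of x] by (cases "x \<in> ?K") auto
  have b2: "norm (\<psi> x) \<le> max 0 (max B1 B2)" for x
    using B(2)[of x] test_pair_vanish(2)[OF assms, of x] by (cases "x \<in> ?K") auto
  show ?thesis by (rule that[OF b1 b2]) simp
qed

text \<open>The two parameters have separate tasks: \<open>\<delta>\<close> removes the corner of
  the modulus at zeros of \<open>v\<close>, and \<open>\<epsilon>\<close> keeps the quotients
  bounded uniformly as \<open>\<delta>\<close> tends to 0.\<close>

lemma test_pair_Picone:
  assumes p: "test_pair \<Omega> \<phi> \<psi>" and v: "test_pair \<Omega> v w" and pos: "\<delta> > 0" "\<epsilon> > 0"
  defines "\<rho> \<equiv> \<lambda>x. sqrt ((v x)\<^sup>2 + \<delta>\<^sup>2)"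
  shows "test_pair \<Omega> (\<lambda>x. (\<phi> x)\<^sup>2 / (\<rho> x + \<epsilon>))
    (\<lambda>x. (2 * \<phi> x / (\<rho> x + \<epsilon>)) *\<^sub>R \<psi> x - ((\<phi> x)\<^sup>2 / (\<rho> x + \<epsilon>)\<^sup>2 * (v x / \<rho> x)) *\<^sub>R w x)"
proof -
  have pos': "(v x)\<^sup>2 + \<delta>\<^sup>2 > 0" for x using pos by (simp add: add_nonneg_pos)
  have rho: "\<rho> x > 0" for x using pos' by (simp add: \<rho>_def)
  have sv: "smooth_on UNIV v" and sp: "smooth_on UNIV \<phi>"
    using p v by (auto simp: test_pair_def test_fun_def)
  \<comment> \<open>Root and reciprocal are the powers \<open>1/2\<close> and \<open>-1\<close> of
    positive smooth functions.\<close>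
  have "smooth_on UNIV (\<lambda>x. ((v x * v x + \<delta>\<^sup>2) powr (1/2) + \<epsilon>) powr (-1))"
    by (intro smooth_on_UNIV_powr smooth_on_UNIV_add smooth_on_UNIV_mult smooth_on_UNIV_const sv)
       (use pos pos' in \<open>auto simp: power2_eq_square add_nonneg_pos\<close>)
  moreover have "((v x * v x + \<delta>\<^sup>2) powr (1/2) + \<epsilon>) powr (-1) = 1 / (\<rho> x + \<epsilon>)" for x
    using pos pos'[of x] rho[of x]
    by (simp add: \<rho>_def powr_minus powr_half_sqrt power2_eq_square field_simps)
  ultimately have "smooth_on UNIV (\<lambda>x. \<phi> x * (1 / (\<rho> x + \<epsilon>)))"
    using sp by (intro smooth_on_UNIV_mult) simp_all
  from test_fun_mult_smooth[OF test_pairD(1)[OF p] this]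
  have 1: "test_fun \<Omega> (\<lambda>x. (\<phi> x)\<^sup>2 / (\<rho> x + \<epsilon>))"
    by (simp add: power2_eq_square)
  have 2: "((\<lambda>x. (\<phi> x)\<^sup>2 / (\<rho> x + \<epsilon>)) has_derivative
     (\<lambda>h. ((2 * \<phi> x / (\<rho> x + \<epsilon>)) *\<^sub>R \<psi> x - ((\<phi> x)\<^sup>2 / (\<rho> x + \<epsilon>)\<^sup>2 * (v x / \<rho> x)) *\<^sub>R w x) \<bullet> h)) (at x)" for x
  proof -
    have d1: "(\<rho> has_derivative (\<lambda>h. (v x / \<rho> x) * (w x \<bullet> h))) (at x)"
      unfolding \<rho>_def using pos'[of x]
      by (auto intro!: derivative_eq_intros test_pairD(2)[OF v] simp: field_simps)
    have alg: "(a * A - b / c) / (A * A) = a / A - b / (A\<^sup>2 * c)" if "A \<noteq> 0" "c \<noteq> 0" for a b c A :: real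
      using that by (simp add: field_simps power2_eq_square)
    have "((\<lambda>x. (\<phi> x)\<^sup>2 / (\<rho> x + \<epsilon>)) has_derivative
      (\<lambda>h. 2 * (\<psi> x \<bullet> h) * \<phi> x / (\<rho> x + \<epsilon>) - (\<phi> x)\<^sup>2 * (v x * (w x \<bullet> h)) / ((\<rho> x + \<epsilon>)\<^sup>2 * \<rho> x))) (at x)"
      using rho[of x] pos alg[of "\<rho> x + \<epsilon>" "\<rho> x"]
      by (auto intro!: derivative_eq_intros d1 test_pairD(2)[OF p] simp: fun_eq_iff)
    then show ?thesis
      by (rule has_derivative_eq_rhs)
         (simp add: fun_eq_iff inner_diff_left mult.commute mult.left_commute)
  qed
  show ?thesis using 1 2 by (simp add: test_pair_def)
qed

section \<open>The fourth power of a test function\<close>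

text \<open>\<open>T\<close> only relabels coordinates, so preimages of boxes are boxes with the
  same side lengths. It lets integrals over \<open>real^'n\<close> be computed on products of real
  lines, where Fubini's theorem applies.\<close>

lemma lborel_distr_basis_bij:
  fixes T :: "'a::euclidean_space \<Rightarrow> 'b::euclidean_space"
  assumes lin: "linear T" and bij: "bij_betw T Basis Basis"
  shows "distr lborel borel T = lborel"
proof (rule lborel_eqI[symmetric])
  have [measurable]: "T \<in> borel_measurable borel"
    using lin by (intro borel_measurable_continuous_onI linear_continuous_on) (simp add: linear_conv_bounded_linear)
  have TB: "T b \<in> Basis" if "b \<in> Basis" for b using bij that by (auto simp: bij_betw_def)
  have inner: "T x \<bullet> T b = x \<bullet> b" if b: "b \<in> Basis" for x b
  proof -
    have "T x = T (\<Sum>c\<in>Basis. (x \<bullet> c) *\<^sub>R c)" by (simp add: euclidean_representation)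
    also have "\<dots> = (\<Sum>c\<in>Basis. (x \<bullet> c) *\<^sub>R T c)"
      using lin by (simp add: linear_sum linear_scale)
    finally have "T x \<bullet> T b = (\<Sum>c\<in>Basis. (x \<bullet> c) * (T c \<bullet> T b))"
      by (simp add: inner_sum_left)
    also have "\<dots> = (\<Sum>c\<in>Basis. if c = b then x \<bullet> b else 0)"
    proof (rule sum.cong)
      fix c assume c: "c \<in> (Basis :: 'a set)"
      have "T c = T b \<longleftrightarrow> c = b" using bij b c by (auto simp: bij_betw_def inj_on_def)
      then show "(x \<bullet> c) * (T c \<bullet> T b) = (if c = b then x \<bullet> b else 0)"
        using TB[OF b] TB[OF c] by (auto simp: inner_Basis)
    qed simp
    finally show ?thesis using b by simp
  qed
  fix l u :: 'b
  assume le: "\<And>b. b \<in> Basis \<Longrightarrow> l \<bullet> b \<le> u \<bullet> b"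
  let ?l = "\<Sum>b\<in>Basis. (l \<bullet> T b) *\<^sub>R b" and ?u = "\<Sum>b\<in>Basis. (u \<bullet> T b) *\<^sub>R b"
  have B: "(Basis :: 'b set) = T ` Basis" using bij by (simp add: bij_betw_def)
  have eq: "T -` box l u = box ?l ?u"
    unfolding box_def B by (auto simp: inner)
  have "emeasure (distr lborel borel T) (box l u) = emeasure lborel (box ?l ?u)"
    by (simp add: emeasure_distr eq)
  also have "\<dots> = (\<Prod>b\<in>Basis. (u - l) \<bullet> T b)"
    by (subst emeasure_lborel_box) (auto simp: le TB inner_diff_left intro!: prod.cong)
  also have "(\<Prod>b\<in>Basis. (u - l) \<bullet> T b) = (\<Prod>b\<in>Basis. (u - l) \<bullet> b)"
    by (rule prod.reindex_bij_betw[OF bij])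
  finally show "emeasure (distr lborel borel T) (box l u) = (\<Prod>b\<in>Basis. (u - l) \<bullet> b)" .
qed simp

lemma nn_integral_basis_bij:
  fixes T :: "'a::euclidean_space \<Rightarrow> 'b::euclidean_space"
  assumes "linear T" "bij_betw T Basis Basis" and f: "f \<in> borel_measurable borel"
  shows "(\<integral>\<^sup>+x. f x \<partial>lborel) = (\<integral>\<^sup>+x. f (T x) \<partial>lborel)"
proof -
  have T: "T \<in> borel_measurable borel"
    using assms(1) by (intro borel_measurable_continuous_onI linear_continuous_on) (simp add: linear_conv_bounded_linear)
  show ?thesis
    by (subst lborel_distr_basis_bij[OF assms(1,2), symmetric])
       (use T f in \<open>simp add: nn_integral_distr\<close>)
qed

text \<open>The fundamental theorem of calculus for the square of \<open>f\<close>, started where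
  \<open>f\<close> vanishes. Stating it in \<open>ennreal\<close> makes integrability of the right
  side irrelevant.\<close>

lemma sq_le_nn_integral_deriv:
  fixes f f' :: "real \<Rightarrow> real"
  assumes deriv: "\<And>x. (f has_real_derivative f' x) (at x)" and cont: "continuous_on UNIV f'"
    and supp: "\<And>x. x \<le> A \<Longrightarrow> f x = 0"
  shows "ennreal ((f x)\<^sup>2) \<le> (\<integral>\<^sup>+t. ennreal (2 * \<bar>f t\<bar> * \<bar>f' t\<bar>) \<partial>lborel)"
proof -
  \<comment> \<open>The minimum also covers \<open>x < A\<close>, where the interval degenerates to
    a point.\<close>
  define a where "a = min A x"
  have a: "f a = 0" "a \<le> x" by (auto simp: a_def supp)
  have cf: "continuous_on UNIV f"
    using deriv by (intro continuous_at_imp_continuous_on) (auto intro: DERIV_isCont)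
  have "isCont f t" "isCont f' t" for t
    using cf cont by (auto simp: continuous_on_eq_continuous_at)
  then have c: "isCont (\<lambda>t. 2 * f t * f' t) t" for t by (intro continuous_intros)
  have d: "((\<lambda>t. (f t)\<^sup>2) has_real_derivative 2 * f t * f' t) (at t)" for t
    by (auto intro!: derivative_eq_intros deriv)
  from has_bochner_integral_FTC_Icc_real[OF a(2) d c]
  have I: "has_bochner_integral lborel (\<lambda>t. 2 * f t * f' t * indicator {a..x} t) ((f x)\<^sup>2)"
    by (simp add: a(1))
  have "ennreal ((f x)\<^sup>2) = ennreal (norm (\<integral>t. 2 * f t * f' t * indicator {a..x} t \<partial>lborel))"
    using I by (simp add: has_bochner_integral_integral_eq)
  also have "\<dots> \<le> (\<integral>\<^sup>+t. ennreal (norm (2 * f t * f' t * indicator {a..x} t)) \<partial>lborel)"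
    using I by (intro integral_norm_bound_ennreal) (auto simp: has_bochner_integral_iff)
  also have "\<dots> \<le> (\<integral>\<^sup>+t. ennreal (2 * \<bar>f t\<bar> * \<bar>f' t\<bar>) \<partial>lborel)"
    by (intro nn_integral_mono ennreal_leI) (auto simp: abs_mult split: split_indicator)
  finally show ?thesis .
qed

lemma ennreal_power4: "ennreal (x ^ 4) = ennreal (x\<^sup>2) * ennreal (x\<^sup>2)" for x :: real
  by (simp add: ennreal_mult[symmetric] power_numeral_reduce power2_eq_square mult.assoc)

lemma nn_integral_lborel_fst:
  fixes f :: "'a::euclidean_space \<times> 'b::euclidean_space \<Rightarrow> ennreal"
  assumes "f \<in> borel_measurable borel"
  shows "(\<integral>\<^sup>+p. f p \<partial>lborel) = (\<integral>\<^sup>+x. \<integral>\<^sup>+y. f (x, y) \<partial>lborel \<partial>lborel)"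
  by (subst lborel_prod[symmetric], subst lborel.nn_integral_fst) (use assms in \<open>auto simp: lborel_prod\<close>)

lemma nn_integral_lborel_snd:
  fixes f :: "'a::euclidean_space \<times> 'b::euclidean_space \<Rightarrow> ennreal"
  assumes "f \<in> borel_measurable borel"
  shows "(\<integral>\<^sup>+p. f p \<partial>lborel) = (\<integral>\<^sup>+y. \<integral>\<^sup>+x. f (x, y) \<partial>lborel \<partial>lborel)"
  by (subst lborel_prod[symmetric], subst lborel_pair.nn_integral_snd) (use assms in \<open>auto simp: lborel_prod\<close>)

lemma measurable_Pair_borel:
  fixes f :: "'a::euclidean_space \<times> 'b::euclidean_space \<Rightarrow> 'c::topological_space"
  assumes "f \<in> borel_measurable borel"
  shows "(\<lambda>x. f (x, y)) \<in> borel_measurable borel" "(\<lambda>y. f (x, y)) \<in> borel_measurable borel"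
proof -
  have "(\<lambda>x. (x, y)) \<in> (borel :: 'a measure) \<rightarrow>\<^sub>M (borel :: ('a \<times> 'b) measure)"
    "(\<lambda>y. (x, y)) \<in> (borel :: 'b measure) \<rightarrow>\<^sub>M (borel :: ('a \<times> 'b) measure)"
    by (auto intro!: borel_measurable_continuous_onI continuous_intros)
  then show "(\<lambda>x. f (x, y)) \<in> borel_measurable borel" "(\<lambda>y. f (x, y)) \<in> borel_measurable borel"
    using assms by (auto intro: measurable_compose)
qed

text \<open>One factor \<open>F^2\<close> is bounded by an integral along the first axis, which
  depends on \<open>y\<close> only, the other by one along the second axis, which depends on
  \<open>x\<close> only; the double integral of the product then factors.\<close>

lemma fourth_power_bound_2:
  fixes F G :: "real \<times> real \<Rightarrow> real"
  assumes [measurable]: "F \<in> borel_measurable borel" "G \<in> borel_measurable borel"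
    and 1: "\<And>x y. ennreal ((F (x, y))\<^sup>2) \<le> (\<integral>\<^sup>+s. ennreal (2 * \<bar>F (s, y)\<bar> * \<bar>G (s, y)\<bar>) \<partial>lborel)"
    and 2: "\<And>x y. ennreal ((F (x, y))\<^sup>2) \<le> (\<integral>\<^sup>+t. ennreal (2 * \<bar>F (x, t)\<bar> * \<bar>G (x, t)\<bar>) \<partial>lborel)"
  shows "(\<integral>\<^sup>+p. ennreal ((F p)^4) \<partial>lborel) \<le> (\<integral>\<^sup>+p. ennreal (2 * \<bar>F p\<bar> * \<bar>G p\<bar>) \<partial>lborel)\<^sup>2"
proof -
  define H where "H p = ennreal (2 * \<bar>F p\<bar> * \<bar>G p\<bar>)" for p
  have H[measurable]: "H \<in> borel_measurable borel" unfolding H_def by measurable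
  have H'[measurable]: "H \<in> borel_measurable (borel \<Otimes>\<^sub>M borel)" using H by (simp add: borel_prod)
  define A where "A y = (\<integral>\<^sup>+s. H (s, y) \<partial>lborel)" for y
  define B where "B x = (\<integral>\<^sup>+t. H (x, t) \<partial>lborel)" for x
  have [measurable]: "A \<in> borel_measurable borel" "B \<in> borel_measurable borel"
    unfolding A_def[abs_def] B_def[abs_def] by measurable
  have "(\<integral>\<^sup>+p. ennreal ((F p)^4) \<partial>lborel) = (\<integral>\<^sup>+x. \<integral>\<^sup>+y. ennreal ((F (x, y))^4) \<partial>lborel \<partial>lborel)"
    by (rule nn_integral_lborel_fst) measurable
  also have "\<dots> \<le> (\<integral>\<^sup>+x. \<integral>\<^sup>+y. B x * A y \<partial>lborel \<partial>lborel)"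
    unfolding ennreal_power4
    using 1 2 by (intro nn_integral_mono mult_mono) (auto simp: A_def B_def H_def)
  also have "\<dots> = (\<integral>\<^sup>+x. B x \<partial>lborel) * (\<integral>\<^sup>+y. A y \<partial>lborel)"
    by (simp add: nn_integral_cmult nn_integral_multc)
  also have "(\<integral>\<^sup>+x. B x \<partial>lborel) = (\<integral>\<^sup>+p. H p \<partial>lborel)"
    unfolding B_def by (rule nn_integral_lborel_fst[symmetric]) measurable
  also have "(\<integral>\<^sup>+y. A y \<partial>lborel) = (\<integral>\<^sup>+p. H p \<partial>lborel)"
    unfolding A_def by (rule nn_integral_lborel_snd[symmetric]) measurable
  finally show ?thesis by (simp add: H_def power2_eq_square)
qed

lemma nn_integral_product_CS:
  fixes F G :: "'a::euclidean_space \<Rightarrow> real"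
  assumes [measurable]: "F \<in> borel_measurable borel" "G \<in> borel_measurable borel"
  shows "(\<integral>\<^sup>+p. ennreal (2 * \<bar>F p\<bar> * \<bar>G p\<bar>) \<partial>lborel)\<^sup>2
    \<le> 4 * ((\<integral>\<^sup>+p. ennreal ((F p)\<^sup>2) \<partial>lborel) * (\<integral>\<^sup>+p. ennreal ((G p)\<^sup>2) \<partial>lborel))"
proof -
  have "(\<integral>\<^sup>+p. ennreal (2 * \<bar>F p\<bar> * \<bar>G p\<bar>) \<partial>lborel) = 2 * (\<integral>\<^sup>+p. ennreal \<bar>F p\<bar> * ennreal \<bar>G p\<bar> \<partial>lborel)"
    by (subst nn_integral_cmult[symmetric]) (auto simp: ennreal_mult mult.assoc)
  then have "(\<integral>\<^sup>+p. ennreal (2 * \<bar>F p\<bar> * \<bar>G p\<bar>) \<partial>lborel)\<^sup>2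
    = 4 * (\<integral>\<^sup>+p. ennreal \<bar>F p\<bar> * ennreal \<bar>G p\<bar> \<partial>lborel)\<^sup>2"
    by (simp add: power_mult_distrib)
  also have "\<dots> \<le> 4 * ((\<integral>\<^sup>+p. (ennreal \<bar>F p\<bar>)\<^sup>2 \<partial>lborel) * (\<integral>\<^sup>+p. (ennreal \<bar>G p\<bar>)\<^sup>2 \<partial>lborel))"
    by (intro mult_left_mono Cauchy_Schwarz_nn_integral) auto
  finally show ?thesis by (simp add: ennreal_power)
qed

text \<open>Ladyzhenskaya's argument: the two-dimensional bound on each slice produces the \<open>L\<^sup>2\<close> mass of the
  slice, which is at most the integral of \<open>2 |F| |G|\<close> over the whole space.\<close>

lemma fourth_power_bound_3:
  fixes F G :: "real \<times> real \<times> real \<Rightarrow> real"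
  assumes [measurable]: "F \<in> borel_measurable borel" "G \<in> borel_measurable borel"
    and 1: "\<And>x p. ennreal ((F (x, p))\<^sup>2) \<le> (\<integral>\<^sup>+s. ennreal (2 * \<bar>F (s, p)\<bar> * \<bar>G (s, p)\<bar>) \<partial>lborel)"
    and 2: "\<And>x y z. ennreal ((F (x, y, z))\<^sup>2) \<le> (\<integral>\<^sup>+s. ennreal (2 * \<bar>F (x, s, z)\<bar> * \<bar>G (x, s, z)\<bar>) \<partial>lborel)"
    and 3: "\<And>x y z. ennreal ((F (x, y, z))\<^sup>2) \<le> (\<integral>\<^sup>+t. ennreal (2 * \<bar>F (x, y, t)\<bar> * \<bar>G (x, y, t)\<bar>) \<partial>lborel)"
  shows "(\<integral>\<^sup>+p. ennreal ((F p)^4) \<partial>lborel)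
    \<le> 4 * (\<integral>\<^sup>+p. ennreal (2 * \<bar>F p\<bar> * \<bar>G p\<bar>) \<partial>lborel) * (\<integral>\<^sup>+p. ennreal ((G p)\<^sup>2) \<partial>lborel)"
proof -
  note [measurable] = measurable_Pair_borel[OF assms(1)] measurable_Pair_borel[OF assms(2)]
  have [measurable]: "F \<in> borel_measurable (borel \<Otimes>\<^sub>M borel)" "G \<in> borel_measurable (borel \<Otimes>\<^sub>M borel)"
    using assms(1,2) by (simp_all add: borel_prod)
  define S where "S = (\<integral>\<^sup>+p. ennreal (2 * \<bar>F p\<bar> * \<bar>G p\<bar>) \<partial>lborel)"
  define m where "m x = (\<integral>\<^sup>+p. ennreal ((F (x, p))\<^sup>2) \<partial>lborel)" for x
  define g where "g x = (\<integral>\<^sup>+p. ennreal ((G (x, p))\<^sup>2) \<partial>lborel)" for x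
  have mS: "m x \<le> S" for x
  proof -
    have "m x \<le> (\<integral>\<^sup>+p. \<integral>\<^sup>+s. ennreal (2 * \<bar>F (s, p)\<bar> * \<bar>G (s, p)\<bar>) \<partial>lborel \<partial>lborel)"
      unfolding m_def by (intro nn_integral_mono 1)
    also have "\<dots> = S" unfolding S_def by (rule nn_integral_lborel_snd[symmetric]) measurable
    finally show ?thesis .
  qed
  have "(\<integral>\<^sup>+p. ennreal ((F p)^4) \<partial>lborel) = (\<integral>\<^sup>+x. \<integral>\<^sup>+p. ennreal ((F (x, p))^4) \<partial>lborel \<partial>lborel)"
    by (rule nn_integral_lborel_fst) measurable
  also have "\<dots> \<le> (\<integral>\<^sup>+x. 4 * S * g x \<partial>lborel)"
  proof (rule nn_integral_mono)
    fix x
    have "(\<integral>\<^sup>+p. ennreal ((F (x, p))^4) \<partial>lborel) \<le> (\<integral>\<^sup>+p. ennreal (2 * \<bar>F (x, p)\<bar> * \<bar>G (x, p)\<bar>) \<partial>lborel)\<^sup>2"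
      by (rule fourth_power_bound_2) (use 2 3 in auto)
    also have "\<dots> \<le> 4 * (m x * g x)"
      unfolding m_def g_def by (rule nn_integral_product_CS) auto
    also have "\<dots> \<le> 4 * (S * g x)" by (intro mult_left_mono mult_right_mono mS) auto
    finally show "(\<integral>\<^sup>+p. ennreal ((F (x, p))^4) \<partial>lborel) \<le> 4 * S * g x" by (simp add: mult.assoc)
  qed
  also have "\<dots> = 4 * S * (\<integral>\<^sup>+x. g x \<partial>lborel)"
    unfolding g_def by (rule nn_integral_cmult) measurable
  also have "(\<integral>\<^sup>+x. g x \<partial>lborel) = (\<integral>\<^sup>+p. ennreal ((G p)\<^sup>2) \<partial>lborel)"
    unfolding g_def by (rule nn_integral_lborel_fst[symmetric]) measurable
  finally show ?thesis by (simp add: S_def)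
qed

text \<open>One factor \<open>F^2\<close> is replaced by its uniform bound, the other stays under
  the integral.\<close>

lemma fourth_power_bound_1:
  fixes F G :: "real \<Rightarrow> real"
  assumes [measurable]: "F \<in> borel_measurable borel" "G \<in> borel_measurable borel"
    and 1: "\<And>x. ennreal ((F x)\<^sup>2) \<le> (\<integral>\<^sup>+s. ennreal (2 * \<bar>F s\<bar> * \<bar>G s\<bar>) \<partial>lborel)"
  shows "(\<integral>\<^sup>+p. ennreal ((F p)^4) \<partial>lborel)
    \<le> (\<integral>\<^sup>+p. ennreal (2 * \<bar>F p\<bar> * \<bar>G p\<bar>) \<partial>lborel) * (\<integral>\<^sup>+p. ennreal ((F p)\<^sup>2) \<partial>lborel)"
proof -
  have "(\<integral>\<^sup>+p. ennreal ((F p)^4) \<partial>lborel)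
    \<le> (\<integral>\<^sup>+p. (\<integral>\<^sup>+s. ennreal (2 * \<bar>F s\<bar> * \<bar>G s\<bar>) \<partial>lborel) * ennreal ((F p)\<^sup>2) \<partial>lborel)"
    unfolding ennreal_power4 by (intro nn_integral_mono mult_right_mono 1) auto
  then show ?thesis by (simp add: nn_integral_cmult)
qed

text \<open>The full squared \<open>H^1\<close> norm, zero-order term included: by
  \<open>2 |F| |G| \<le> F^2 + G^2\<close> it dominates the mixed integrals above.\<close>

definition energy :: "(real^'n \<Rightarrow> real) \<Rightarrow> (real^'n \<Rightarrow> real^'n) \<Rightarrow> ennreal" where
  "energy \<phi> \<psi> = (\<integral>\<^sup>+x. ennreal ((\<phi> x)\<^sup>2 + (norm (\<psi> x))\<^sup>2) \<partial>lborel)"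

text \<open>Restricted to a line, \<open>\<phi>\<close> vanishes far to the left by compactness of
  its support, and the directional derivative is at most the norm of the gradient.\<close>

lemma test_pair_line_bound:
  assumes p: "test_pair \<Omega> \<phi> \<psi>" and e: "norm e = 1"
  shows "ennreal ((\<phi> (q + s *\<^sub>R e))\<^sup>2)
    \<le> (\<integral>\<^sup>+t. ennreal (2 * \<bar>\<phi> (q + t *\<^sub>R e)\<bar> * \<bar>norm (\<psi> (q + t *\<^sub>R e))\<bar>) \<partial>lborel)"
proof -
  note D = test_pairD[OF p] and C = test_pair_continuous[OF p]
  have "compact (closure {x. \<phi> x \<noteq> 0})" using D(1) by (simp add: test_fun_def)
  then obtain R where R: "\<And>x. x \<in> closure {x. \<phi> x \<noteq> 0} \<Longrightarrow> norm x \<le> R"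
    using compact_imp_bounded bounded_iff by metis
  have supp: "\<phi> (q + t *\<^sub>R e) = 0" if "t \<le> - (R + norm q + 1)" for t
  proof -
    have "norm (q + t *\<^sub>R e) \<ge> norm (t *\<^sub>R e) - norm q" by (metis add.commute norm_diff_ineq)
    moreover have "norm (t *\<^sub>R e) = \<bar>t\<bar>" using e by simp
    ultimately have "norm (q + t *\<^sub>R e) > R" using that by linarith
    then have "q + t *\<^sub>R e \<notin> closure {x. \<phi> x \<noteq> 0}" using R by fastforce
    then show ?thesis using test_pair_vanish(1)[OF p] by blast
  qed
  have d: "((\<lambda>t. \<phi> (q + t *\<^sub>R e)) has_real_derivative (\<psi> (q + t *\<^sub>R e) \<bullet> e)) (at t)" for t
  proof -
    have "((\<lambda>t. q + t *\<^sub>R e) has_derivative (\<lambda>h. h *\<^sub>R e)) (at t)"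
      by (auto intro!: derivative_eq_intros)
    from has_derivative_compose[OF this D(2)[of "q + t *\<^sub>R e"]]
    show ?thesis unfolding has_field_derivative_def
      by (rule has_derivative_eq_rhs) (simp add: fun_eq_iff)
  qed
  have "ennreal ((\<phi> (q + s *\<^sub>R e))\<^sup>2)
    \<le> (\<integral>\<^sup>+t. ennreal (2 * \<bar>\<phi> (q + t *\<^sub>R e)\<bar> * \<bar>\<psi> (q + t *\<^sub>R e) \<bullet> e\<bar>) \<partial>lborel)"
    using supp
    by (intro sq_le_nn_integral_deriv[OF d])
       (auto intro!: continuous_intros continuous_on_compose2[OF C(2)])
  also have "\<dots> \<le> (\<integral>\<^sup>+t. ennreal (2 * \<bar>\<phi> (q + t *\<^sub>R e)\<bar> * \<bar>norm (\<psi> (q + t *\<^sub>R e))\<bar>) \<partial>lborel)"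
    using e Cauchy_Schwarz_ineq2[of _ e]
    by (intro nn_integral_mono ennreal_leI mult_left_mono) auto
  finally show ?thesis .
qed

lemma Basis_real_vec: "(Basis :: (real^'n) set) = range (\<lambda>i. axis i 1)"
  by (auto simp: Basis_vec_def)

lemma ennreal_double_bound:
  fixes F G :: "real^'n \<Rightarrow> real"
  assumes [measurable]: "F \<in> borel_measurable borel" "G \<in> borel_measurable borel"
  shows "(\<integral>\<^sup>+p. ennreal (2 * \<bar>F p\<bar> * \<bar>G p\<bar>) \<partial>lborel) \<le> (\<integral>\<^sup>+x. ennreal ((F x)\<^sup>2 + (G x)\<^sup>2) \<partial>lborel)"
  using sum_squares_bound[of "\<bar>F x\<bar>" "\<bar>G x\<bar>" for x]
  by (intro nn_integral_mono ennreal_leI) auto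

text \<open>The index type has one, two or three elements. In each case a linear map matching basis
  vectors transports the integrals to a product of real lines, and the line bound in each coordinate
  direction supplies the hypotheses of the corresponding estimate. The factor 4 is the one from
  dimension three.\<close>

lemma test_pair_fourth_power:
  fixes \<phi> :: "real^'n \<Rightarrow> real"
  assumes p: "test_pair \<Omega> \<phi> \<psi>" and card: "CARD('n) \<le> 3"
  shows "(\<integral>\<^sup>+x. ennreal ((\<phi> x)^4) \<partial>lborel) \<le> 4 * (energy \<phi> \<psi>)\<^sup>2"
proof -
  note C = test_pair_continuous[OF p]
  define G where "G x = norm (\<psi> x)" for x
  have [measurable]: "\<phi> \<in> borel_measurable borel" "G \<in> borel_measurable borel"
    unfolding G_def using C by (auto intro!: borel_measurable_continuous_onI continuous_intros)
  have line: "ennreal ((\<phi> (q + s *\<^sub>R axis i 1))\<^sup>2)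
    \<le> (\<integral>\<^sup>+t. ennreal (2 * \<bar>\<phi> (q + t *\<^sub>R axis i 1)\<bar> * \<bar>G (q + t *\<^sub>R axis i 1)\<bar>) \<partial>lborel)" for q s i
    unfolding G_def by (rule test_pair_line_bound[OF p]) simp
  define S where "S = (\<integral>\<^sup>+p. ennreal (2 * \<bar>\<phi> p\<bar> * \<bar>G p\<bar>) \<partial>lborel)"
  define E where "E = energy \<phi> \<psi>"
  have SE: "S \<le> E" unfolding S_def E_def energy_def
    using ennreal_double_bound[of \<phi> G] by (simp add: G_def)
  have FE: "(\<integral>\<^sup>+p. ennreal ((\<phi> p)\<^sup>2) \<partial>lborel) \<le> E" "(\<integral>\<^sup>+p. ennreal ((G p)\<^sup>2) \<partial>lborel) \<le> E"
    unfolding E_def energy_def G_def by (auto intro!: nn_integral_mono ennreal_leI)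
  \<comment> \<open>Dimensions one and two yield \<open>E * E\<close>, which is weakened to the
    common bound.\<close>
  have le4: "E * E \<le> 4 * E\<^sup>2"
  proof -
    have "1 * (E * E) \<le> 4 * (E * E)" by (intro mult_right_mono) auto
    then show ?thesis by (simp add: power2_eq_square)
  qed
  have inj: "axis i (1::real) = axis j 1 \<longleftrightarrow> i = j" for i j :: 'n
    by (simp add: axis_eq_axis)
  have "card (UNIV :: 'n set) = 1 \<or> card (UNIV :: 'n set) = 2 \<or> card (UNIV :: 'n set) = 3"
    using card zero_less_card_finite[where 'a='n] by linarith
  then consider (1) i where "(UNIV :: 'n set) = {i}"
    | (2) i j where "(UNIV :: 'n set) = {i, j}" "i \<noteq> j"
    | (3) i j k where "(UNIV :: 'n set) = {i, j, k}" "i \<noteq> j" "i \<noteq> k" "j \<noteq> k"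
    unfolding card_1_singleton_iff card_2_iff card_3_iff One_nat_def by metis
  then have "(\<integral>\<^sup>+x. ennreal ((\<phi> x)^4) \<partial>lborel) \<le> 4 * E\<^sup>2"
  proof cases
    case (1 i)
    define T where "T x = x *\<^sub>R (axis i 1 :: real^'n)" for x :: real
    have T: "linear T" unfolding T_def by (intro linearI) (auto simp: algebra_simps)
    then have [measurable]: "T \<in> borel_measurable borel"
      by (intro borel_measurable_continuous_onI linear_continuous_on) (simp add: linear_conv_bounded_linear)
    have B: "bij_betw T Basis Basis" unfolding Basis_real_vec 1 by (simp add: T_def bij_betw_def)
    note tr = nn_integral_basis_bij[OF T B]
    have "(\<integral>\<^sup>+x. ennreal ((\<phi> x)^4) \<partial>lborel) = (\<integral>\<^sup>+x. ennreal ((\<phi> (T x))^4) \<partial>lborel)"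
      by (rule tr) measurable
    also have "\<dots> \<le> (\<integral>\<^sup>+x. ennreal (2 * \<bar>\<phi> (T x)\<bar> * \<bar>G (T x)\<bar>) \<partial>lborel) * (\<integral>\<^sup>+x. ennreal ((\<phi> (T x))\<^sup>2) \<partial>lborel)"
      by (rule fourth_power_bound_1) (use line[of 0 _ i] in \<open>auto simp: T_def[symmetric]\<close>)
    also have "(\<integral>\<^sup>+x. ennreal (2 * \<bar>\<phi> (T x)\<bar> * \<bar>G (T x)\<bar>) \<partial>lborel) = S"
      unfolding S_def by (rule tr[symmetric]) measurable
    also have "(\<integral>\<^sup>+x. ennreal ((\<phi> (T x))\<^sup>2) \<partial>lborel) = (\<integral>\<^sup>+x. ennreal ((\<phi> x)\<^sup>2) \<partial>lborel)"
      by (rule tr[symmetric]) measurable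
    also have "S * \<dots> \<le> E * E" by (intro mult_mono SE FE) auto
    finally show ?thesis using le4 by (rule order_trans)
  next
    case (2 i j)
    define T where "T = (\<lambda>(x, y). x *\<^sub>R (axis i 1 :: real^'n) + y *\<^sub>R axis j 1)"
    have T: "linear T" unfolding T_def by (intro linearI) (auto simp: algebra_simps)
    then have [measurable]: "T \<in> borel_measurable borel"
      by (intro borel_measurable_continuous_onI linear_continuous_on) (simp add: linear_conv_bounded_linear)
    have B: "bij_betw T Basis Basis" unfolding Basis_real_vec 2
      using 2(2) by (auto simp: T_def bij_betw_def Basis_prod_def inj_on_def inj)
    note tr = nn_integral_basis_bij[OF T B]
    have "(\<integral>\<^sup>+x. ennreal ((\<phi> x)^4) \<partial>lborel) = (\<integral>\<^sup>+x. ennreal ((\<phi> (T x))^4) \<partial>lborel)"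
      by (rule tr) measurable
    also have "\<dots> \<le> (\<integral>\<^sup>+x. ennreal (2 * \<bar>\<phi> (T x)\<bar> * \<bar>G (T x)\<bar>) \<partial>lborel)\<^sup>2"
    proof (rule fourth_power_bound_2)
      show "ennreal ((\<phi> (T (x, y)))\<^sup>2) \<le> (\<integral>\<^sup>+s. ennreal (2 * \<bar>\<phi> (T (s, y))\<bar> * \<bar>G (T (s, y))\<bar>) \<partial>lborel)" for x y
        using line[of "y *\<^sub>R axis j 1" x i] by (simp add: T_def add.commute)
      show "ennreal ((\<phi> (T (x, y)))\<^sup>2) \<le> (\<integral>\<^sup>+t. ennreal (2 * \<bar>\<phi> (T (x, t))\<bar> * \<bar>G (T (x, t))\<bar>) \<partial>lborel)" for x y
        using line[of "x *\<^sub>R axis i 1" y j] by (simp add: T_def add.commute)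
    qed measurable
    also have "(\<integral>\<^sup>+x. ennreal (2 * \<bar>\<phi> (T x)\<bar> * \<bar>G (T x)\<bar>) \<partial>lborel) = S"
      unfolding S_def by (rule tr[symmetric]) measurable
    also have "S\<^sup>2 \<le> E * E" unfolding power2_eq_square by (intro mult_mono SE) auto
    finally show ?thesis using le4 by (rule order_trans)
  next
    case (3 i j k)
    define T where "T = (\<lambda>(x, y, z). x *\<^sub>R (axis i 1 :: real^'n) + y *\<^sub>R axis j 1 + z *\<^sub>R axis k 1)"
    have T: "linear T" unfolding T_def by (intro linearI) (auto simp: algebra_simps)
    then have [measurable]: "T \<in> borel_measurable borel"
      by (intro borel_measurable_continuous_onI linear_continuous_on) (simp add: linear_conv_bounded_linear)
    have B: "bij_betw T Basis Basis" unfolding Basis_real_vec 3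
      using 3(2-4) by (auto simp: T_def bij_betw_def Basis_prod_def inj_on_def inj image_iff zero_prod_def)
    note tr = nn_integral_basis_bij[OF T B]
    have "(\<integral>\<^sup>+x. ennreal ((\<phi> x)^4) \<partial>lborel) = (\<integral>\<^sup>+x. ennreal ((\<phi> (T x))^4) \<partial>lborel)"
      by (rule tr) measurable
    also have "\<dots> \<le> 4 * (\<integral>\<^sup>+x. ennreal (2 * \<bar>\<phi> (T x)\<bar> * \<bar>G (T x)\<bar>) \<partial>lborel) * (\<integral>\<^sup>+x. ennreal ((G (T x))\<^sup>2) \<partial>lborel)"
    proof (rule fourth_power_bound_3)
      show "ennreal ((\<phi> (T (x, p)))\<^sup>2) \<le> (\<integral>\<^sup>+s. ennreal (2 * \<bar>\<phi> (T (s, p))\<bar> * \<bar>G (T (s, p))\<bar>) \<partial>lborel)" for x p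
        using line[of "fst p *\<^sub>R axis j 1 + snd p *\<^sub>R axis k 1" x i] by (simp add: T_def split_beta add_ac)
      show "ennreal ((\<phi> (T (x, y, z)))\<^sup>2) \<le> (\<integral>\<^sup>+s. ennreal (2 * \<bar>\<phi> (T (x, s, z))\<bar> * \<bar>G (T (x, s, z))\<bar>) \<partial>lborel)" for x y z
        using line[of "x *\<^sub>R axis i 1 + z *\<^sub>R axis k 1" y j] by (simp add: T_def add_ac)
      show "ennreal ((\<phi> (T (x, y, z)))\<^sup>2) \<le> (\<integral>\<^sup>+t. ennreal (2 * \<bar>\<phi> (T (x, y, t))\<bar> * \<bar>G (T (x, y, t))\<bar>) \<partial>lborel)" for x y z
        using line[of "x *\<^sub>R axis i 1 + y *\<^sub>R axis j 1" z k] by (simp add: T_def add_ac)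
    qed measurable
    also have "(\<integral>\<^sup>+x. ennreal (2 * \<bar>\<phi> (T x)\<bar> * \<bar>G (T x)\<bar>) \<partial>lborel) = S"
      unfolding S_def by (rule tr[symmetric]) measurable
    also have "(\<integral>\<^sup>+x. ennreal ((G (T x))\<^sup>2) \<partial>lborel) = (\<integral>\<^sup>+x. ennreal ((G x)\<^sup>2) \<partial>lborel)"
      by (rule tr[symmetric]) measurable
    also have "4 * S * \<dots> \<le> 4 * E * E" by (intro mult_mono SE FE) auto
    finally show ?thesis by (simp add: power2_eq_square mult.assoc)
  qed
  then show ?thesis by (simp add: E_def)
qed

section \<open>Poincare inequality on a grid of cubes\<close>

lemma nn_integral_lborel_translate:
  fixes f :: "'a::euclidean_space \<Rightarrow> ennreal"
  assumes "f \<in> borel_measurable borel"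
  shows "(\<integral>\<^sup>+x. f (c + x) \<partial>lborel) = (\<integral>\<^sup>+x. f x \<partial>lborel)"
proof -
  have "(\<integral>\<^sup>+x. f x \<partial>lborel) = (\<integral>\<^sup>+x. f x \<partial>distr lborel borel ((+) c))"
    by (simp add: lborel_distr_plus)
  also have "\<dots> = (\<integral>\<^sup>+x. f (c + x) \<partial>lborel)"
    using assms by (intro nn_integral_distr) auto
  finally show ?thesis by simp
qed

text \<open>The increment is the integral of \<open>\<psi> \<bullet> z\<close> over the segment from
  \<open>x\<close> to \<open>x + z\<close>. After Cauchy-Schwarz in the segment parameter and an
  exchange of integrals, translation invariance makes the inner integral independent of the
  parameter.\<close>

lemma test_pair_translation:
  fixes \<phi> :: "real^'n \<Rightarrow> real"
  assumes p: "test_pair \<Omega> \<phi> \<psi>"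
  shows "(\<integral>\<^sup>+x. ennreal ((\<phi> (x + z) - \<phi> x)\<^sup>2) \<partial>lborel)
    \<le> ennreal ((norm z)\<^sup>2) * (\<integral>\<^sup>+x. ennreal ((norm (\<psi> x))\<^sup>2) \<partial>lborel)"
proof -
  note D = test_pairD[OF p] and C = test_pair_continuous[OF p]
  have [measurable]: "\<phi> \<in> borel_measurable borel" "\<psi> \<in> borel_measurable borel"
    using C by (auto intro!: borel_measurable_continuous_onI)
  \<comment> \<open>The cut-off to the unit interval is inserted twice, using that it equals its
    square: one copy becomes the second factor in Cauchy-Schwarz, and its integral is 1.\<close>
  define J :: "real \<Rightarrow> ennreal" where "J = indicator {0..1}"
  have [measurable]: "J \<in> borel_measurable borel" unfolding J_def by measurable
  have J2: "(J t)\<^sup>2 = J t" for t by (auto simp: J_def split: split_indicator)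
  have J1: "(\<integral>\<^sup>+t. J t \<partial>lborel) = 1" by (simp add: J_def)
  have pt: "ennreal ((\<phi> (x + z) - \<phi> x)\<^sup>2)
    \<le> (\<integral>\<^sup>+t. ennreal ((norm (\<psi> (t *\<^sub>R z + x)))\<^sup>2) * (ennreal ((norm z)\<^sup>2) * J t) \<partial>lborel)" for x
  proof -
    have d: "((\<lambda>t. \<phi> (t *\<^sub>R z + x)) has_real_derivative (\<psi> (t *\<^sub>R z + x) \<bullet> z)) (at t)" for t
    proof -
      have "((\<lambda>t. t *\<^sub>R z + x) has_derivative (\<lambda>h. h *\<^sub>R z)) (at t)"
        by (auto intro!: derivative_eq_intros)
      from has_derivative_compose[OF this D(2)[of "t *\<^sub>R z + x"]]
      show ?thesis unfolding has_field_derivative_def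
        by (rule has_derivative_eq_rhs) (simp add: fun_eq_iff)
    qed
    have "continuous_on UNIV (\<lambda>t. \<psi> (t *\<^sub>R z + x) \<bullet> z)"
      by (auto intro!: continuous_intros continuous_on_compose2[OF C(2)])
    then have c: "isCont (\<lambda>t. \<psi> (t *\<^sub>R z + x) \<bullet> z) t" for t
      by (simp add: continuous_on_eq_continuous_at)
    have I: "has_bochner_integral lborel (\<lambda>t. (\<psi> (t *\<^sub>R z + x) \<bullet> z) * indicator {0..1} t) (\<phi> (x + z) - \<phi> x)"
      using has_bochner_integral_FTC_Icc_real[OF _ d c, of 0 1] by (simp add: add.commute)
    have "ennreal \<bar>\<phi> (x + z) - \<phi> x\<bar> = ennreal (norm (\<integral>t. (\<psi> (t *\<^sub>R z + x) \<bullet> z) * indicator {0..1} t \<partial>lborel))"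
      using I by (simp add: has_bochner_integral_integral_eq)
    also have "\<dots> \<le> (\<integral>\<^sup>+t. ennreal (norm ((\<psi> (t *\<^sub>R z + x) \<bullet> z) * indicator {0..1} t)) \<partial>lborel)"
      using I by (intro integral_norm_bound_ennreal) (auto simp: has_bochner_integral_iff)
    also have "\<dots> \<le> (\<integral>\<^sup>+t. (ennreal (norm (\<psi> (t *\<^sub>R z + x)) * norm z) * J t) * J t \<partial>lborel)"
      by (intro nn_integral_mono)
         (auto simp: J_def abs_mult Cauchy_Schwarz_ineq2 intro!: ennreal_leI split: split_indicator)
    finally have "ennreal \<bar>\<phi> (x + z) - \<phi> x\<bar> ^ 2
      \<le> (\<integral>\<^sup>+t. (ennreal (norm (\<psi> (t *\<^sub>R z + x)) * norm z) * J t) * J t \<partial>lborel)\<^sup>2"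
      by (rule power_mono) simp
    also have "\<dots> \<le> (\<integral>\<^sup>+t. (ennreal (norm (\<psi> (t *\<^sub>R z + x)) * norm z) * J t)\<^sup>2 \<partial>lborel) * (\<integral>\<^sup>+t. (J t)\<^sup>2 \<partial>lborel)"
      by (rule Cauchy_Schwarz_nn_integral) measurable
    also have "\<dots> = (\<integral>\<^sup>+t. ennreal ((norm (\<psi> (t *\<^sub>R z + x)))\<^sup>2) * (ennreal ((norm z)\<^sup>2) * J t) \<partial>lborel)"
      by (simp add: J2 J1 power_mult_distrib ennreal_power ennreal_mult mult.assoc)
    finally show ?thesis by (simp add: ennreal_power)
  qed
  have "(\<integral>\<^sup>+x. ennreal ((\<phi> (x + z) - \<phi> x)\<^sup>2) \<partial>lborel)
    \<le> (\<integral>\<^sup>+x. \<integral>\<^sup>+t. ennreal ((norm (\<psi> (t *\<^sub>R z + x)))\<^sup>2) * (ennreal ((norm z)\<^sup>2) * J t) \<partial>lborel \<partial>lborel)"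
    by (intro nn_integral_mono pt)
  also have "\<dots> = (\<integral>\<^sup>+t. \<integral>\<^sup>+x. ennreal ((norm (\<psi> (t *\<^sub>R z + x)))\<^sup>2) * (ennreal ((norm z)\<^sup>2) * J t) \<partial>lborel \<partial>lborel)"
    by (rule lborel_pair.Fubini') measurable
  also have "\<dots> = (\<integral>\<^sup>+t. (\<integral>\<^sup>+x. ennreal ((norm (\<psi> x))\<^sup>2) \<partial>lborel) * (ennreal ((norm z)\<^sup>2) * J t) \<partial>lborel)"
  proof (rule nn_integral_cong)
    fix t
    have "(\<integral>\<^sup>+x. ennreal ((norm (\<psi> (t *\<^sub>R z + x)))\<^sup>2) * (ennreal ((norm z)\<^sup>2) * J t) \<partial>lborel)
      = (\<integral>\<^sup>+x. ennreal ((norm (\<psi> (t *\<^sub>R z + x)))\<^sup>2) \<partial>lborel) * (ennreal ((norm z)\<^sup>2) * J t)"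
      by (rule nn_integral_multc) measurable
    then show "(\<integral>\<^sup>+x. ennreal ((norm (\<psi> (t *\<^sub>R z + x)))\<^sup>2) * (ennreal ((norm z)\<^sup>2) * J t) \<partial>lborel)
      = (\<integral>\<^sup>+x. ennreal ((norm (\<psi> x))\<^sup>2) \<partial>lborel) * (ennreal ((norm z)\<^sup>2) * J t)"
      by (subst (asm) nn_integral_lborel_translate[of "\<lambda>x. ennreal ((norm (\<psi> x))\<^sup>2)"]) auto
  qed
  also have "\<dots> = ennreal ((norm z)\<^sup>2) * (\<integral>\<^sup>+x. ennreal ((norm (\<psi> x))\<^sup>2) \<partial>lborel)"
    by (simp only: mult.assoc[symmetric], subst nn_integral_cmult) (auto simp: J1 mult.commute)
  finally show ?thesis .
qed

text \<open>This is twice the unnormalised variance, the cross term of the square being the product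
  of the two means. On a cell it links squared increments with the squared mean.\<close>

lemma nn_integral_double_diff_sq:
  fixes f :: "'a \<Rightarrow> real"
  assumes fin: "finite_measure M" and f[measurable]: "f \<in> borel_measurable M" and bd: "\<And>x. \<bar>f x\<bar> \<le> B"
  shows "(\<integral>\<^sup>+x. \<integral>\<^sup>+y. ennreal ((f x - f y)\<^sup>2) \<partial>M \<partial>M)
    = ennreal (2 * (measure M (space M) * (\<integral>x. (f x)\<^sup>2 \<partial>M) - (\<integral>x. f x \<partial>M)\<^sup>2))"
proof -
  interpret finite_measure M by fact
  define V where "V = measure M (space M)"
  define b1 where "b1 = (\<integral>x. f x \<partial>M)"
  define b2 where "b2 = (\<integral>x. (f x)\<^sup>2 \<partial>M)"
  have i1: "integrable M f" by (rule integrable_const_bound[of _ B]) (use bd in auto)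
  have i2: "integrable M (\<lambda>x. (f x)\<^sup>2)"
  proof (rule integrable_const_bound[of _ "B\<^sup>2"])
    have "\<bar>f x\<bar> \<le> \<bar>B\<bar>" for x using bd[of x] by linarith
    then show "AE x in M. norm ((f x)\<^sup>2) \<le> B\<^sup>2" by (simp add: abs_le_square_iff)
  qed measurable
  have sq: "(a - f y)\<^sup>2 = a\<^sup>2 - 2 * a * f y + (f y)\<^sup>2" for a y by (simp add: power2_diff)
  have inner: "(\<integral>\<^sup>+y. ennreal ((a - f y)\<^sup>2) \<partial>M) = ennreal (V * a\<^sup>2 - 2 * a * b1 + b2)" for a
  proof -
    have "integrable M (\<lambda>y. (a - f y)\<^sup>2)" unfolding sq using i1 i2 by simp
    then have "(\<integral>\<^sup>+y. ennreal ((a - f y)\<^sup>2) \<partial>M) = ennreal (\<integral>y. (a - f y)\<^sup>2 \<partial>M)"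
      by (intro nn_integral_eq_integral) auto
    also have "(\<integral>y. (a - f y)\<^sup>2 \<partial>M) = V * a\<^sup>2 - 2 * a * b1 + b2"
      unfolding sq using i1 i2 by (simp add: V_def b1_def b2_def)
    finally show ?thesis .
  qed
  have nn: "0 \<le> V * a\<^sup>2 - 2 * a * b1 + b2" for a
  proof -
    have "0 \<le> (\<integral>y. (a - f y)\<^sup>2 \<partial>M)" by simp
    also have "\<dots> = V * a\<^sup>2 - 2 * a * b1 + b2"
      unfolding sq using i1 i2 by (simp add: V_def b1_def b2_def)
    finally show ?thesis .
  qed
  have "(\<integral>\<^sup>+x. \<integral>\<^sup>+y. ennreal ((f x - f y)\<^sup>2) \<partial>M \<partial>M) = (\<integral>\<^sup>+x. ennreal (V * (f x)\<^sup>2 - 2 * f x * b1 + b2) \<partial>M)"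
    by (simp add: inner)
  also have "\<dots> = ennreal (\<integral>x. V * (f x)\<^sup>2 - 2 * f x * b1 + b2 \<partial>M)"
    using i1 i2 nn by (intro nn_integral_eq_integral) auto
  also have "(\<integral>x. V * (f x)\<^sup>2 - 2 * f x * b1 + b2 \<partial>M) = V * b2 - 2 * b1 * b1 + b2 * V"
    using i1 i2 by (simp add: V_def[symmetric] b1_def[symmetric] b2_def[symmetric] mult.commute)
  finally show ?thesis by (simp add: V_def b1_def b2_def algebra_simps power2_eq_square)
qed

section \<open>The grid of cubes\<close>

definition cell_index :: "real \<Rightarrow> real^'n \<Rightarrow> 'n \<Rightarrow> int" where
  "cell_index h x = (\<lambda>i. \<lfloor>x $ i / h\<rfloor>)"

text \<open>Floors make the cubes half-open, so they partition the space: at each point exactly one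
  indicator is nonzero and sums over cells collapse to one term.\<close>

definition cell :: "real \<Rightarrow> ('n \<Rightarrow> int) \<Rightarrow> (real^'n) set" where
  "cell h m = {x. cell_index h x = m}"

lemma mem_cell_iff:
  assumes "h > 0"
  shows "x \<in> cell h m \<longleftrightarrow> (\<forall>i. h * m i \<le> x $ i \<and> x $ i < h * (real_of_int (m i) + 1))"
  using assms by (auto simp: cell_def cell_index_def fun_eq_iff floor_eq_iff field_simps)

lemma cell_borel[measurable]:
  assumes "h > 0" shows "cell h m \<in> sets (borel :: (real^'n) measure)"
proof -
  have "cell h m = {x. \<forall>i\<in>UNIV. h * m i \<le> x $ i \<and> x $ i < h * (real_of_int (m i) + 1)}"
    using mem_cell_iff[OF assms, of _ m] by auto
  also have "\<dots> \<in> sets borel"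
    by measurable
  finally show ?thesis .
qed

lemma prod_Basis_const_box:
  "(\<Prod>b\<in>(Basis :: (real^'n) set). ((\<chi> i. q i + c) - (\<chi> i. q i)) \<bullet> b) = c ^ CARD('n)"
proof -
  have "((\<chi> i. q i + c) - (\<chi> i. q i)) \<bullet> b = c" if "b \<in> (Basis :: (real^'n) set)" for b
    using that by (auto simp: Basis_real_vec inner_axis)
  then show ?thesis by simp
qed

text \<open>The half-open cube lies between an open and a closed box with the same corners.\<close>

lemma emeasure_cell:
  fixes m :: "'n::finite \<Rightarrow> int"
  assumes h: "h > 0" shows "emeasure lborel (cell h m) = ennreal (h ^ CARD('n))"
proof (rule antisym)
  let ?l = "(\<chi> i. h * m i) :: real^'n" and ?u = "(\<chi> i. h * m i + h) :: real^'n"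
  have le: "?l \<bullet> b \<le> ?u \<bullet> b" if "b \<in> Basis" for b
    using that h by (auto simp: Basis_real_vec inner_axis)
  have "cell h m \<subseteq> cbox ?l ?u"
  proof
    fix x assume "x \<in> cell h m"
    then have "\<forall>i. h * m i \<le> x $ i \<and> x $ i < h * (real_of_int (m i) + 1)" using mem_cell_iff[OF h, of x m] by blast
    then show "x \<in> cbox ?l ?u" by (simp add: mem_box_cart distrib_left less_imp_le)
  qed
  then have "emeasure lborel (cell h m) \<le> emeasure lborel (cbox ?l ?u)"
    by (intro emeasure_mono) auto
  also have "\<dots> = ennreal (h ^ CARD('n))"
    using le by (simp add: emeasure_lborel_cbox_eq prod_Basis_const_box)
  finally show "emeasure lborel (cell h m) \<le> ennreal (h ^ CARD('n))" .
  have "ennreal (h ^ CARD('n)) = emeasure lborel (box ?l ?u)"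
    using le by (simp add: emeasure_lborel_box_eq prod_Basis_const_box)
  also have "\<dots> \<le> emeasure lborel (cell h m)"
  proof (rule emeasure_mono)
    show "box ?l ?u \<subseteq> cell h m"
      by (rule subsetI, subst mem_cell_iff[OF h]) (simp add: mem_box_cart distrib_left less_imp_le)
  qed (use cell_borel[OF h, of m] in simp)
  finally show "ennreal (h ^ CARD('n)) \<le> emeasure lborel (cell h m)" .
qed

lemma finite_cell_indices:
  fixes \<Omega> :: "(real^'n) set"
  assumes "bounded \<Omega>" "h > 0"
  shows "finite (cell_index h ` \<Omega>)"
proof -
  obtain R where R: "\<And>x. x \<in> \<Omega> \<Longrightarrow> norm x \<le> R" using assms(1) bounded_iff by metis
  have "cell_index h ` \<Omega> \<subseteq> PiE UNIV (\<lambda>_. {\<lfloor>- R / h\<rfloor>..\<lfloor>R / h\<rfloor>})"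
  proof (intro image_subsetI PiE_I)
    fix x i assume "x \<in> \<Omega>"
    then have "\<bar>x $ i\<bar> \<le> R" using R component_le_norm_cart[of x i] by (meson order_trans)
    then have "- R / h \<le> x $ i / h" "x $ i / h \<le> R / h"
      using assms(2) by (auto intro!: divide_right_mono simp del: minus_divide_left[symmetric] simp: abs_le_iff)
    then show "cell_index h x i \<in> {\<lfloor>- R / h\<rfloor>..\<lfloor>R / h\<rfloor>}"
      by (auto simp: cell_index_def intro!: floor_mono)
  qed simp
  then show ?thesis by (rule finite_subset) (intro finite_PiE, auto)
qed

lemma integrable_compact_support:
  fixes f :: "'a::euclidean_space \<Rightarrow> 'b::euclidean_space"
  assumes "continuous_on UNIV f" "compact K" "\<And>x. x \<notin> K \<Longrightarrow> f x = 0"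
  shows "integrable lborel f"
proof -
  have "integrable lborel (\<lambda>x. indicator K x *\<^sub>R f x)"
    using assms(1,2) by (intro borel_integrable_compact) (auto elim: continuous_on_subset)
  also have "(\<lambda>x. indicator K x *\<^sub>R f x) = f" using assms(3) by (auto simp: fun_eq_iff split: split_indicator)
  finally show ?thesis .
qed

lemma test_pair_integrable:
  assumes p: "test_pair \<Omega> \<phi> \<psi>"
  shows "integrable lborel \<phi>" "integrable lborel (\<lambda>x. (\<phi> x)\<^sup>2)" "integrable lborel (\<lambda>x. (norm (\<psi> x))\<^sup>2)"
proof -
  have K: "compact (closure {x. \<phi> x \<noteq> 0})" using p by (simp add: test_pair_def test_fun_def)
  note C = test_pair_continuous[OF p] and V = test_pair_vanish[OF p]
  show "integrable lborel \<phi>" by (rule integrable_compact_support[OF C(1) K V(1)])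
  show "integrable lborel (\<lambda>x. (\<phi> x)\<^sup>2)"
    by (rule integrable_compact_support[OF continuous_on_power[OF C(1)] K]) (drule V(1), simp)
  show "integrable lborel (\<lambda>x. (norm (\<psi> x))\<^sup>2)"
    by (rule integrable_compact_support[OF continuous_on_power[OF continuous_on_norm[OF C(2)]] K])
       (drule V(2), simp)
qed

text \<open>Poincare's inequality summed over a grid of cubes of side \<open>h\<close>: pairs of points in a common
  cube differ by at most \<open>h\<close> in each coordinate, so the translation estimate controls
  the double integrals over all cubes simultaneously.\<close>

lemma cell_Poincare:
  fixes \<phi> :: "real^'n \<Rightarrow> real"
  assumes p: "test_pair \<Omega> \<phi> \<psi>" and h: "h > 0" and I: "finite I" "\<And>x. \<phi> x \<noteq> 0 \<Longrightarrow> cell_index h x \<in> I"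
  shows "h ^ CARD('n) * (\<integral>x. (\<phi> x)\<^sup>2 \<partial>lborel)
    \<le> (\<Sum>m\<in>I. (\<integral>x. indicator (cell h m) x * \<phi> x \<partial>lborel)\<^sup>2)
      + (2 * h) ^ CARD('n) * (real CARD('n) * h\<^sup>2) * (\<integral>x. (norm (\<psi> x))\<^sup>2 \<partial>lborel)"
proof -
  note C = test_pair_continuous[OF p] and int = test_pair_integrable[OF p]
  have [measurable]: "\<phi> \<in> borel_measurable borel" "\<psi> \<in> borel_measurable borel"
    using C by (auto intro!: borel_measurable_continuous_onI)
  obtain B where B: "\<And>x. \<bar>\<phi> x\<bar> \<le> B" using test_pair_bounded[OF p] by metis
  note [measurable] = cell_borel[OF h]
  define V where "V = h ^ CARD('n)"
  define A where "A m = (\<integral>x. indicator (cell h m) x * \<phi> x \<partial>lborel)" for m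
  define b where "b m = (\<integral>x. indicator (cell h m) x * (\<phi> x)\<^sup>2 \<partial>lborel)" for m
  define G where "G = (\<integral>x. (norm (\<psi> x))\<^sup>2 \<partial>lborel)"
  define N where "N = real CARD('n)"
  have Vpos: "V > 0" using h by (simp add: V_def)
  have cellwise: "(\<integral>\<^sup>+x. \<integral>\<^sup>+y. ennreal ((\<phi> x - \<phi> y)\<^sup>2) * (indicator (cell h m) x * indicator (cell h m) y) \<partial>lborel \<partial>lborel)
      = ennreal (2 * (V * b m - (A m)\<^sup>2))" for m
  proof -
    let ?M = "restrict_space lborel (cell h m)"
    have em: "emeasure ?M (space ?M) = ennreal V"
      by (simp add: space_restrict_space emeasure_restrict_space emeasure_cell[OF h] V_def)
    then have fin: "finite_measure ?M" by (intro finite_measureI) simp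
    have mV: "measure ?M (space ?M) = V" using em Vpos by (simp add: measure_def)
    have "(\<integral>\<^sup>+x. \<integral>\<^sup>+y. ennreal ((\<phi> x - \<phi> y)\<^sup>2) \<partial>?M \<partial>?M)
      = ennreal (2 * (measure ?M (space ?M) * (\<integral>x. (\<phi> x)\<^sup>2 \<partial>?M) - (\<integral>x. \<phi> x \<partial>?M)\<^sup>2))"
      by (rule nn_integral_double_diff_sq[OF fin _ B]) (auto intro: measurable_restrict_space1)
    also have "(\<integral>\<^sup>+x. \<integral>\<^sup>+y. ennreal ((\<phi> x - \<phi> y)\<^sup>2) \<partial>?M \<partial>?M)
      = (\<integral>\<^sup>+x. (\<integral>\<^sup>+y. ennreal ((\<phi> x - \<phi> y)\<^sup>2) * indicator (cell h m) y \<partial>lborel) * indicator (cell h m) x \<partial>lborel)"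
      by (simp add: nn_integral_restrict_space)
    also have "\<dots> = (\<integral>\<^sup>+x. \<integral>\<^sup>+y. ennreal ((\<phi> x - \<phi> y)\<^sup>2) * (indicator (cell h m) x * indicator (cell h m) y) \<partial>lborel \<partial>lborel)"
      by (subst nn_integral_multc[symmetric]) (auto simp: mult_ac)
    finally show ?thesis
      unfolding mV by (simp add: integral_restrict_space A_def b_def)
  qed
  \<comment> \<open>Cauchy-Schwarz against the indicator of the cell. The sign matters because
    \<open>ennreal\<close> sends negative numbers to 0, so that sums pass through it only for
    nonnegative terms.\<close>
  have pos: "0 \<le> V * b m - (A m)\<^sup>2" for m
  proof -
    let ?c = "indicator (cell h m) :: _ \<Rightarrow> real"
    have cL: "?c \<in> L2 lborel"
    proof (rule L2_I)
      have "integrable lborel ?c"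
        using emeasure_cell[OF h, of m] by (intro integrable_real_indicator) auto
      moreover have "(\<lambda>x. (norm (?c x))\<^sup>2) = ?c" by (auto simp: fun_eq_iff split: split_indicator)
      ultimately show "integrable lborel (\<lambda>x. (norm (?c x))\<^sup>2)" by simp
    qed measurable
    have fL: "(\<lambda>x. ?c x *\<^sub>R \<phi> x) \<in> L2 lborel"
      using int by (intro L2_bounded_mult[where C=1]) (auto intro!: L2_I split: split_indicator)
    have "(\<integral>x. ?c x \<bullet> (?c x *\<^sub>R \<phi> x) \<partial>lborel)\<^sup>2
      \<le> (\<integral>x. (norm (?c x))\<^sup>2 \<partial>lborel) * (\<integral>x. (norm (?c x *\<^sub>R \<phi> x))\<^sup>2 \<partial>lborel)"
      by (rule L2_Cauchy_Schwarz[OF cL fL])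
    also have "(\<lambda>x. ?c x \<bullet> (?c x *\<^sub>R \<phi> x)) = (\<lambda>x. indicator (cell h m) x * \<phi> x)"
      by (auto simp: fun_eq_iff split: split_indicator)
    also have "(\<lambda>x. (norm (?c x))\<^sup>2) = ?c" by (auto simp: fun_eq_iff split: split_indicator)
    also have "(\<lambda>x. (norm (?c x *\<^sub>R \<phi> x))\<^sup>2) = (\<lambda>x. indicator (cell h m) x * (\<phi> x)\<^sup>2)"
      by (auto simp: fun_eq_iff split: split_indicator)
    also have "(\<integral>x. ?c x \<partial>lborel) = V"
      using emeasure_cell[OF h, of m] Vpos by (simp add: measure_def V_def)
    finally show ?thesis by (simp add: A_def b_def)
  qed
  \<comment> \<open>The cube \<open>[-h, h]^N\<close> contains all differences of two points of a
    common cell. Its volume is the source of the factor \<open>(2 * h) ^ CARD('n)\<close>.\<close>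
  define Z :: "(real^'n) set" where "Z = cbox (\<chi> i. -h) (\<chi> i. -h + 2 * h)"
  have Z: "emeasure lborel Z = ennreal ((2 * h) ^ CARD('n))"
  proof -
    have "(\<chi> i. -h) \<bullet> b \<le> (\<chi> i. -h + 2 * h) \<bullet> b" if "b \<in> (Basis :: (real^'n) set)" for b
      using that h by (auto simp: Basis_real_vec inner_axis)
    then show ?thesis
      unfolding Z_def emeasure_lborel_cbox_eq using prod_Basis_const_box[where 'n='n, of "\<lambda>_. -h" "2 * h"] by simp
  qed
  have [measurable]: "Z \<in> sets borel" by (simp add: Z_def)
  have normZ: "(norm z)\<^sup>2 \<le> N * h\<^sup>2" if "z \<in> Z" for z
  proof -
    have "(z $ i)\<^sup>2 \<le> h\<^sup>2" for i
    proof -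
      have "\<bar>z $ i\<bar> \<le> \<bar>h\<bar>" using that h by (auto simp: Z_def mem_box_cart abs_le_iff dest: spec[of _ i])
      then show ?thesis by (simp add: abs_le_square_iff)
    qed
    then have "(\<Sum>i\<in>UNIV. (z $ i)\<^sup>2) \<le> (\<Sum>i\<in>(UNIV::'n set). h\<^sup>2)" by (intro sum_mono)
    then show ?thesis by (simp add: norm_vec_def L2_set_def N_def sum_nonneg)
  qed
  have Gn: "(\<integral>\<^sup>+x. ennreal ((norm (\<psi> x))\<^sup>2) \<partial>lborel) = ennreal G"
    unfolding G_def using int(3) by (intro nn_integral_eq_integral) auto
  have "ennreal (\<Sum>m\<in>I. 2 * (V * b m - (A m)\<^sup>2)) = (\<Sum>m\<in>I. ennreal (2 * (V * b m - (A m)\<^sup>2)))"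
    using pos by (intro sum_ennreal[symmetric]) auto
  also have "\<dots> = (\<integral>\<^sup>+x. \<integral>\<^sup>+y. (\<Sum>m\<in>I. ennreal ((\<phi> x - \<phi> y)\<^sup>2) * (indicator (cell h m) x * indicator (cell h m) y)) \<partial>lborel \<partial>lborel)"
    unfolding cellwise[symmetric] by (subst nn_integral_sum[symmetric]) (auto intro!: nn_integral_cong nn_integral_sum[symmetric])
  \<comment> \<open>Lying in a common cell is relaxed to \<open>y - x \<in> Z\<close>. This
    condition involves the difference only, so \<open>z = y - x\<close> turns the double integral
    into an integral over translations.\<close>
  also have "\<dots> \<le> (\<integral>\<^sup>+x. \<integral>\<^sup>+y. ennreal ((\<phi> x - \<phi> y)\<^sup>2) * indicator Z (y - x) \<partial>lborel \<partial>lborel)"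
  proof (intro nn_integral_mono)
    fix x y
    have "(\<Sum>m\<in>I. indicator (cell h m) x * indicator (cell h m) y) \<le> (indicator Z (y - x) :: ennreal)"
    proof (cases "cell_index h x = cell_index h y")
      case True
      have "y - x \<in> Z"
      proof -
        have "x \<in> cell h (cell_index h x)" "y \<in> cell h (cell_index h x)" using True by (auto simp: cell_def)
        then have "- h \<le> y $ i - x $ i \<and> y $ i - x $ i \<le> h" for i
          unfolding mem_cell_iff[OF h] by (smt (verit) distrib_left mult_cancel_left2 mult.right_neutral)
        then show ?thesis unfolding Z_def mem_box_cart by simp
      qed
      have "(\<Sum>m\<in>I. indicator (cell h m) x * indicator (cell h m) y) = (\<Sum>m\<in>I. if m = cell_index h x then 1 else (0::ennreal))"
        using True by (intro sum.cong) (auto simp: cell_def split: split_indicator)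
      also have "\<dots> \<le> 1" using I(1) by simp
      finally show ?thesis using \<open>y - x \<in> Z\<close> by simp
    next
      case False
      then have "(\<Sum>m\<in>I. indicator (cell h m) x * indicator (cell h m) y) = (0::ennreal)"
        by (intro sum.neutral) (auto simp: cell_def split: split_indicator)
      then show ?thesis by simp
    qed
    then show "(\<Sum>m\<in>I. ennreal ((\<phi> x - \<phi> y)\<^sup>2) * (indicator (cell h m) x * indicator (cell h m) y))
      \<le> ennreal ((\<phi> x - \<phi> y)\<^sup>2) * indicator Z (y - x)"
      unfolding sum_distrib_left[symmetric] by (intro mult_left_mono) auto
  qed
  also have "\<dots> = (\<integral>\<^sup>+x. \<integral>\<^sup>+z. ennreal ((\<phi> (x + z) - \<phi> x)\<^sup>2) * indicator Z z \<partial>lborel \<partial>lborel)"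
  proof (rule nn_integral_cong)
    fix x
    show "(\<integral>\<^sup>+y. ennreal ((\<phi> x - \<phi> y)\<^sup>2) * indicator Z (y - x) \<partial>lborel)
      = (\<integral>\<^sup>+z. ennreal ((\<phi> (x + z) - \<phi> x)\<^sup>2) * indicator Z z \<partial>lborel)"
      using nn_integral_lborel_translate[of "\<lambda>y. ennreal ((\<phi> x - \<phi> y)\<^sup>2) * indicator Z (y - x)" x]
      by (simp add: power2_commute)
  qed
  also have "\<dots> = (\<integral>\<^sup>+z. \<integral>\<^sup>+x. ennreal ((\<phi> (x + z) - \<phi> x)\<^sup>2) * indicator Z z \<partial>lborel \<partial>lborel)"
    by (rule lborel_pair.Fubini') measurable
  also have "\<dots> \<le> (\<integral>\<^sup>+z. ennreal (N * h\<^sup>2) * ennreal G * indicator Z z \<partial>lborel)"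
  proof (rule nn_integral_mono)
    fix z
    have "(\<integral>\<^sup>+x. ennreal ((\<phi> (x + z) - \<phi> x)\<^sup>2) * indicator Z z \<partial>lborel)
      = (\<integral>\<^sup>+x. ennreal ((\<phi> (x + z) - \<phi> x)\<^sup>2) \<partial>lborel) * indicator Z z"
      by (rule nn_integral_multc) measurable
    also have "\<dots> \<le> (ennreal ((norm z)\<^sup>2) * ennreal G) * indicator Z z"
      unfolding Gn[symmetric] by (intro mult_right_mono test_pair_translation[OF p]) auto
    also have "\<dots> \<le> ennreal (N * h\<^sup>2) * ennreal G * indicator Z z"
      using normZ[of z] by (auto intro!: mult_right_mono ennreal_leI split: split_indicator)
    finally show "(\<integral>\<^sup>+x. ennreal ((\<phi> (x + z) - \<phi> x)\<^sup>2) * indicator Z z \<partial>lborel)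
      \<le> ennreal (N * h\<^sup>2) * ennreal G * indicator Z z" .
  qed
  also have "\<dots> = ennreal (N * h\<^sup>2) * ennreal G * ennreal ((2 * h) ^ CARD('n))"
    by (simp add: nn_integral_cmult_indicator Z)
  also have "\<dots> = ennreal ((2 * h) ^ CARD('n) * (N * h\<^sup>2) * G)"
    using h by (simp add: ennreal_mult[symmetric] N_def G_def mult_ac)
  finally have "(\<Sum>m\<in>I. 2 * (V * b m - (A m)\<^sup>2)) \<le> (2 * h) ^ CARD('n) * (N * h\<^sup>2) * G"
    using h by (subst (asm) ennreal_le_iff) (auto simp: N_def G_def)
  moreover have "(\<Sum>m\<in>I. b m) = (\<integral>x. (\<phi> x)\<^sup>2 \<partial>lborel)"
  proof -
    have "(\<Sum>m\<in>I. b m) = (\<integral>x. (\<Sum>m\<in>I. indicator (cell h m) x * (\<phi> x)\<^sup>2) \<partial>lborel)"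
      unfolding b_def
      by (intro Bochner_Integration.integral_sum[symmetric] integrable_real_mult_indicator[of _ lborel, unfolded mult.commute[of _ "indicator _ _"]] int) auto
    also have "(\<lambda>x. \<Sum>m\<in>I. indicator (cell h m) x * (\<phi> x)\<^sup>2) = (\<lambda>x. (\<phi> x)\<^sup>2)"
    proof
      fix x
      have "(\<Sum>m\<in>I. indicator (cell h m) x * (\<phi> x)\<^sup>2) = (\<Sum>m\<in>I. if m = cell_index h x then (\<phi> x)\<^sup>2 else 0)"
        by (intro sum.cong) (auto simp: cell_def split: split_indicator)
      also have "\<dots> = (\<phi> x)\<^sup>2" using I by auto
      finally show "(\<Sum>m\<in>I. indicator (cell h m) x * (\<phi> x)\<^sup>2) = (\<phi> x)\<^sup>2" .
    qed
    finally show ?thesis .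
  qed
  \<comment> \<open>Permits dropping the factor 2 of the variance identity.\<close>
  moreover have "(\<Sum>m\<in>I. V * b m - (A m)\<^sup>2) \<ge> 0" using pos by (intro sum_nonneg)
  ultimately have "V * (\<integral>x. (\<phi> x)\<^sup>2 \<partial>lborel) - (\<Sum>m\<in>I. (A m)\<^sup>2) \<le> (2 * h) ^ CARD('n) * (N * h\<^sup>2) * G"
    by (simp add: sum_subtractf flip: sum_distrib_left)
  then show ?thesis by (simp add: V_def N_def G_def A_def)
qed

section \<open>Compactness\<close>

text \<open>Bolzano-Weierstrass for each index and a diagonal extraction over the countable index
  type.\<close>

lemma diagonal_convergent_subseq:
  fixes X :: "nat \<Rightarrow> 'i::countable \<Rightarrow> real"
  assumes bd: "\<And>k i. \<bar>X k i\<bar> \<le> C"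
  obtains r :: "nat \<Rightarrow> nat" where "strict_mono r" "\<And>i. convergent (\<lambda>k. X (r k) i)"
proof -
  let ?P = "\<lambda>n s. convergent (\<lambda>k. X (s k) (from_nat n))"
  interpret subseqs ?P
  proof
    fix n and s :: "nat \<Rightarrow> nat" assume "strict_mono s"
    have "X (s k) (from_nat n) \<in> {-C..C}" for k
      using bd[of "s k" "from_nat n"] by (simp add: abs_le_iff)
    then obtain l r where "strict_mono r" "((\<lambda>k. X (s k) (from_nat n)) \<circ> r) \<longlonglongrightarrow> l"
      using compact_imp_seq_compact[OF compact_Icc[of "-C" C]] unfolding seq_compact_def by metis
    then show "\<exists>r'. strict_mono r' \<and> ?P n (s \<circ> r')"
      by (auto simp: convergent_def o_def)
  qed
  have conv: "convergent (\<lambda>k. X (diagseq k) i)" for i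
  proof -
    \<comment> \<open>The diagonal sequence is a subsequence of the extraction for index
      \<open>m\<close> only from position \<open>m + 1\<close> on, so convergence is first obtained
      for a tail.\<close>
    have "?P (to_nat i) (diagseq \<circ> ((+) (Suc (to_nat i))))"
    proof (rule diagseq_holds)
      fix r s :: "nat \<Rightarrow> nat" and n assume "strict_mono r" "?P n s"
      then show "?P n (s \<circ> r)"
        using convergent_subseq_convergent[of "\<lambda>k. X (s k) (from_nat n)" r] by (simp add: o_def)
    qed
    then have "convergent (\<lambda>k. X (diagseq (k + Suc (to_nat i))) i)"
      by (simp add: o_def add.commute)
    then obtain L where "(\<lambda>k. X (diagseq (k + Suc (to_nat i))) i) \<longlonglongrightarrow> L" by (blast dest: convergentD)
    then have "(\<lambda>k. X (diagseq k) i) \<longlonglongrightarrow> L" by (rule LIMSEQ_offset)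
    then show ?thesis by (rule convergentI)
  qed
  show ?thesis by (rule that[OF subseq_diagseq conv])
qed

text \<open>Cell integrals are bounded sequences of numbers, so one subsequence makes them converge
  for all grid sizes at once. For differences of its members, the grid inequality leaves finitely
  many cell integrals, which tend to 0, and an error of order \<open>h^2\<close>. The result is a
  Cauchy condition; the limit is built later by completeness.\<close>

lemma Rellich_test_pairs:
  fixes \<Omega> :: "(real^'n) set" and \<phi> :: "nat \<Rightarrow> real^'n \<Rightarrow> real"
  assumes \<Omega>: "bounded \<Omega>" and p: "\<And>k. test_pair \<Omega> (\<phi> k) (\<psi> k)"
    and K: "\<And>k. (\<integral>x. (\<phi> k x)\<^sup>2 \<partial>lborel) \<le> K" "\<And>k. (\<integral>x. (norm (\<psi> k x))\<^sup>2 \<partial>lborel) \<le> K"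
  obtains r :: "nat \<Rightarrow> nat" where "strict_mono r"
    "\<And>e. e > 0 \<Longrightarrow> \<exists>N. \<forall>k\<ge>N. \<forall>l\<ge>N. (\<integral>x. (\<phi> (r k) x - \<phi> (r l) x)\<^sup>2 \<partial>lborel) < e"
proof -
  define hh where "hh q = 1 / (real q + 1)" for q :: nat
  have hpos: "hh q > 0" for q by (simp add: hh_def)
  have hle: "hh q \<le> 1" for q by (simp add: hh_def)
  define X where "X k i = (\<integral>x. indicator (cell (hh (fst i)) (snd i)) x * \<phi> k x \<partial>lborel)"
    for k and i :: "nat \<times> ('n \<Rightarrow> int)"
  note int = test_pair_integrable[OF p]
  have K0: "0 \<le> K" using K(1)[of 0] by (rule order_trans[rotated]) simp
  have cellint: "integrable lborel (\<lambda>x. indicator (cell (hh q) m) x * f x)"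
    if "integrable lborel f" for q m and f :: "real^'n \<Rightarrow> real"
    using integrable_mult_indicator[OF _ that, of "cell (hh q) m"] cell_borel[OF hpos[of q], of m] by simp
  have bd: "\<bar>X k i\<bar> \<le> 1 + K" for k i
  proof -
    obtain q m where i: "i = (q, m)" by force
    note cb = cell_borel[OF hpos[of q], of m]
    have "measure lborel (cell (hh q) m) \<le> 1"
      using emeasure_cell[OF hpos[of q], of m] hpos[of q] hle[of q]
      by (simp add: measure_def power_le_one)
    have ii: "integrable lborel (indicator (cell (hh q) m) :: _ \<Rightarrow> real)"
      using emeasure_cell[OF hpos[of q], of m] cb by (intro integrable_real_indicator) auto
    have le: "\<bar>indicator (cell (hh q) m) x * \<phi> k x\<bar> \<le> indicator (cell (hh q) m) x + (\<phi> k x)\<^sup>2" for x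
    proof -
      have "\<bar>\<phi> k x\<bar> \<le> 1 + (\<phi> k x)\<^sup>2"
        using sum_squares_bound[of 1 "\<bar>\<phi> k x\<bar>"] abs_ge_zero[of "\<phi> k x"] by (simp del: abs_ge_zero)
      then show ?thesis by (auto split: split_indicator)
    qed
    have "\<bar>X k i\<bar> \<le> (\<integral>x. \<bar>indicator (cell (hh q) m) x * \<phi> k x\<bar> \<partial>lborel)"
      unfolding X_def i by simp
    also have "\<dots> \<le> (\<integral>x. indicator (cell (hh q) m) x + (\<phi> k x)\<^sup>2 \<partial>lborel)"
      using cellint[OF int(1)] ii int(2) le by (intro integral_mono) auto
    also have "\<dots> = measure lborel (cell (hh q) m) + (\<integral>x. (\<phi> k x)\<^sup>2 \<partial>lborel)"
      using ii int(2) cb by simp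
    also have "\<dots> \<le> 1 + K" using \<open>measure lborel _ \<le> 1\<close> K(1)[of k] by linarith
    finally show ?thesis .
  qed
  obtain r where r: "strict_mono r" "\<And>i. convergent (\<lambda>k. X (r k) i)"
    using diagonal_convergent_subseq[of X, OF bd] by metis
  define a where "a i = lim (\<lambda>k. X (r k) i)" for i
  have lim: "(\<lambda>k. X (r k) i) \<longlonglongrightarrow> a i" for i
    using r(2) by (simp add: a_def convergent_LIMSEQ_iff)
  \<comment> \<open>What remains of the error term \<open>(2 h)^N N h^2 (4 K)\<close> after division
    by \<open>h^N h^2\<close>; \<open>4 * K\<close> bounds the squared gradient norm of a
    difference.\<close>
  define D where "D = 2 ^ CARD('n) * real CARD('n) * (4 * K)"
  have D0: "0 \<le> D" using K0 by (simp add: D_def)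
  have main: "\<exists>N. \<forall>k\<ge>N. \<forall>l\<ge>N. (\<integral>x. (\<phi> (r k) x - \<phi> (r l) x)\<^sup>2 \<partial>lborel) < e" if e: "e > 0" for e
  proof -
    \<comment> \<open>Chosen so that \<open>D * h^2 \<le> D * h < e / 2\<close> for
      \<open>h = 1 / (q + 1)\<close>; the other half of \<open>e\<close> is shared by the cell sums
      of the two indices.\<close>
    obtain q :: nat where q: "2 * D / e < q" using reals_Archimedean2 by blast
    let ?h = "hh q"
    define J where "J = cell_index ?h ` \<Omega>"
    have J: "finite J" unfolding J_def by (rule finite_cell_indices[OF \<Omega> hpos])
    have small: "D * ?h\<^sup>2 < e / 2"
    proof -
      have "D * ?h\<^sup>2 \<le> D * ?h"
        using D0 hpos[of q] hle[of q] by (intro mult_left_mono) (auto simp: power2_eq_square mult_left_le)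
      also have "\<dots> = D / (real q + 1)" by (simp add: hh_def)
      also have "\<dots> < e / 2"
      proof -
        have "2 * D < e * q" using q e by (simp add: field_simps)
        also have "\<dots> \<le> e * (real q + 1)" using e by simp
        finally show ?thesis by (simp add: field_simps)
      qed
      finally show ?thesis .
    qed
    define s where "s k = (\<Sum>m\<in>J. 2 * (X (r k) (q, m) - a (q, m))\<^sup>2)" for k
    have "s \<longlonglongrightarrow> (\<Sum>m\<in>J. 2 * (a (q, m) - a (q, m))\<^sup>2)"
      unfolding s_def[abs_def] by (intro tendsto_intros lim)
    then have "s \<longlonglongrightarrow> 0" by simp
    moreover have "0 < ?h ^ CARD('n) * e / 4" using hpos e by simp
    ultimately have "\<forall>\<^sub>F k in sequentially. s k < ?h ^ CARD('n) * e / 4"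
      by (rule order_tendstoD(2))
    then obtain N where N: "\<And>k. k \<ge> N \<Longrightarrow> s k < ?h ^ CARD('n) * e / 4"
      unfolding eventually_sequentially by blast
    show ?thesis
    proof (intro exI allI impI)
      fix k l assume kl: "k \<ge> N" "l \<ge> N"
      let ?f = "\<lambda>x. \<phi> (r k) x - \<phi> (r l) x" and ?g = "\<lambda>x. \<psi> (r k) x - \<psi> (r l) x"
      have fp: "test_pair \<Omega> ?f ?g" by (rule test_pair_diff[OF p p])
      have "?h ^ CARD('n) * (\<integral>x. (?f x)\<^sup>2 \<partial>lborel)
        \<le> (\<Sum>m\<in>J. (\<integral>x. indicator (cell ?h m) x * ?f x \<partial>lborel)\<^sup>2)
          + (2 * ?h) ^ CARD('n) * (real CARD('n) * ?h\<^sup>2) * (\<integral>x. (norm (?g x))\<^sup>2 \<partial>lborel)"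
      proof (rule cell_Poincare[OF fp hpos J])
        fix x assume "?f x \<noteq> 0"
        then have "x \<in> \<Omega>" using test_pair_vanish_outside(1)[OF fp] by blast
        then show "cell_index ?h x \<in> J" by (simp add: J_def)
      qed
      also have "(\<integral>x. (norm (?g x))\<^sup>2 \<partial>lborel) \<le> 4 * K"
      proof -
        have "(\<integral>x. (norm (?g x))\<^sup>2 \<partial>lborel) \<le> (\<integral>x. 2 * (norm (\<psi> (r k) x))\<^sup>2 + 2 * (norm (\<psi> (r l) x))\<^sup>2 \<partial>lborel)"
          using test_pair_integrable(3)[OF fp] int(3) norm_diff_sq_le by (intro integral_mono) auto
        also have "\<dots> = 2 * (\<integral>x. (norm (\<psi> (r k) x))\<^sup>2 \<partial>lborel) + 2 * (\<integral>x. (norm (\<psi> (r l) x))\<^sup>2 \<partial>lborel)"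
          using int(3) by simp
        finally show ?thesis using K(2)[of "r k"] K(2)[of "r l"] by linarith
      qed
      also have "(\<Sum>m\<in>J. (\<integral>x. indicator (cell ?h m) x * ?f x \<partial>lborel)\<^sup>2) \<le> s k + s l"
      proof -
        have "(\<integral>x. indicator (cell ?h m) x * ?f x \<partial>lborel) = X (r k) (q, m) - X (r l) (q, m)" for m
          unfolding X_def using cellint[OF int(1)] by (simp add: right_diff_distrib)
        moreover have "(X (r k) i - X (r l) i)\<^sup>2 \<le> 2 * (X (r k) i - a i)\<^sup>2 + 2 * (X (r l) i - a i)\<^sup>2" for i
          using norm_diff_sq_le[of "X (r k) i - a i" "X (r l) i - a i"] by simp
        ultimately show ?thesis
          unfolding s_def sum.distrib[symmetric] by (intro sum_mono) simp
      qed
      finally have "?h ^ CARD('n) * (\<integral>x. (?f x)\<^sup>2 \<partial>lborel)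
        \<le> s k + s l + (2 * ?h) ^ CARD('n) * (real CARD('n) * ?h\<^sup>2) * (4 * K)"
        using hpos[of q] by (simp add: mult_left_mono)
      also have "(2 * ?h) ^ CARD('n) * (real CARD('n) * ?h\<^sup>2) * (4 * K) = ?h ^ CARD('n) * (D * ?h\<^sup>2)"
        by (simp add: D_def power_mult_distrib)
      also have "s k + s l + ?h ^ CARD('n) * (D * ?h\<^sup>2) < ?h ^ CARD('n) * e / 4 + ?h ^ CARD('n) * e / 4 + ?h ^ CARD('n) * (e / 2)"
        using N[OF kl(1)] N[OF kl(2)] small hpos[of q] by (intro add_strict_mono mult_strict_left_mono) auto
      also have "\<dots> = ?h ^ CARD('n) * e" by simp
      finally show "(\<integral>x. (?f x)\<^sup>2 \<partial>lborel) < e" using hpos[of q] by simp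
    qed
  qed
  show ?thesis by (rule that[OF r(1)]) (rule main)
qed

text \<open>The abstract form of a vanishing first variation. At \<open>t = - b / d\<close> the
  linear term outweighs the quadratic one because \<open>c \<le> d\<close>; adding 1 keeps
  \<open>d\<close> positive when \<open>c = 0\<close>.\<close>

lemma quadratic_nonneg_imp_linear_zero:
  fixes b c :: real
  assumes "\<And>t. 0 \<le> 2 * t * b + t\<^sup>2 * c"
  shows "b = 0"
proof -
  define d where "d = \<bar>c\<bar> + 1"
  have "d > 0" by (simp add: d_def)
  have "0 \<le> 2 * (- b / d) * b + (- b / d)\<^sup>2 * c" by (rule assms)
  also have "(- b / d)\<^sup>2 * c \<le> (- b / d)\<^sup>2 * d" by (intro mult_left_mono) (auto simp: d_def)
  also have "2 * (- b / d) * b + (- b / d)\<^sup>2 * d = - (b\<^sup>2 / d)"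
    using \<open>d > 0\<close> by (simp add: power2_eq_square field_simps)
  finally have "b\<^sup>2 / d \<le> 0" by simp
  with \<open>d > 0\<close> show ?thesis by (simp add: divide_le_0_iff)
qed

section \<open>Approximation in the Dirichlet space\<close>

lemma L2_bound:
  fixes f :: "'a \<Rightarrow> 'b::euclidean_space" and w :: "'a \<Rightarrow> 'c::euclidean_space"
  assumes w: "w \<in> L2 M" and f[measurable]: "f \<in> borel_measurable M" and le: "\<And>x. norm (f x) \<le> norm (w x)"
  shows "f \<in> L2 M"
proof (rule L2_I[OF f])
  show "integrable M (\<lambda>x. (norm (f x))\<^sup>2)"
    by (rule Bochner_Integration.integrable_bound[OF L2_integrable_norm[OF w]])
       (use le in \<open>auto intro!: power_mono\<close>)
qed

locale bounded_open =
  fixes \<Omega> :: "(real^'n) set"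
  assumes open_Omega: "open \<Omega>" and bounded_Omega: "bounded \<Omega>"
begin

abbreviation "M \<equiv> lebesgue_on \<Omega>"

lemma Omega_sets[simp, measurable]: "\<Omega> \<in> sets lebesgue" "\<Omega> \<in> lmeasurable"
  using open_Omega bounded_Omega by (auto simp: lmeasurable_open)

lemma finite_M: "finite_measure M"
  by (intro finite_measure_restrict_space finite_measureI)
     (use Omega_sets(2) in \<open>auto simp: fmeasurable_def space_restrict_space emeasure_restrict_space intro!: finite_measureI\<close>)

lemma set_integral_M:
  "(LINT x:\<Omega>|lebesgue. f x) = integral\<^sup>L M f" for f :: "_ \<Rightarrow> real"
  by (simp add: set_lebesgue_integral_def integral_restrict_space)

lemma set_integrable_M:
  "set_integrable lebesgue \<Omega> f \<longleftrightarrow> integrable M f" for f :: "_ \<Rightarrow> real"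
  by (simp add: set_integrable_def integrable_restrict_space)

lemma AE_M: "(AE x in lebesgue. x \<in> \<Omega> \<longrightarrow> P x) \<longleftrightarrow> (AE x in M. P x)"
  by (simp add: AE_restrict_space_iff)

lemma continuous_M[measurable]:
  "continuous_on UNIV f \<Longrightarrow> f \<in> borel_measurable M" for f :: "_ \<Rightarrow> 'b::euclidean_space"
  by (intro measurable_restrict_space1 measurable_completion) (simp add: borel_measurable_continuous_onI)

text \<open>Bridges two settings: estimates for test functions live on the whole space with Borel
  sets, whereas \<open>H01\<close> uses the completed measure on \<open>\<Omega>\<close>.\<close>

lemma lborel_eq_M:
  fixes f :: "real^'n \<Rightarrow> real"
  assumes "continuous_on UNIV f" "\<And>x. x \<notin> \<Omega> \<Longrightarrow> f x = 0"
  shows "integral\<^sup>L M f = integral\<^sup>L lborel f" "integrable M f \<longleftrightarrow> integrable lborel f"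
    "(\<integral>\<^sup>+x. ennreal (f x) \<partial>M) = (\<integral>\<^sup>+x. ennreal (f x) \<partial>lborel)"
proof -
  have eq: "(\<lambda>x. indicator \<Omega> x *\<^sub>R f x) = f" using assms(2) by (auto simp: fun_eq_iff split: split_indicator)
  have m: "f \<in> borel_measurable lborel" using assms(1) by (simp add: borel_measurable_continuous_onI)
  show "integral\<^sup>L M f = integral\<^sup>L lborel f"
    unfolding integral_restrict_space[of \<Omega> lebesgue f, simplified] using eq m by (simp add: integral_completion)
  show "integrable M f \<longleftrightarrow> integrable lborel f"
    using eq m by (simp add: integrable_restrict_space integrable_completion)
  have "(\<lambda>x. ennreal (f x) * indicator \<Omega> x) = (\<lambda>x. ennreal (f x))"
    using assms(2) by (auto simp: fun_eq_iff split: split_indicator)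
  then show "(\<integral>\<^sup>+x. ennreal (f x) \<partial>M) = (\<integral>\<^sup>+x. ennreal (f x) \<partial>lborel)"
    by (simp add: nn_integral_restrict_space nn_integral_completion)
qed

lemma test_pair_M:
  assumes p: "test_pair \<Omega> \<phi> \<psi>"
  shows "\<phi> \<in> L2 M" "\<psi> \<in> L2 M" "(\<lambda>x. (\<phi> x)\<^sup>2) \<in> L2 M"
    "(\<integral>x. (\<phi> x)\<^sup>2 \<partial>M) = (\<integral>x. (\<phi> x)\<^sup>2 \<partial>lborel)"
    "(\<integral>x. (norm (\<psi> x))\<^sup>2 \<partial>M) = (\<integral>x. (norm (\<psi> x))\<^sup>2 \<partial>lborel)"
proof -
  note C = test_pair_continuous[OF p] and V = test_pair_vanish_outside[OF p] and int = test_pair_integrable[OF p]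
  have C1: "continuous_on UNIV (\<lambda>x. (\<phi> x)\<^sup>2)" "continuous_on UNIV (\<lambda>x. (norm (\<psi> x))\<^sup>2)"
    using C by (auto intro!: continuous_intros)
  note tr1 = lborel_eq_M[OF C1(1)] and tr2 = lborel_eq_M[OF C1(2)]
  show "(\<integral>x. (\<phi> x)\<^sup>2 \<partial>M) = (\<integral>x. (\<phi> x)\<^sup>2 \<partial>lborel)" using V by (intro tr1) simp
  show "(\<integral>x. (norm (\<psi> x))\<^sup>2 \<partial>M) = (\<integral>x. (norm (\<psi> x))\<^sup>2 \<partial>lborel)" using V by (intro tr2) simp
  show phi: "\<phi> \<in> L2 M" using tr1(2) V int continuous_M[OF C(1)] by (intro L2_I) auto
  show "\<psi> \<in> L2 M" using tr2(2) V int continuous_M[OF C(2)] by (intro L2_I) auto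
  obtain B where "\<And>x. \<bar>\<phi> x\<bar> \<le> B" using test_pair_bounded[OF p] by metis
  from L2_bounded_mult[OF phi continuous_M[OF C(1)] this]
  show "(\<lambda>x. (\<phi> x)\<^sup>2) \<in> L2 M" by (simp add: power2_eq_square)
qed

lemma test_pair_M_fourth_power:
  assumes p: "test_pair \<Omega> \<phi> \<psi>" and card: "CARD('n) \<le> 3"
  shows "(\<integral>\<^sup>+x. ennreal ((\<phi> x)^4) \<partial>M)
    \<le> ennreal (4 * ((\<integral>x. (\<phi> x)\<^sup>2 \<partial>M) + (\<integral>x. (norm (\<psi> x))\<^sup>2 \<partial>M))\<^sup>2)"
proof -
  note C = test_pair_continuous[OF p] and V = test_pair_vanish_outside[OF p] and int = test_pair_integrable[OF p]
  have "continuous_on UNIV (\<lambda>x. (\<phi> x)^4)" using C by (intro continuous_intros)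
  then have "(\<integral>\<^sup>+x. ennreal ((\<phi> x)^4) \<partial>M) = (\<integral>\<^sup>+x. ennreal ((\<phi> x)^4) \<partial>lborel)"
    using V by (intro lborel_eq_M) auto
  also have "\<dots> \<le> 4 * (energy \<phi> \<psi>)\<^sup>2" by (rule test_pair_fourth_power[OF p card])
  also have "energy \<phi> \<psi> = ennreal (\<integral>x. (\<phi> x)\<^sup>2 + (norm (\<psi> x))\<^sup>2 \<partial>lborel)"
    unfolding energy_def using int by (intro nn_integral_eq_integral) auto
  also have "(\<integral>x. (\<phi> x)\<^sup>2 + (norm (\<psi> x))\<^sup>2 \<partial>lborel) = (\<integral>x. (\<phi> x)\<^sup>2 \<partial>M) + (\<integral>x. (norm (\<psi> x))\<^sup>2 \<partial>M)"
    using int by (simp add: test_pair_M(4,5)[OF p])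
  finally show ?thesis by (simp add: ennreal_mult ennreal_power[symmetric])
qed

text \<open>Membership in \<open>H_0^1\<close> with the approximating sequence exposed. All
  conditions on \<open>u\<close> and \<open>g\<close> refer to the measure on
  \<open>\<Omega>\<close>, so their values elsewhere, even measurability there, are left
  free.\<close>

definition H01_seq :: "(nat \<Rightarrow> real^'n \<Rightarrow> real) \<Rightarrow> (nat \<Rightarrow> real^'n \<Rightarrow> real^'n)
    \<Rightarrow> (real^'n \<Rightarrow> real) \<Rightarrow> (real^'n \<Rightarrow> real^'n) \<Rightarrow> bool" where
  "H01_seq \<phi> \<psi> u g \<longleftrightarrow> (\<forall>k. test_pair \<Omega> (\<phi> k) (\<psi> k)) \<and> L2_tendsto M \<phi> u \<and> L2_tendsto M \<psi> g"

lemma H01_seqD: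
  assumes "H01_seq \<phi> \<psi> u g"
  shows "\<And>k. test_pair \<Omega> (\<phi> k) (\<psi> k)" "L2_tendsto M \<phi> u" "L2_tendsto M \<psi> g" "u \<in> L2 M" "g \<in> L2 M"
  using assms by (auto simp: H01_seq_def dest: L2_tendstoD)

lemma H01_seq_subseq:
  assumes "H01_seq \<phi> \<psi> u g" "strict_mono r"
  shows "H01_seq (\<lambda>k. \<phi> (r k)) (\<lambda>k. \<psi> (r k)) u g"
  using assms by (auto simp: H01_seq_def intro: L2_tendsto_subseq)

lemma H01_obtain_seq:
  assumes "H01 \<Omega> u g"
  obtains \<phi> \<psi> where "H01_seq \<phi> \<psi> u g"
proof -
  obtain \<phi> \<psi> where p: "\<forall>k. test_fun \<Omega> (\<phi> k) \<and> (\<forall>x. (\<phi> k has_derivative (\<lambda>h. \<psi> k x \<bullet> h)) (at x))"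
    and l: "(\<lambda>k. LINT x:\<Omega>|lebesgue. (\<phi> k x - u x)\<^sup>2) \<longlonglongrightarrow> 0"
      "(\<lambda>k. LINT x:\<Omega>|lebesgue. (norm (\<psi> k x - g x))\<^sup>2) \<longlonglongrightarrow> 0"
    using assms unfolding H01_def by auto
  have tp: "test_pair \<Omega> (\<phi> k) (\<psi> k)" for k using p by (auto simp: test_pair_def)
  have "u \<in> L2 M" "g \<in> L2 M"
    using assms unfolding H01_def set_integrable_M
    by (auto intro!: L2_I intro: measurable_restrict_space1)
  then have "H01_seq \<phi> \<psi> u g"
    unfolding H01_seq_def L2_tendsto_def
    using tp test_pair_M[OF tp] l unfolding set_integral_M by auto
  then show ?thesis using that by blast
qed

text \<open>The fourth-power bound is applied to differences \<open>\<phi>_k - \<phi>_l\<close>;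
  Fatou's lemma in \<open>l\<close> along an almost everywhere convergent subsequence then bounds
  the fourth power of \<open>\<phi>_k - u\<close> by the squared \<open>H^1\<close> distance, itself
  squared.\<close>

lemma H01_seq_fourth_power:
  assumes s: "H01_seq \<phi> \<psi> u g" and card: "CARD('n) \<le> 3"
  shows "(\<lambda>x. (u x)\<^sup>2) \<in> L2 M" "L2_tendsto M (\<lambda>k x. (\<phi> k x - u x)\<^sup>2) (\<lambda>x. 0)"
proof -
  note D = H01_seqD[OF s]
  note tp = D(1)
  note [measurable] = D(4)[THEN L2_measurable] test_pair_M(1)[OF tp, THEN L2_measurable]
  define d where "d k = (\<integral>x. (\<phi> k x - u x)\<^sup>2 \<partial>M) + (\<integral>x. (norm (\<psi> k x - g x))\<^sup>2 \<partial>M)" for k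
  have d0: "0 \<le> d k" for k by (simp add: d_def)
  have dlim: "d \<longlonglongrightarrow> 0"
    unfolding d_def[abs_def]
    using tendsto_add[OF L2_tendstoD(3)[OF D(2)] L2_tendstoD(3)[OF D(3)]] by simp
  have E: "(\<integral>x. (\<phi> k x - \<phi> l x)\<^sup>2 \<partial>M) + (\<integral>x. (norm (\<psi> k x - \<psi> l x))\<^sup>2 \<partial>M) \<le> 2 * (d k + d l)" for k l
  proof -
    have split: "(\<integral>x. (norm (f x - f' x))\<^sup>2 \<partial>M) \<le> 2 * (\<integral>x. (norm (f x - h x))\<^sup>2 \<partial>M) + 2 * (\<integral>x. (norm (f' x - h x))\<^sup>2 \<partial>M)"
      if "f \<in> L2 M" "f' \<in> L2 M" "h \<in> L2 M" for f f' h :: "real^'n \<Rightarrow> 'c::euclidean_space"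
    proof -
      have i: "integrable M (\<lambda>x. (norm (f x - h x))\<^sup>2)" "integrable M (\<lambda>x. (norm (f' x - h x))\<^sup>2)"
        "integrable M (\<lambda>x. (norm (f x - f' x))\<^sup>2)"
        using that by (auto intro!: L2_integrable_norm)
      have "(\<integral>x. (norm (f x - f' x))\<^sup>2 \<partial>M) \<le> (\<integral>x. 2 * (norm (f x - h x))\<^sup>2 + 2 * (norm (f' x - h x))\<^sup>2 \<partial>M)"
        using i norm_diff_sq_le[of "f x - h x" "f' x - h x" for x] by (intro integral_mono) auto
      then show ?thesis using i by simp
    qed
    show ?thesis
      using split[OF test_pair_M(1)[OF tp[of k]] test_pair_M(1)[OF tp[of l]] D(4)]
        split[OF test_pair_M(2)[OF tp[of k]] test_pair_M(2)[OF tp[of l]] D(5)]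
      by (simp add: d_def)
  qed
  obtain r where r: "strict_mono r" and ae: "AE x in M. (\<lambda>k. \<phi> (r k) x) \<longlonglongrightarrow> u x"
    using L2_tendsto_AE_subseq[OF D(2)] by metis
  have bound: "(\<integral>\<^sup>+x. ennreal ((\<phi> k x - u x)^4) \<partial>M) \<le> ennreal (16 * (d k)\<^sup>2)" for k
  proof -
    have "(\<integral>\<^sup>+x. ennreal ((\<phi> k x - u x)^4) \<partial>M) = (\<integral>\<^sup>+x. liminf (\<lambda>l. ennreal ((\<phi> k x - \<phi> (r l) x)^4)) \<partial>M)"
    proof (rule nn_integral_cong_AE)
      show "AE x in M. ennreal ((\<phi> k x - u x)^4) = liminf (\<lambda>l. ennreal ((\<phi> k x - \<phi> (r l) x)^4))"
        using ae
      proof eventually_elim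
        case (elim x)
        then have "(\<lambda>l. ennreal ((\<phi> k x - \<phi> (r l) x)^4)) \<longlonglongrightarrow> ennreal ((\<phi> k x - u x)^4)"
          by (intro tendsto_intros tendsto_ennrealI)
        then show ?case by (intro lim_imp_Liminf[symmetric]) auto
      qed
    qed
    also have "\<dots> \<le> liminf (\<lambda>l. \<integral>\<^sup>+x. ennreal ((\<phi> k x - \<phi> (r l) x)^4) \<partial>M)"
      by (rule nn_integral_liminf) measurable
    also have "\<dots> \<le> liminf (\<lambda>l. ennreal (4 * (2 * (d k + d (r l)))\<^sup>2))"
    proof (rule Liminf_mono, rule always_eventually, rule allI)
      fix l
      have "(\<integral>\<^sup>+x. ennreal ((\<phi> k x - \<phi> (r l) x)^4) \<partial>M)
        \<le> ennreal (4 * ((\<integral>x. (\<phi> k x - \<phi> (r l) x)\<^sup>2 \<partial>M) + (\<integral>x. (norm (\<psi> k x - \<psi> (r l) x))\<^sup>2 \<partial>M))\<^sup>2)"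
        by (rule test_pair_M_fourth_power[OF test_pair_diff[OF tp tp] card])
      also have "\<dots> \<le> ennreal (4 * (2 * (d k + d (r l)))\<^sup>2)"
        using E[of k "r l"] by (intro ennreal_leI mult_left_mono power_mono) auto
      finally show "(\<integral>\<^sup>+x. ennreal ((\<phi> k x - \<phi> (r l) x)^4) \<partial>M) \<le> ennreal (4 * (2 * (d k + d (r l)))\<^sup>2)" .
    qed
    also have "\<dots> = ennreal (4 * (2 * (d k + 0))\<^sup>2)"
      by (intro lim_imp_Liminf tendsto_ennrealI tendsto_intros LIMSEQ_subseq_LIMSEQ[OF dlim r, unfolded o_def]) auto
    also have "\<dots> = ennreal (16 * (d k)\<^sup>2)" by (simp add: power_mult_distrib)
    finally show ?thesis .
  qed
  have int4: "integrable M (\<lambda>x. (\<phi> k x - u x)^4)" for k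
    using bound[of k] by (intro integrableI_bounded) (auto elim!: le_less_trans)
  have sq4: "(norm (t\<^sup>2))\<^sup>2 = t^4" for t :: real by simp
  have wL: "(\<lambda>x. (\<phi> k x - u x)\<^sup>2) \<in> L2 M" for k
    by (rule L2_I) (use int4[of k] in \<open>auto simp: sq4\<close>)
  show "L2_tendsto M (\<lambda>k x. (\<phi> k x - u x)\<^sup>2) (\<lambda>x. 0)"
  proof (rule L2_tendsto_squeeze[OF wL])
    show "(\<lambda>x. 0) \<in> L2 M" by (rule L2_I) auto
    show "(\<integral>x. (norm ((\<phi> k x - u x)\<^sup>2 - 0))\<^sup>2 \<partial>M) \<le> 16 * (d k)\<^sup>2" for k
    proof -
      have "ennreal (\<integral>x. (\<phi> k x - u x)^4 \<partial>M) \<le> ennreal (16 * (d k)\<^sup>2)"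
        using bound[of k] int4[of k] by (subst (asm) nn_integral_eq_integral) auto
      then show ?thesis by (simp add: sq4 ennreal_le_iff)
    qed
    show "(\<lambda>k. 16 * (d k)\<^sup>2) \<longlonglongrightarrow> 0"
      using tendsto_mult_right_zero[OF tendsto_power[OF dlim, of 2, simplified], of 16] by simp
  qed
  \<comment> \<open>Integrability of \<open>u^4\<close> follows by comparing \<open>u\<close> with a
    single approximant, which is bounded.\<close>
  have "(\<lambda>x. 2 *\<^sub>R (\<phi> 0 x - u x)\<^sup>2 + 2 *\<^sub>R (\<phi> 0 x)\<^sup>2) \<in> L2 M"
    by (intro L2_add L2_scaleR wL test_pair_M(3)[OF tp])
  then show "(\<lambda>x. (u x)\<^sup>2) \<in> L2 M"
  proof (rule L2_bound)
    show "norm ((u x)\<^sup>2) \<le> norm (2 *\<^sub>R (\<phi> 0 x - u x)\<^sup>2 + 2 *\<^sub>R (\<phi> 0 x)\<^sup>2)" for x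
      using norm_diff_sq_le[of "\<phi> 0 x" "\<phi> 0 x - u x"] by simp
  qed measurable
qed

lemma L4_mult_L2:
  assumes a: "a \<in> borel_measurable M" "(\<lambda>x. (a x)\<^sup>2) \<in> L2 M"
    and b: "b \<in> borel_measurable M" "(\<lambda>x. (b x)\<^sup>2) \<in> L2 M"
  shows "(\<lambda>x. a x * b x :: real) \<in> L2 M"
proof (rule L2_I)
  note [measurable] = a(1) b(1)
  show "integrable M (\<lambda>x. (norm (a x * b x))\<^sup>2)"
    using L2_integrable_inner[OF a(2) b(2)] by (simp add: power_mult_distrib abs_mult)
qed (use a(1) b(1) in measurable)

text \<open>The squared distance is the inner product of \<open>a^2\<close> with
  \<open>(\<phi>_k - u)^2\<close>; the first is fixed in \<open>L2\<close> and the second tends to 0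
  there.\<close>

lemma H01_seq_mult_tendsto:
  assumes s: "H01_seq \<phi> \<psi> u g" and card: "CARD('n) \<le> 3"
    and a[measurable]: "a \<in> borel_measurable M" and a2: "(\<lambda>x. (a x)\<^sup>2) \<in> L2 M"
  shows "L2_tendsto M (\<lambda>k x. a x * \<phi> k x) (\<lambda>x. a x * u x)"
proof (rule L2_tendsto_squeeze)
  note D = H01_seqD[OF s] and F = H01_seq_fourth_power[OF s card]
  note [measurable] = D(4)[THEN L2_measurable]
  show "(\<lambda>x. a x * \<phi> k x) \<in> L2 M" for k
    using test_pair_M[OF D(1)] a a2 by (intro L4_mult_L2) (auto dest: L2_measurable)
  show "(\<lambda>x. a x * u x) \<in> L2 M"
    using F a2 by (intro L4_mult_L2) auto
  have eq: "(norm (a x * \<phi> k x - a x * u x))\<^sup>2 = (a x)\<^sup>2 \<bullet> (\<phi> k x - u x)\<^sup>2" for k x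
    by (simp add: power_mult_distrib[symmetric] right_diff_distrib)
  show "(\<integral>x. (norm (a x * \<phi> k x - a x * u x))\<^sup>2 \<partial>M) \<le> (\<integral>x. (a x)\<^sup>2 \<bullet> (\<phi> k x - u x)\<^sup>2 \<partial>M)" for k
    by (simp only: eq)
  show "(\<lambda>k. \<integral>x. (a x)\<^sup>2 \<bullet> (\<phi> k x - u x)\<^sup>2 \<partial>M) \<longlonglongrightarrow> 0"
    using L2_tendsto_inner[OF L2_tendsto_const[OF a2] F(2)] by simp
qed

end

section \<open>The ground state\<close>

context bounded_open begin

lemma integral_M_indicator:
  fixes f :: "real^'n \<Rightarrow> real"
  assumes "\<And>x. x \<in> \<Omega> \<Longrightarrow> f x = f' x"
  shows "integral\<^sup>L M f = integral\<^sup>L M f'" "integrable M f \<longleftrightarrow> integrable M f'"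
  using assms by (auto simp: space_restrict_space intro!: Bochner_Integration.integral_cong Bochner_Integration.integrable_cong)

text \<open>\<open>H01\<close> demands measurability on the whole space, hence the extension by
  zero.\<close>

lemma H01_seq_imp_H01:
  assumes s: "H01_seq \<phi> \<psi> u g"
  shows "H01 \<Omega> (\<lambda>x. indicator \<Omega> x * u x) (\<lambda>x. indicator \<Omega> x *\<^sub>R g x)"
proof -
  note D = H01_seqD[OF s]
  have m: "(\<lambda>x. indicator \<Omega> x * u x) \<in> borel_measurable lebesgue"
    "(\<lambda>x. indicator \<Omega> x *\<^sub>R g x) \<in> borel_measurable lebesgue"
    using D(4,5)[THEN L2_measurable] borel_measurable_restrict_space_iff[of \<Omega> lebesgue u]
      borel_measurable_restrict_space_iff[of \<Omega> lebesgue g] by auto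
  have i: "integrable M (\<lambda>x. (indicator \<Omega> x * u x)\<^sup>2)" "integrable M (\<lambda>x. (norm (indicator \<Omega> x *\<^sub>R g x))\<^sup>2)"
    using D(4,5)[THEN L2_integrable_norm]
    by (subst integral_M_indicator(2); simp)+
  have l1: "(\<lambda>k. \<integral>x. (\<phi> k x - indicator \<Omega> x * u x)\<^sup>2 \<partial>M) \<longlonglongrightarrow> 0"
    using L2_tendstoD(3)[OF D(2)]
      integral_M_indicator(1)[of "\<lambda>x. (\<phi> k x - indicator \<Omega> x * u x)\<^sup>2" "\<lambda>x. (\<phi> k x - u x)\<^sup>2" for k]
    by simp
  have l2: "(\<lambda>k. \<integral>x. (norm (\<psi> k x - indicator \<Omega> x *\<^sub>R g x))\<^sup>2 \<partial>M) \<longlonglongrightarrow> 0"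
    using L2_tendstoD(3)[OF D(3)]
      integral_M_indicator(1)[of "\<lambda>x. (norm (\<psi> k x - indicator \<Omega> x *\<^sub>R g x))\<^sup>2" "\<lambda>x. (norm (\<psi> k x - g x))\<^sup>2" for k]
    by simp
  show ?thesis
    unfolding H01_def set_integrable_M set_integral_M
    using m i l1 l2 D(1) unfolding test_pair_def by blast
qed

section \<open>Minimising the Rayleigh quotient\<close>

definition rayleigh :: real where
  "rayleigh = Inf {(\<integral>x. (norm (\<psi> x))\<^sup>2 \<partial>M) | \<phi> \<psi>. test_pair \<Omega> \<phi> \<psi> \<and> (\<integral>x. (\<phi> x)\<^sup>2 \<partial>M) = 1}"

lemma test_pair_normalize:
  assumes p: "test_pair \<Omega> \<phi> \<psi>" and nz: "(\<integral>x. (\<phi> x)\<^sup>2 \<partial>M) \<noteq> 0"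
  obtains \<phi>' \<psi>' where "test_pair \<Omega> \<phi>' \<psi>'" "(\<integral>x. (\<phi>' x)\<^sup>2 \<partial>M) = 1"
    "(\<integral>x. (norm (\<psi>' x))\<^sup>2 \<partial>M) = (\<integral>x. (norm (\<psi> x))\<^sup>2 \<partial>M) / (\<integral>x. (\<phi> x)\<^sup>2 \<partial>M)"
proof
  define N where "N = (\<integral>x. (\<phi> x)\<^sup>2 \<partial>M)"
  have "N \<ge> 0" by (simp add: N_def)
  with nz have N: "N > 0" unfolding N_def by linarith
  define c where "c = 1 / sqrt N"
  have c2: "c\<^sup>2 = 1 / N" using N by (simp add: c_def power_divide)
  show "test_pair \<Omega> (\<lambda>x. c * \<phi> x) (\<lambda>x. c *\<^sub>R \<psi> x)" by (rule test_pair_scale[OF p])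
  show "(\<integral>x. (c * \<phi> x)\<^sup>2 \<partial>M) = 1"
    using N by (simp add: power_mult_distrib c2 N_def[symmetric])
  show "(\<integral>x. (norm (c *\<^sub>R \<psi> x))\<^sup>2 \<partial>M) = (\<integral>x. (norm (\<psi> x))\<^sup>2 \<partial>M) / (\<integral>x. (\<phi> x)\<^sup>2 \<partial>M)"
    by (simp add: power_mult_distrib c2 N_def)
qed

lemma rayleigh_le:
  assumes p: "test_pair \<Omega> \<phi> \<psi>"
  shows "rayleigh * (\<integral>x. (\<phi> x)\<^sup>2 \<partial>M) \<le> (\<integral>x. (norm (\<psi> x))\<^sup>2 \<partial>M)"
proof (cases "(\<integral>x. (\<phi> x)\<^sup>2 \<partial>M) = 0")
  case True
  then show ?thesis by simp
next
  case False
  obtain \<phi>' \<psi>' where n: "test_pair \<Omega> \<phi>' \<psi>'" "(\<integral>x. (\<phi>' x)\<^sup>2 \<partial>M) = 1"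
    "(\<integral>x. (norm (\<psi>' x))\<^sup>2 \<partial>M) = (\<integral>x. (norm (\<psi> x))\<^sup>2 \<partial>M) / (\<integral>x. (\<phi> x)\<^sup>2 \<partial>M)"
    by (rule test_pair_normalize[OF p False])
  have "rayleigh \<le> (\<integral>x. (norm (\<psi>' x))\<^sup>2 \<partial>M)"
    unfolding rayleigh_def
  proof (rule cInf_lower)
    show "(\<integral>x. (norm (\<psi>' x))\<^sup>2 \<partial>M)
      \<in> {(\<integral>x. (norm (\<psi> x))\<^sup>2 \<partial>M) | \<phi> \<psi>. test_pair \<Omega> \<phi> \<psi> \<and> (\<integral>x. (\<phi> x)\<^sup>2 \<partial>M) = 1}"
      using n by blast
  qed (auto intro!: bdd_belowI[of _ 0])
  moreover have "(\<integral>x. (\<phi> x)\<^sup>2 \<partial>M) \<ge> 0" by simp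
  with False have "(\<integral>x. (\<phi> x)\<^sup>2 \<partial>M) > 0" by linarith
  ultimately show ?thesis unfolding n(3) by (simp only: pos_le_divide_eq)
qed

lemma rayleigh_le_H01:
  assumes s: "H01_seq \<phi> \<psi> u g"
  shows "rayleigh * (\<integral>x. (u x)\<^sup>2 \<partial>M) \<le> (\<integral>x. (norm (g x))\<^sup>2 \<partial>M)"
proof (rule LIMSEQ_le)
  note D = H01_seqD[OF s]
  show "(\<lambda>k. rayleigh * (\<integral>x. (\<phi> k x)\<^sup>2 \<partial>M)) \<longlonglongrightarrow> rayleigh * (\<integral>x. (u x)\<^sup>2 \<partial>M)"
    using tendsto_mult[OF tendsto_const L2_tendsto_norm[OF D(2)]] by simp
  show "(\<lambda>k. \<integral>x. (norm (\<psi> k x))\<^sup>2 \<partial>M) \<longlonglongrightarrow> (\<integral>x. (norm (g x))\<^sup>2 \<partial>M)"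
    by (rule L2_tendsto_norm[OF D(3)])
  show "\<exists>N. \<forall>n\<ge>N. rayleigh * (\<integral>x. (\<phi> n x)\<^sup>2 \<partial>M) \<le> (\<integral>x. (norm (\<psi> n x))\<^sup>2 \<partial>M)"
    using rayleigh_le[OF D(1)] by blast
qed

text \<open>Compactness gives a minimising sequence that is Cauchy as functions. The parallelogram
  law and the lower bound for sums of its members upgrade this to the gradients, so the limit
  attains the infimum.\<close>

lemma rayleigh_minimizer:
  assumes ex: "test_pair \<Omega> \<phi>0 \<psi>0" "(\<integral>x. (\<phi>0 x)\<^sup>2 \<partial>M) \<noteq> 0"
  obtains \<phi> \<psi> e g where "H01_seq \<phi> \<psi> e g" "(\<integral>x. (e x)\<^sup>2 \<partial>M) = 1" "(\<integral>x. (norm (g x))\<^sup>2 \<partial>M) = rayleigh"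
proof -
  let ?S = "{(\<integral>x. (norm (\<psi> x))\<^sup>2 \<partial>M) | \<phi> \<psi>. test_pair \<Omega> \<phi> \<psi> \<and> (\<integral>x. (\<phi> x)\<^sup>2 \<partial>M) = 1}"
  have ne: "?S \<noteq> {}" using test_pair_normalize[OF ex] by blast
  have bb: "bdd_below ?S" by (rule bdd_belowI[of _ 0]) auto
  have "\<exists>\<phi> \<psi>. test_pair \<Omega> \<phi> \<psi> \<and> (\<integral>x. (\<phi> x)\<^sup>2 \<partial>M) = 1 \<and> (\<integral>x. (norm (\<psi> x))\<^sup>2 \<partial>M) < rayleigh + 1 / (real k + 1)" for k :: nat
  proof -
    have "\<exists>s\<in>?S. s < rayleigh + 1 / (real k + 1)"
      using cInf_less_iff[OF ne bb, of "rayleigh + 1 / (real k + 1)"] by (simp add: rayleigh_def)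
    then show ?thesis by blast
  qed
  then obtain \<phi> \<psi> where p: "\<And>k. test_pair \<Omega> (\<phi> k) (\<psi> k)" and n1: "\<And>k. (\<integral>x. (\<phi> k x)\<^sup>2 \<partial>M) = 1"
    and up: "\<And>k::nat. (\<integral>x. (norm (\<psi> k x))\<^sup>2 \<partial>M) < rayleigh + 1 / (real k + 1)"
    by metis
  have r0: "0 \<le> rayleigh" unfolding rayleigh_def by (rule cInf_greatest[OF ne]) auto
  have K2: "(\<integral>x. (norm (\<psi> k x))\<^sup>2 \<partial>lborel) \<le> rayleigh + 1" for k
  proof -
    have "1 / (real k + 1) \<le> 1" by simp
    then show ?thesis using up[of k] unfolding test_pair_M(5)[OF p] by linarith
  qed
  have K1: "(\<integral>x. (\<phi> k x)\<^sup>2 \<partial>lborel) \<le> rayleigh + 1" for k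
    using n1[of k] r0 unfolding test_pair_M(4)[OF p] by simp
  obtain r :: "nat \<Rightarrow> nat" where r: "strict_mono r"
    and ca0: "\<And>e. e > 0 \<Longrightarrow> \<exists>N. \<forall>k\<ge>N. \<forall>l\<ge>N. (\<integral>x. (\<phi> (r k) x - \<phi> (r l) x)\<^sup>2 \<partial>lborel) < e"
    by (rule Rellich_test_pairs[where \<phi>=\<phi> and \<psi>=\<psi>, OF bounded_Omega p K1 K2]) blast
  define f where "f k = \<phi> (r k)" for k
  define w where "w k = \<psi> (r k)" for k
  have fp: "test_pair \<Omega> (f k) (w k)" for k unfolding f_def w_def by (rule p)
  note fL = test_pair_M[OF fp]
  have ca: "\<exists>N. \<forall>k\<ge>N. \<forall>l\<ge>N. (\<integral>x. (norm (f k x - f l x))\<^sup>2 \<partial>M) < e" if "e > 0" for e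
    using ca0[OF that] test_pair_M(4)[OF test_pair_diff[OF fp fp]] by (simp add: f_def)
  have f1: "(\<integral>x. (f k x)\<^sup>2 \<partial>M) = 1" for k by (simp add: f_def n1)
  have wup: "(\<integral>x. (norm (w k x))\<^sup>2 \<partial>M) < rayleigh + 1 / (real k + 1)" for k
  proof -
    have "1 / (real (r k) + 1) \<le> 1 / (real k + 1)"
      using seq_suble[OF r, of k] by (intro divide_left_mono) auto
    then show ?thesis using up[of "r k"] by (simp add: w_def)
  qed
  \<comment> \<open>\<open>f k + f l\<close> is a competitor with squared norm
    \<open>4 - |f k - f l|^2\<close>. Hence its gradient is nearly as large as the parallelogram law
    allows, which leaves little for the gradient of the difference.\<close>
  have par: "(\<integral>x. (norm (w k x - w l x))\<^sup>2 \<partial>M)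
     \<le> 2 / (real k + 1) + 2 / (real l + 1) + rayleigh * (\<integral>x. (norm (f k x - f l x))\<^sup>2 \<partial>M)" for k l
  proof -
    have para: "(norm (a - b))\<^sup>2 = 2 * (norm a)\<^sup>2 + 2 * (norm b)\<^sup>2 - (norm (a + b))\<^sup>2" for a b :: "'c::real_inner"
      by (simp add: power2_norm_eq_inner algebra_simps inner_commute)
    have pI: "(\<integral>x. (norm (a x - b x))\<^sup>2 \<partial>M)
       = 2 * (\<integral>x. (norm (a x))\<^sup>2 \<partial>M) + 2 * (\<integral>x. (norm (b x))\<^sup>2 \<partial>M) - (\<integral>x. (norm (a x + b x))\<^sup>2 \<partial>M)"
      if "a \<in> L2 M" "b \<in> L2 M" for a b :: "real^'n \<Rightarrow> 'c::euclidean_space"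
      using L2_integrable_norm[OF that(1)] L2_integrable_norm[OF that(2)] L2_integrable_norm[OF L2_add[OF that]]
      unfolding para by simp
    have "rayleigh * (\<integral>x. (f k x + f l x)\<^sup>2 \<partial>M) \<le> (\<integral>x. (norm (w k x + w l x))\<^sup>2 \<partial>M)"
      by (rule rayleigh_le[OF test_pair_add[OF fp fp]])
    moreover have "(\<integral>x. (f k x + f l x)\<^sup>2 \<partial>M) = 4 - (\<integral>x. (norm (f k x - f l x))\<^sup>2 \<partial>M)"
      using pI[OF fL(1)[of k] fL(1)[of l]] f1[of k] f1[of l] by simp
    ultimately have "rayleigh * (4 - (\<integral>x. (norm (f k x - f l x))\<^sup>2 \<partial>M)) \<le> (\<integral>x. (norm (w k x + w l x))\<^sup>2 \<partial>M)"
      by simp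
    then show ?thesis
      using pI[OF fL(2)[of k] fL(2)[of l]] wup[of k] wup[of l] by (simp add: algebra_simps)
  qed
  have caw: "\<exists>N. \<forall>k\<ge>N. \<forall>l\<ge>N. (\<integral>x. (norm (w k x - w l x))\<^sup>2 \<partial>M) < e" if e: "e > 0" for e
  proof -
    \<comment> \<open>Dividing by \<open>rayleigh + 1\<close> avoids a separate treatment of the
      value 0.\<close>
    obtain N1 where N1: "\<forall>k\<ge>N1. \<forall>l\<ge>N1. (\<integral>x. (norm (f k x - f l x))\<^sup>2 \<partial>M) < e / (2 * (rayleigh + 1))"
      using ca[of "e / (2 * (rayleigh + 1))"] e r0 by auto
    \<comment> \<open>Makes each of the two excess terms smaller than \<open>e / 4\<close>.\<close>
    obtain N2 :: nat where N2: "8 / e < N2" using reals_Archimedean2 by blast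
    have small: "2 / (real k + 1) < e / 4" if "k \<ge> N2" for k
    proof -
      have "8 / e < real k + 1" using N2 that by linarith
      then show ?thesis using e by (simp add: field_simps)
    qed
    show ?thesis
    proof (intro exI[of _ "max N1 N2"] allI impI)
      fix k l assume kl: "k \<ge> max N1 N2" "l \<ge> max N1 N2"
      have "(\<integral>x. (norm (f k x - f l x))\<^sup>2 \<partial>M) < e / (2 * (rayleigh + 1))" using N1 kl by auto
      then have "rayleigh * (\<integral>x. (norm (f k x - f l x))\<^sup>2 \<partial>M) \<le> rayleigh * (e / (2 * (rayleigh + 1)))"
        using r0 by (intro mult_left_mono) auto
      also have "\<dots> \<le> e / 2" using r0 e by (simp add: field_simps)
      finally show "(\<integral>x. (norm (w k x - w l x))\<^sup>2 \<partial>M) < e"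
        using par[of k l] small[of k] small[of l] kl by auto
    qed
  qed
  obtain e where e: "L2_tendsto M f e" using L2_complete[OF finite_M fL(1) ca] by metis
  obtain g where g: "L2_tendsto M w g" using L2_complete[OF finite_M fL(2) caw] by metis
  have s: "H01_seq f w e g" using fp e g by (simp add: H01_seq_def)
  have e1: "(\<integral>x. (e x)\<^sup>2 \<partial>M) = 1"
    using L2_tendsto_norm[OF e] f1 by (simp add: LIMSEQ_const_iff)
  have "(\<integral>x. (norm (g x))\<^sup>2 \<partial>M) \<le> rayleigh"
  proof (rule LIMSEQ_le[OF L2_tendsto_norm[OF g]])
    have "(\<lambda>k. rayleigh + 1 / (real k + 1)) \<longlonglongrightarrow> rayleigh + 0"
      using LIMSEQ_inverse_real_of_nat by (intro tendsto_intros) (simp add: inverse_eq_divide add.commute)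
    then show "(\<lambda>k. rayleigh + 1 / (real k + 1)) \<longlonglongrightarrow> rayleigh" by simp
    show "\<exists>N. \<forall>n\<ge>N. (\<integral>x. (norm (w n x))\<^sup>2 \<partial>M) \<le> rayleigh + 1 / (real n + 1)"
      using wup less_imp_le by blast
  qed
  moreover have "rayleigh \<le> (\<integral>x. (norm (g x))\<^sup>2 \<partial>M)" using rayleigh_le_H01[OF s] e1 by simp
  ultimately have "(\<integral>x. (norm (g x))\<^sup>2 \<partial>M) = rayleigh" by simp
  then show ?thesis using that[OF s e1] by simp
qed

text \<open>The Rayleigh inequality holds for \<open>e + t \<eta>\<close> for every real
  \<open>t\<close>, with equality at \<open>t = 0\<close>; the coefficient linear in
  \<open>t\<close> must vanish.\<close>

lemma rayleigh_minimizer_eigen: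
  assumes s: "H01_seq \<phi> \<psi> e g" and e1: "(\<integral>x. (e x)\<^sup>2 \<partial>M) = 1" and g1: "(\<integral>x. (norm (g x))\<^sup>2 \<partial>M) = rayleigh"
    and p: "test_pair \<Omega> \<eta> \<xi>"
  shows "(\<integral>x. g x \<bullet> \<xi> x \<partial>M) = rayleigh * (\<integral>x. e x * \<eta> x \<partial>M)"
proof -
  note D = H01_seqD[OF s] and P = test_pair_M[OF p]
  have exp: "(\<integral>x. (norm (a x + t *\<^sub>R b x))\<^sup>2 \<partial>M)
      = (\<integral>x. (norm (a x))\<^sup>2 \<partial>M) + 2 * t * (\<integral>x. a x \<bullet> b x \<partial>M) + t\<^sup>2 * (\<integral>x. (norm (b x))\<^sup>2 \<partial>M)"
    if "a \<in> L2 M" "b \<in> L2 M" for a b :: "real^'n \<Rightarrow> 'c::euclidean_space" and t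
  proof -
    have "(norm (a x + t *\<^sub>R b x))\<^sup>2 = (norm (a x))\<^sup>2 + 2 * t * (a x \<bullet> b x) + t\<^sup>2 * (norm (b x))\<^sup>2" for x
      by (simp add: power2_norm_eq_inner algebra_simps inner_commute) (simp add: power2_eq_square)
    then show ?thesis
      using L2_integrable_norm[OF that(1)] L2_integrable_norm[OF that(2)] L2_integrable_inner[OF that] by simp
  qed
  have "0 \<le> 2 * t * ((\<integral>x. g x \<bullet> \<xi> x \<partial>M) - rayleigh * (\<integral>x. e x * \<eta> x \<partial>M))
      + t\<^sup>2 * ((\<integral>x. (norm (\<xi> x))\<^sup>2 \<partial>M) - rayleigh * (\<integral>x. (\<eta> x)\<^sup>2 \<partial>M))" for t
  proof -
    have "H01_seq (\<lambda>k x. \<phi> k x + t *\<^sub>R \<eta> x) (\<lambda>k x. \<psi> k x + t *\<^sub>R \<xi> x) (\<lambda>x. e x + t *\<^sub>R \<eta> x) (\<lambda>x. g x + t *\<^sub>R \<xi> x)"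
      unfolding H01_seq_def
      using test_pair_add[OF D(1) test_pair_scale[OF p, of t]] P(1,2) D(2,3)
      by (intro conjI allI L2_tendsto_add L2_tendsto_const L2_scaleR) auto
    from rayleigh_le_H01[OF this]
    have "rayleigh * (\<integral>x. (norm (e x + t *\<^sub>R \<eta> x))\<^sup>2 \<partial>M) \<le> (\<integral>x. (norm (g x + t *\<^sub>R \<xi> x))\<^sup>2 \<partial>M)"
      by simp
    then show ?thesis
      unfolding exp[OF D(4) P(1)] exp[OF D(5) P(2)] using e1 g1 by (simp add: algebra_simps)
  qed
  then have "(\<integral>x. g x \<bullet> \<xi> x \<partial>M) - rayleigh * (\<integral>x. e x * \<eta> x \<partial>M) = 0"
    by (rule quadratic_nonneg_imp_linear_zero)
  then show ?thesis by simp
qed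

text \<open>Every eigenvalue is the Rayleigh quotient of its eigenfunction, hence at least the
  infimum of these quotients.\<close>

lemma rayleigh_le_principal_eigenvalue:
  assumes s: "H01_seq \<phi> \<psi> e g" and e1: "(\<integral>x. (e x)\<^sup>2 \<partial>M) = 1" and g1: "(\<integral>x. (norm (g x))\<^sup>2 \<partial>M) = rayleigh"
  shows "rayleigh \<le> principal_eigenvalue \<Omega>"
  unfolding principal_eigenvalue_def
proof (rule cInf_greatest)
  let ?e = "\<lambda>x. indicator \<Omega> x * e x" and ?g = "\<lambda>x. indicator \<Omega> x *\<^sub>R g x"
  have "dirichlet_eigenvalue \<Omega> rayleigh"
    unfolding dirichlet_eigenvalue_def
  proof (intro exI conjI allI impI)
    show "H01 \<Omega> ?e ?g" by (rule H01_seq_imp_H01[OF s])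
    show "\<not> (AE x in lebesgue. x \<in> \<Omega> \<longrightarrow> ?e x = 0)"
    proof
      assume "AE x in lebesgue. x \<in> \<Omega> \<longrightarrow> ?e x = 0"
      then have "AE x in lebesgue. x \<in> \<Omega> \<longrightarrow> e x = 0" by eventually_elim (auto split: split_indicator)
      then have "AE x in M. e x = 0" by (simp add: AE_M)
      then have "(\<integral>x. (e x)\<^sup>2 \<partial>M) = (\<integral>x. 0 \<partial>M)"
        using H01_seqD(4)[OF s, THEN L2_measurable]
        by (intro integral_cong_AE) auto
      then show False using e1 by simp
    qed
    fix \<eta> \<xi> assume "test_fun \<Omega> \<eta> \<and> (\<forall>x. (\<eta> has_derivative (\<lambda>h. \<xi> x \<bullet> h)) (at x))"
    then have p: "test_pair \<Omega> \<eta> \<xi>" by (simp add: test_pair_def)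
    show "(LINT x:\<Omega>|lebesgue. ?g x \<bullet> \<xi> x) = rayleigh * (LINT x:\<Omega>|lebesgue. ?e x * \<eta> x)"
      unfolding set_integral_M
      using rayleigh_minimizer_eigen[OF s e1 g1 p]
        integral_M_indicator(1)[of "\<lambda>x. ?g x \<bullet> \<xi> x" "\<lambda>x. g x \<bullet> \<xi> x"]
        integral_M_indicator(1)[of "\<lambda>x. ?e x * \<eta> x" "\<lambda>x. e x * \<eta> x"] by simp
  qed
  then show "{lam. dirichlet_eigenvalue \<Omega> lam} \<noteq> {}" by blast
  fix lam assume "lam \<in> {lam. dirichlet_eigenvalue \<Omega> lam}"
  then obtain u v where H: "H01 \<Omega> u v" and nz: "\<not> (AE x in M. u x = 0)"
    and eq: "\<And>\<phi> \<psi>. test_pair \<Omega> \<phi> \<psi> \<Longrightarrow> (\<integral>x. v x \<bullet> \<psi> x \<partial>M) = lam * (\<integral>x. u x * \<phi> x \<partial>M)"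
    unfolding dirichlet_eigenvalue_def set_integral_M AE_M by (auto simp: test_pair_def)
  obtain \<eta> \<xi> where us: "H01_seq \<eta> \<xi> u v" using H01_obtain_seq[OF H] by metis
  note D = H01_seqD[OF us]
  \<comment> \<open>The eigenvalue equation is tested with the approximants of \<open>u\<close>,
    whose limit is \<open>u\<close> itself.\<close>
  have "(\<lambda>k. \<integral>x. v x \<bullet> \<xi> k x \<partial>M) \<longlonglongrightarrow> (\<integral>x. v x \<bullet> v x \<partial>M)"
    by (rule L2_tendsto_inner[OF L2_tendsto_const[OF D(5)] D(3)])
  moreover have "(\<lambda>k. lam * (\<integral>x. u x \<bullet> \<eta> k x \<partial>M)) \<longlonglongrightarrow> lam * (\<integral>x. u x \<bullet> u x \<partial>M)"
    by (intro tendsto_mult tendsto_const L2_tendsto_inner[OF L2_tendsto_const[OF D(4)] D(2)])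
  ultimately have "(\<integral>x. v x \<bullet> v x \<partial>M) = lam * (\<integral>x. u x \<bullet> u x \<partial>M)"
    using eq[OF D(1)] LIMSEQ_unique by simp
  then have "rayleigh * (\<integral>x. (u x)\<^sup>2 \<partial>M) \<le> lam * (\<integral>x. (u x)\<^sup>2 \<partial>M)"
    using rayleigh_le_H01[OF us] by (simp add: power2_norm_eq_inner) (simp add: power2_eq_square)
  moreover have "(\<integral>x. (u x)\<^sup>2 \<partial>M) > 0"
  proof -
    have "(\<integral>x. (u x)\<^sup>2 \<partial>M) \<noteq> 0"
      using nz L2_integrable_norm[OF D(4)] by (subst integral_nonneg_eq_0_iff_AE) auto
    moreover have "(\<integral>x. (u x)\<^sup>2 \<partial>M) \<ge> 0" by simp
    ultimately show ?thesis by linarith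
  qed
  ultimately show "rayleigh \<le> lam" by simp
qed

lemma H01_seq_nonzero_test_pair:
  assumes s: "H01_seq \<phi> \<psi> u g" and nz: "(\<integral>x. (u x)\<^sup>2 \<partial>M) \<noteq> 0"
  obtains \<eta> \<xi> where "test_pair \<Omega> \<eta> \<xi>" "(\<integral>x. (\<eta> x)\<^sup>2 \<partial>M) \<noteq> 0"
proof -
  note D = H01_seqD[OF s]
  have "(\<lambda>k. \<integral>x. (\<phi> k x)\<^sup>2 \<partial>M) \<longlonglongrightarrow> (\<integral>x. (u x)\<^sup>2 \<partial>M)"
    using L2_tendsto_norm[OF D(2)] by simp
  then have "\<exists>k. (\<integral>x. (\<phi> k x)\<^sup>2 \<partial>M) \<noteq> 0" using nz by (metis (no_types, lifting) LIMSEQ_const_iff ext)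
  then show ?thesis using that D(1) by blast
qed

text \<open>Normalisation and the gradient bound are all that is kept: Picone's inequality uses the
  ground state through \<open>e^2\<close> and \<open>|v|^2\<close> only.\<close>

lemma H01_ground_state:
  assumes s: "H01_seq \<phi> \<psi> u g" and nz: "(\<integral>x. (u x)\<^sup>2 \<partial>M) \<noteq> 0"
  obtains \<eta> \<xi> e v where "H01_seq \<eta> \<xi> e v" "(\<integral>x. (e x)\<^sup>2 \<partial>M) = 1"
    "(\<integral>x. (norm (v x))\<^sup>2 \<partial>M) \<le> principal_eigenvalue \<Omega>"
proof -
  obtain \<phi>0 \<psi>0 where "test_pair \<Omega> \<phi>0 \<psi>0" "(\<integral>x. (\<phi>0 x)\<^sup>2 \<partial>M) \<noteq> 0"
    by (rule H01_seq_nonzero_test_pair[OF s nz])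
  then obtain \<eta> \<xi> e v where "H01_seq \<eta> \<xi> e v" "(\<integral>x. (e x)\<^sup>2 \<partial>M) = 1" "(\<integral>x. (norm (v x))\<^sup>2 \<partial>M) = rayleigh"
    by (rule rayleigh_minimizer)
  then show ?thesis using that rayleigh_le_principal_eigenvalue by simp
qed

end

section \<open>Testing the equation\<close>

context bounded_open begin

text \<open>Since \<open>\<phi>\<^sup>2 / u\<close> is not admissible, the equation is tested with
  \<open>\<phi>\<^sup>2 / (\<rho> + \<epsilon>)\<close>, where \<open>\<rho> = sqrt (v\<^sub>k\<^sup>2 + \<delta>\<^sub>k\<^sup>2)\<close> smooths the modulus of the test functions
  \<open>v\<^sub>k\<close> tending to \<open>u\<close>, and then \<open>k \<rightarrow> \<infinity>\<close>, \<open>\<epsilon> \<rightarrow> 0\<close>.\<close>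

lemma weak_Picone:
  assumes s: "H01_seq v w u g" and pos: "AE x in M. u x > 0" and c: "c \<in> L2 M"
    and eq: "\<And>\<phi> \<psi>. test_pair \<Omega> \<phi> \<psi> \<Longrightarrow> (\<integral>x. g x \<bullet> \<psi> x \<partial>M) = (\<integral>x. c x * (u x * \<phi> x) \<partial>M)"
    and p: "test_pair \<Omega> \<phi> \<psi>"
  shows "(\<integral>x. c x * (\<phi> x)\<^sup>2 \<partial>M) \<le> (\<integral>x. (norm (\<psi> x))\<^sup>2 \<partial>M)"
proof -
  obtain r where r: "strict_mono r" and ae: "AE x in M. (\<lambda>k. v (r k) x) \<longlonglongrightarrow> u x"
    using L2_tendsto_AE_subseq[OF H01_seqD(2)[OF s]] by metis
  define f where "f k = v (r k)" for k
  define y where "y k = w (r k)" for k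
  have s': "H01_seq f y u g" unfolding f_def y_def by (rule H01_seq_subseq[OF s r])
  note D = H01_seqD[OF s'] and P = test_pair_M[OF p]
  obtain B where B: "\<And>x. \<bar>\<phi> x\<bar> \<le> B" "0 \<le> B" using test_pair_bounded[OF p] by metis
  note [measurable] = D(4)[THEN L2_measurable] D(5)[THEN L2_measurable] P(1)[THEN L2_measurable]
    P(2)[THEN L2_measurable] c[THEN L2_measurable] test_pair_M(1)[OF D(1), THEN L2_measurable]
  define \<delta> where "\<delta> k = 1 / (real k + 1)" for k :: nat
  have \<delta>: "\<delta> k > 0" for k by (simp add: \<delta>_def)
  have \<delta>lim: "\<delta> \<longlonglongrightarrow> 0"
    using LIMSEQ_inverse_real_of_nat unfolding \<delta>_def[abs_def] by (simp add: inverse_eq_divide add.commute)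
  define \<rho> where "\<rho> k x = sqrt ((f k x)\<^sup>2 + (\<delta> k)\<^sup>2)" for k x
  have [measurable]: "\<rho> k \<in> borel_measurable M" for k unfolding \<rho>_def by measurable
  have \<rho>0: "\<rho> k x > 0" for k x using \<delta>[of k] by (simp add: \<rho>_def add_nonneg_pos)
  have \<rho>f: "\<bar>f k x / \<rho> k x\<bar> \<le> 1" for k x
  proof -
    have "\<bar>f k x\<bar> = sqrt ((f k x)\<^sup>2)" by simp
    also have "\<dots> \<le> \<rho> k x" unfolding \<rho>_def by (rule real_sqrt_le_mono) simp
    finally show ?thesis using \<rho>0[of k x] by simp
  qed
  have \<rho>lim: "(\<lambda>k. \<rho> k x) \<longlonglongrightarrow> \<bar>u x\<bar>" if "(\<lambda>k. f k x) \<longlonglongrightarrow> u x" for x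
  proof -
    have "(\<lambda>k. \<rho> k x) \<longlonglongrightarrow> sqrt ((u x)\<^sup>2 + 0\<^sup>2)"
      unfolding \<rho>_def by (intro tendsto_intros that \<delta>lim)
    then show ?thesis by simp
  qed
  have ae': "AE x in M. (\<lambda>k. f k x) \<longlonglongrightarrow> u x" using ae by (simp add: f_def)
  have step: "(\<integral>x. c x * ((u x / (\<bar>u x\<bar> + \<epsilon>)) * (\<phi> x)\<^sup>2) \<partial>M) \<le> (\<integral>x. (norm (\<psi> x))\<^sup>2 \<partial>M)" if \<epsilon>: "\<epsilon> > 0" for \<epsilon>
  proof -
    \<comment> \<open>One bound for the three coefficient families below: those of
      \<open>\<psi>\<close>, of \<open>y k\<close>, and of the test function itself.\<close>
    define C where "C = 2 * B / \<epsilon> + B\<^sup>2 / \<epsilon>\<^sup>2 + B\<^sup>2 / \<epsilon>"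
    have Cs: "2 * B / \<epsilon> \<le> C" "B\<^sup>2 / \<epsilon>\<^sup>2 \<le> C" "B\<^sup>2 / \<epsilon> \<le> C" using B \<epsilon> by (auto simp: C_def)
    have bA: "\<bar>2 * \<phi> x / (t + \<epsilon>)\<bar> \<le> C" if "t \<ge> 0" for x t
    proof -
      have "\<bar>2 * \<phi> x / (t + \<epsilon>)\<bar> = 2 * \<bar>\<phi> x\<bar> / (t + \<epsilon>)" using that \<epsilon> by (simp add: abs_mult)
      also have "\<dots> \<le> 2 * B / \<epsilon>" using B that \<epsilon> by (intro frac_le) auto
      finally show ?thesis using Cs by linarith
    qed
    have phi2: "(\<phi> x)\<^sup>2 \<le> B\<^sup>2" for x using B(1)[of x] B(2) by (simp add: abs_le_square_iff[symmetric])
    have bB0: "(\<phi> x)\<^sup>2 / (t + \<epsilon>)\<^sup>2 \<le> C" if "t \<ge> 0" for x t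
    proof -
      have "(\<phi> x)\<^sup>2 / (t + \<epsilon>)\<^sup>2 \<le> B\<^sup>2 / \<epsilon>\<^sup>2" using phi2[of x] that \<epsilon> power_mono[of \<epsilon> "t + \<epsilon>" 2] by (intro frac_le) auto
      then show ?thesis using Cs by linarith
    qed
    have bB: "\<bar>(\<phi> x)\<^sup>2 / (\<rho> k x + \<epsilon>)\<^sup>2 * (f k x / \<rho> k x)\<bar> \<le> C" for k x
    proof -
      have "\<bar>(\<phi> x)\<^sup>2 / (\<rho> k x + \<epsilon>)\<^sup>2 * (f k x / \<rho> k x)\<bar> \<le> (\<phi> x)\<^sup>2 / (\<rho> k x + \<epsilon>)\<^sup>2 * 1"
        unfolding abs_mult using \<rho>f[of k x] by (intro mult_mono) auto
      then show ?thesis using bB0[of "\<rho> k x" x] \<rho>0[of k x] by simp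
    qed
    have bW: "\<bar>(\<phi> x)\<^sup>2 / (t + \<epsilon>)\<bar> \<le> C" if "t \<ge> 0" for x t
    proof -
      have "(\<phi> x)\<^sup>2 / (t + \<epsilon>) \<le> B\<^sup>2 / \<epsilon>" using phi2 that \<epsilon> by (intro frac_le) auto
      then show ?thesis using Cs that \<epsilon> by simp
    qed
    let ?A = "\<lambda>k x. 2 * \<phi> x / (\<rho> k x + \<epsilon>)" and ?A' = "\<lambda>x. 2 * \<phi> x / (\<bar>u x\<bar> + \<epsilon>)"
    let ?B = "\<lambda>k x. (\<phi> x)\<^sup>2 / (\<rho> k x + \<epsilon>)\<^sup>2 * (f k x / \<rho> k x)" and ?B' = "\<lambda>x. (\<phi> x)\<^sup>2 / (\<bar>u x\<bar> + \<epsilon>)\<^sup>2"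
    let ?W = "\<lambda>k x. (\<phi> x)\<^sup>2 / (\<rho> k x + \<epsilon>)" and ?W' = "\<lambda>x. (\<phi> x)\<^sup>2 / (\<bar>u x\<bar> + \<epsilon>)"
    have ne: "\<bar>u x\<bar> + \<epsilon> \<noteq> 0" for x using \<epsilon> by (simp add: add_nonneg_pos less_imp_neq[symmetric])
    have TA: "L2_tendsto M (\<lambda>k x. ?A k x *\<^sub>R \<psi> x) (\<lambda>x. ?A' x *\<^sub>R \<psi> x)"
    proof (rule L2_tendsto_bounded_mult[OF L2_tendsto_const[OF P(2)], where C=C])
      show "AE x in M. (\<lambda>k. ?A k x) \<longlonglongrightarrow> ?A' x"
        using ae' by eventually_elim (intro tendsto_intros \<rho>lim ne)
    qed (use bA \<rho>0 in \<open>auto simp: less_imp_le\<close>)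
    \<comment> \<open>Positivity of \<open>u\<close> enters here: the factor
      \<open>f k / \<rho> k\<close> tends to \<open>u / |u| = 1\<close>.\<close>
    have TB: "L2_tendsto M (\<lambda>k x. ?B k x *\<^sub>R y k x) (\<lambda>x. ?B' x *\<^sub>R g x)"
    proof (rule L2_tendsto_bounded_mult[OF D(3), where C=C])
      show "AE x in M. (\<lambda>k. ?B k x) \<longlonglongrightarrow> ?B' x"
        using ae' pos
      proof eventually_elim
        case (elim x)
        have "(\<lambda>k. ?B k x) \<longlonglongrightarrow> (\<phi> x)\<^sup>2 / (\<bar>u x\<bar> + \<epsilon>)\<^sup>2 * (u x / \<bar>u x\<bar>)"
          using elim ne[of x] by (intro tendsto_intros \<rho>lim) auto
        then show ?case using elim by simp
      qed
      show "\<bar>?B' x\<bar> \<le> C" for x using bB0[of "\<bar>u x\<bar>" x] by simp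
    qed (use bB in auto)
    have TW: "L2_tendsto M (\<lambda>k x. ?W k x *\<^sub>R u x) (\<lambda>x. ?W' x *\<^sub>R u x)"
    proof (rule L2_tendsto_bounded_mult[OF L2_tendsto_const[OF D(4)], where C=C])
      show "AE x in M. (\<lambda>k. ?W k x) \<longlonglongrightarrow> ?W' x"
        using ae' by eventually_elim (intro tendsto_intros \<rho>lim ne)
    qed (use bW \<rho>0 in \<open>auto simp: less_imp_le\<close>)
    have TG: "L2_tendsto M (\<lambda>k x. ?A k x *\<^sub>R \<psi> x - ?B k x *\<^sub>R y k x) (\<lambda>x. ?A' x *\<^sub>R \<psi> x - ?B' x *\<^sub>R g x)"
    proof -
      have "L2_tendsto M (\<lambda>k x. (-1) *\<^sub>R (?B k x *\<^sub>R y k x)) (\<lambda>x. (-1) *\<^sub>R (?B' x *\<^sub>R g x))"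
        by (rule L2_tendsto_bounded_mult[OF TB, where C=1]) auto
      from L2_tendsto_add[OF TA this] show ?thesis by simp
    qed
    have "(\<integral>x. g x \<bullet> (?A k x *\<^sub>R \<psi> x - ?B k x *\<^sub>R y k x) \<partial>M) = (\<integral>x. c x * (u x * ?W k x) \<partial>M)" for k
      using eq[OF test_pair_Picone[OF p D(1)[of k] \<delta>[of k] \<epsilon>]] by (simp add: \<rho>_def)
    then have e1: "(\<integral>x. g x \<bullet> (?A k x *\<^sub>R \<psi> x - ?B k x *\<^sub>R y k x) \<partial>M) = (\<integral>x. c x \<bullet> (?W k x *\<^sub>R u x) \<partial>M)" for k
      by (simp add: mult.commute)
    have "(\<integral>x. c x \<bullet> (?W' x *\<^sub>R u x) \<partial>M) = (\<integral>x. g x \<bullet> (?A' x *\<^sub>R \<psi> x - ?B' x *\<^sub>R g x) \<partial>M)"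
      using L2_tendsto_inner[OF L2_tendsto_const[OF c] TW]
        L2_tendsto_inner[OF L2_tendsto_const[OF D(5)] TG] e1 by (auto intro: LIMSEQ_unique)
    also have "\<dots> \<le> (\<integral>x. (norm (\<psi> x))\<^sup>2 \<partial>M)"
    proof (rule integral_mono)
      show "integrable M (\<lambda>x. g x \<bullet> (?A' x *\<^sub>R \<psi> x - ?B' x *\<^sub>R g x))"
        by (rule L2_integrable_inner[OF D(5) L2_tendstoD(2)[OF TG]])
      show "integrable M (\<lambda>x. (norm (\<psi> x))\<^sup>2)" by (rule L2_integrable_norm[OF P(2)])
      fix x
      \<comment> \<open>The pointwise Picone inequality: expanding
        \<open>|\<psi> - t g|^2 \<ge> 0\<close> for this \<open>t\<close> is exactly the bound on
        the integrand.\<close>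
      define t where "t = \<phi> x / (\<bar>u x\<bar> + \<epsilon>)"
      have "0 \<le> (norm (\<psi> x - t *\<^sub>R g x))\<^sup>2" by simp
      also have "\<dots> = (norm (\<psi> x))\<^sup>2 - 2 * t * (g x \<bullet> \<psi> x) + t\<^sup>2 * (g x \<bullet> g x)"
        by (simp add: power2_norm_eq_inner algebra_simps inner_commute) (simp add: power2_eq_square)
      finally show "g x \<bullet> (?A' x *\<^sub>R \<psi> x - ?B' x *\<^sub>R g x) \<le> (norm (\<psi> x))\<^sup>2"
        by (simp add: t_def inner_diff_right power_divide)
    qed
    finally show ?thesis by (simp add: mult_ac)
  qed
  \<comment> \<open>The sequence \<open>\<delta>\<close> is reused as values of
    \<open>\<epsilon>\<close>; the leftover factor is bounded by 1 and tends to 1 where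
    \<open>u > 0\<close>.\<close>
  let ?b = "\<lambda>m x. u x / (\<bar>u x\<bar> + \<delta> m)"
  have "L2_tendsto M (\<lambda>m x. ?b m x *\<^sub>R (\<phi> x)\<^sup>2) (\<lambda>x. 1 *\<^sub>R (\<phi> x)\<^sup>2)"
  proof (rule L2_tendsto_bounded_mult[OF L2_tendsto_const[OF P(3)], where C=1])
    show "AE x in M. (\<lambda>m. ?b m x) \<longlonglongrightarrow> 1"
      using pos
    proof eventually_elim
      case (elim x)
      have "(\<lambda>m. ?b m x) \<longlonglongrightarrow> u x / (\<bar>u x\<bar> + 0)"
        using elim by (intro tendsto_intros \<delta>lim) auto
      then show ?case using elim by simp
    qed
    show "\<bar>?b m x\<bar> \<le> 1" for m x using \<delta>[of m] by (simp add: abs_divide divide_le_eq_1 add_nonneg_pos)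
  qed auto
  from L2_tendsto_inner[OF L2_tendsto_const[OF c] this]
  have "(\<lambda>m. \<integral>x. c x * (?b m x * (\<phi> x)\<^sup>2) \<partial>M) \<longlonglongrightarrow> (\<integral>x. c x * (\<phi> x)\<^sup>2 \<partial>M)" by simp
  then show ?thesis
    by (rule LIMSEQ_le_const2) (use step[OF \<delta>] in blast)
qed

text \<open>Uses \<open>\<phi>_k^2 = (\<phi>_k - e)^2 + 2 e \<phi>_k - e^2\<close>, where the first
  term tends to 0 and the second to \<open>2 e^2\<close>.\<close>

lemma H01_seq_sq_tendsto:
  assumes s: "H01_seq \<phi> \<psi> e g" and card: "CARD('n) \<le> 3"
  shows "L2_tendsto M (\<lambda>k x. (\<phi> k x)\<^sup>2) (\<lambda>x. (e x)\<^sup>2)"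
proof -
  note D = H01_seqD[OF s] and F = H01_seq_fourth_power[OF s card]
  have "L2_tendsto M (\<lambda>k x. e x * \<phi> k x) (\<lambda>x. e x * e x)"
    by (rule H01_seq_mult_tendsto[OF s card L2_measurable[OF D(4)] F(1)])
  then have "L2_tendsto M (\<lambda>k x. 2 *\<^sub>R (e x * \<phi> k x)) (\<lambda>x. 2 *\<^sub>R (e x * e x))"
    by (rule L2_tendsto_bounded_mult[where C=2]) auto
  from L2_tendsto_add[OF L2_tendsto_add[OF F(2) this] L2_tendsto_const[OF L2_scaleR[OF F(1), of "-1"]]]
  show ?thesis by (simp add: power2_eq_square algebra_simps)
qed

text \<open>Since \<open>c\<close> is only square integrable, the left side passes to the limit
  because the squares \<open>\<phi>_k^2\<close> converge in \<open>L2\<close>.\<close>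

lemma weak_Picone_H01:
  assumes s: "H01_seq v w u g" and pos: "AE x in M. u x > 0" and c: "c \<in> L2 M"
    and eq: "\<And>\<phi> \<psi>. test_pair \<Omega> \<phi> \<psi> \<Longrightarrow> (\<integral>x. g x \<bullet> \<psi> x \<partial>M) = (\<integral>x. c x * (u x * \<phi> x) \<partial>M)"
    and t: "H01_seq \<phi> \<psi> e d" and card: "CARD('n) \<le> 3"
  shows "(\<integral>x. c x * (e x)\<^sup>2 \<partial>M) \<le> (\<integral>x. (norm (d x))\<^sup>2 \<partial>M)"
proof (rule LIMSEQ_le)
  note D = H01_seqD[OF t]
  show "(\<lambda>k. \<integral>x. c x * (\<phi> k x)\<^sup>2 \<partial>M) \<longlonglongrightarrow> (\<integral>x. c x * (e x)\<^sup>2 \<partial>M)"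
    using L2_tendsto_inner[OF L2_tendsto_const[OF c] H01_seq_sq_tendsto[OF t card]] by simp
  show "(\<lambda>k. \<integral>x. (norm (\<psi> k x))\<^sup>2 \<partial>M) \<longlonglongrightarrow> (\<integral>x. (norm (d x))\<^sup>2 \<partial>M)"
    by (rule L2_tendsto_norm[OF D(3)])
  show "\<exists>N. \<forall>k\<ge>N. (\<integral>x. c x * (\<phi> k x)\<^sup>2 \<partial>M) \<le> (\<integral>x. (norm (\<psi> k x))\<^sup>2 \<partial>M)"
    using weak_Picone[OF s pos c eq D(1)] by blast
qed

text \<open>Extends the admissible tests to \<open>H_0^1\<close> by density:
  \<open>u \<phi>_k\<close> converges to \<open>u e\<close> in \<open>L2\<close>, against which
  \<open>c\<close> can be integrated.\<close>

lemma weak_cross_test: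
  assumes s: "H01_seq v w u g" and c: "c \<in> L2 M"
    and eq: "\<And>\<phi> \<psi>. test_pair \<Omega> \<phi> \<psi> \<Longrightarrow> (\<integral>x. g x \<bullet> \<psi> x \<partial>M) = (\<integral>x. c x * (u x * \<phi> x) \<partial>M)"
    and t: "H01_seq \<phi> \<psi> e d" and card: "CARD('n) \<le> 3"
  shows "(\<integral>x. g x \<bullet> d x \<partial>M) = (\<integral>x. c x * (u x * e x) \<partial>M)"
proof -
  note S = H01_seqD[OF s] and D = H01_seqD[OF t]
  have "(\<lambda>k. \<integral>x. g x \<bullet> \<psi> k x \<partial>M) \<longlonglongrightarrow> (\<integral>x. g x \<bullet> d x \<partial>M)"
    by (rule L2_tendsto_inner[OF L2_tendsto_const[OF S(5)] D(3)])
  moreover have "(\<lambda>k. \<integral>x. c x \<bullet> (u x * \<phi> k x) \<partial>M) \<longlonglongrightarrow> (\<integral>x. c x \<bullet> (u x * e x) \<partial>M)"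
    by (rule L2_tendsto_inner[OF L2_tendsto_const[OF c]
          H01_seq_mult_tendsto[OF t card L2_measurable[OF S(4)] H01_seq_fourth_power(1)[OF s card]]])
  ultimately show ?thesis using eq[OF D(1)] by (auto intro: LIMSEQ_unique)
qed

end

section \<open>Positive solutions\<close>

lemma L2_sum:
  assumes "finite I" "\<And>i. i \<in> I \<Longrightarrow> f i \<in> L2 M"
  shows "(\<lambda>x. \<Sum>i\<in>I. f i x) \<in> L2 M"
  using assms
proof (induction I rule: finite_induct)
  case empty
  show ?case by (rule L2_I) auto
next
  case (insert i I)
  then show ?case by (auto intro!: L2_add)
qed

context bounded_open begin

text \<open>Contradictions will be reached almost everywhere in \<open>\<Omega>\<close>; they count
  because a nonempty open set is not negligible.\<close>

lemma not_AE_False: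
  assumes "\<Omega> \<noteq> {}" shows "\<not> (AE x in M. False)"
proof
  assume "AE x in M. False"
  then have "AE x in lebesgue. x \<notin> \<Omega>" unfolding AE_M[symmetric] by simp
  then have "negligible \<Omega>" by (simp add: negligible_iff_null_sets AE_iff_null_sets)
  then show False using open_not_negligible[OF open_Omega assms] by blast
qed

end

locale solution = bounded_open \<Omega> for \<Omega> :: "(real^'n) set" +
  fixes n :: nat and a \<mu> :: "nat \<Rightarrow> real" and \<beta> :: real and u :: "nat \<Rightarrow> real^'n \<Rightarrow> real"
  assumes card: "CARD('n) \<le> 3" and nonempty: "\<Omega> \<noteq> {}"
    and sol: "positive_solution \<Omega> n a \<mu> \<beta> u"
begin

text \<open>The sum runs over all components, the surplus \<open>k = j\<close> being absorbed in
  \<open>\<mu> j - \<beta>\<close>. Its \<open>\<beta>\<close> part is thus common to all equations: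
  it cancels in differences and becomes the same total in every integrated inequality.\<close>

definition c :: "nat \<Rightarrow> real^'n \<Rightarrow> real" where
  "c j x = (\<mu> j - \<beta>) * (u j x)\<^sup>2 + \<beta> * (\<Sum>k=1..n. (u k x)\<^sup>2) - a j"

lemma solution_weak_form:
  obtains g v w where "\<And>j. j \<in> {1..n} \<Longrightarrow> H01_seq (v j) (w j) (u j) (g j)"
    "\<And>j. j \<in> {1..n} \<Longrightarrow> AE x in M. u j x > 0"
    "\<And>j. j \<in> {1..n} \<Longrightarrow> c j \<in> L2 M"
    "\<And>j \<phi> \<psi>. j \<in> {1..n} \<Longrightarrow> test_pair \<Omega> \<phi> \<psi> \<Longrightarrow> (\<integral>x. g j x \<bullet> \<psi> x \<partial>M) = (\<integral>x. c j x * (u j x * \<phi> x) \<partial>M)"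
proof -
  obtain g where g: "\<And>j. j \<in> {1..n} \<Longrightarrow> H01 \<Omega> (u j) (g j)"
    "\<And>j. j \<in> {1..n} \<Longrightarrow> AE x in M. u j x > 0"
    "\<And>j \<phi> \<psi>. j \<in> {1..n} \<Longrightarrow> test_pair \<Omega> \<phi> \<psi> \<Longrightarrow> (\<integral>x. g j x \<bullet> \<psi> x + a j * u j x * \<phi> x \<partial>M)
      = (\<integral>x. (\<mu> j * (u j x)^3 + \<beta> * (\<Sum>k\<in>{1..n}-{j}. (u k x)\<^sup>2) * u j x) * \<phi> x \<partial>M)"
    using sol unfolding positive_solution_def AE_M set_integral_M test_pair_def by blast
  have "\<exists>v w. j \<in> {1..n} \<longrightarrow> H01_seq v w (u j) (g j)" for j
    using g(1) H01_obtain_seq by metis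
  then obtain v w where s: "\<And>j. j \<in> {1..n} \<Longrightarrow> H01_seq (v j) (w j) (u j) (g j)" by metis
  have uL: "u j \<in> L2 M" and u2: "(\<lambda>x. (u j x)\<^sup>2) \<in> L2 M" if "j \<in> {1..n}" for j
    using H01_seqD(4)[OF s[OF that]] H01_seq_fourth_power(1)[OF s[OF that] card] by auto
  have S: "(\<lambda>x. \<Sum>k=1..n. (u k x)\<^sup>2) \<in> L2 M" by (rule L2_sum) (use u2 in auto)
  have one: "(\<lambda>x. 1 :: real) \<in> L2 M"
    by (rule L2_I) (use finite_measure.integrable_const[OF finite_M] in auto)
  have cL: "c j \<in> L2 M" if j: "j \<in> {1..n}" for j
  proof -
    have "(\<lambda>x. ((\<mu> j - \<beta>) *\<^sub>R (u j x)\<^sup>2 + \<beta> *\<^sub>R (\<Sum>k=1..n. (u k x)\<^sup>2)) - a j *\<^sub>R 1) \<in> L2 M"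
      by (intro L2_diff L2_add L2_scaleR u2[OF j] S one)
    then show ?thesis by (simp add: c_def[abs_def])
  qed
  have eq: "(\<integral>x. g j x \<bullet> \<psi> x \<partial>M) = (\<integral>x. c j x * (u j x * \<phi> x) \<partial>M)"
    if j: "j \<in> {1..n}" and p: "test_pair \<Omega> \<phi> \<psi>" for j \<phi> \<psi>
  proof -
    note P = test_pair_M[OF p]
    obtain B where B: "\<And>x. \<bar>\<phi> x\<bar> \<le> B" using test_pair_bounded[OF p] by metis
    have uphi: "(\<lambda>x. u j x * \<phi> x) \<in> L2 M"
      using L2_bounded_mult[OF uL[OF j] L2_measurable[OF P(1)] B] by (simp add: mult.commute)
    \<comment> \<open>Separate integrability of the pieces is what allows the term with
      \<open>a j\<close> to be cancelled on both sides.\<close>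
    have i1: "integrable M (\<lambda>x. g j x \<bullet> \<psi> x)"
      by (rule L2_integrable_inner[OF H01_seqD(5)[OF s[OF j]] P(2)])
    have i2: "integrable M (\<lambda>x. u j x * \<phi> x)"
      using L2_integrable_inner[OF uL[OF j] P(1)] by simp
    have i3: "integrable M (\<lambda>x. c j x * (u j x * \<phi> x))"
      using L2_integrable_inner[OF cL[OF j] uphi] by simp
    have "(\<Sum>k=1..n. (u k x)\<^sup>2) = (u j x)\<^sup>2 + (\<Sum>k\<in>{1..n}-{j}. (u k x)\<^sup>2)" for x
      using j by (simp add: sum.remove)
    then have "(\<mu> j * (u j x)^3 + \<beta> * (\<Sum>k\<in>{1..n}-{j}. (u k x)\<^sup>2) * u j x) * \<phi> x
      = c j x * (u j x * \<phi> x) + a j * (u j x * \<phi> x)" for x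
      by (simp add: c_def algebra_simps power2_eq_square power3_eq_cube)
    then have "(\<integral>x. g j x \<bullet> \<psi> x + a j * (u j x * \<phi> x) \<partial>M)
      = (\<integral>x. c j x * (u j x * \<phi> x) + a j * (u j x * \<phi> x) \<partial>M)"
      using g(3)[OF j p] by (simp add: mult.assoc)
    then show ?thesis using i1 i2 i3 by simp
  qed
  show ?thesis
    by (rule that[where g=g and v=v and w=w]) (fact s g(2) cL eq)+
qed

lemma cross_inequality:
  assumes ij: "i \<in> {1..n}" "j \<in> {1..n}" and le: "a j \<le> a i" "\<mu> i \<le> \<beta>" "\<beta> \<le> \<mu> j"
    and strict: "a j < a i \<or> \<mu> i < \<beta> \<or> \<beta> < \<mu> j"
  shows False
proof -
  obtain g v w where s: "\<And>j. j \<in> {1..n} \<Longrightarrow> H01_seq (v j) (w j) (u j) (g j)"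
    and pos: "\<And>j. j \<in> {1..n} \<Longrightarrow> AE x in M. u j x > 0"
    and cL: "\<And>j. j \<in> {1..n} \<Longrightarrow> c j \<in> L2 M"
    and eq: "\<And>j \<phi> \<psi>. j \<in> {1..n} \<Longrightarrow> test_pair \<Omega> \<phi> \<psi> \<Longrightarrow> (\<integral>x. g j x \<bullet> \<psi> x \<partial>M) = (\<integral>x. c j x * (u j x * \<phi> x) \<partial>M)"
    by (rule solution_weak_form) blast
  have uu: "(\<lambda>x. u i x * u j x) \<in> L2 M"
    by (intro L4_mult_L2 H01_seq_fourth_power(1)[OF s card] L2_measurable[OF H01_seqD(4)[OF s]] ij)
  have I: "(\<integral>x. g i x \<bullet> g j x \<partial>M) = (\<integral>x. c i x * (u i x * u j x) \<partial>M)"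
    by (rule weak_cross_test[OF s[OF ij(1)] cL[OF ij(1)] eq[OF ij(1)] s[OF ij(2)] card])
  have J: "(\<integral>x. g j x \<bullet> g i x \<partial>M) = (\<integral>x. c j x * (u j x * u i x) \<partial>M)"
    by (rule weak_cross_test[OF s[OF ij(2)] cL[OF ij(2)] eq[OF ij(2)] s[OF ij(1)] card])
  have i: "integrable M (\<lambda>x. c i x * (u i x * u j x))" "integrable M (\<lambda>x. c j x * (u i x * u j x))"
    using L2_integrable_inner[OF cL[OF ij(1)] uu] L2_integrable_inner[OF cL[OF ij(2)] uu] by auto
  let ?f = "\<lambda>x. (c j x - c i x) * (u i x * u j x)"
  have f0: "(\<integral>x. ?f x \<partial>M) = 0"
    using I J i by (simp add: left_diff_distrib inner_commute mult.commute[of "u j _" "u i _"])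
  have fi: "integrable M ?f" using i by (simp add: left_diff_distrib)
  have fpos: "AE x in M. ?f x > 0"
    using pos[OF ij(1)] pos[OF ij(2)]
  proof eventually_elim
    case (elim x)
    \<comment> \<open>The common sum has cancelled. All three terms are nonnegative, and the strict
      hypothesis makes one of them positive because \<open>u i\<close> and \<open>u j\<close>
      are.\<close>
    have "c j x - c i x = (\<mu> j - \<beta>) * (u j x)\<^sup>2 + (\<beta> - \<mu> i) * (u i x)\<^sup>2 + (a i - a j)"
      by (simp add: c_def algebra_simps)
    also have "\<dots> > 0"
    proof -
      have t: "0 \<le> (\<mu> j - \<beta>) * (u j x)\<^sup>2" "0 \<le> (\<beta> - \<mu> i) * (u i x)\<^sup>2" "0 \<le> a i - a j" using le by auto
      have "0 < (\<mu> j - \<beta>) * (u j x)\<^sup>2 \<or> 0 < (\<beta> - \<mu> i) * (u i x)\<^sup>2 \<or> 0 < a i - a j"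
        using strict elim by auto
      then show ?thesis using t by linarith
    qed
    finally show ?case using elim by simp
  qed
  have "AE x in M. 0 \<le> ?f x" using fpos by eventually_elim simp
  from iffD1[OF integral_nonneg_eq_0_iff_AE[OF fi this] f0] have "AE x in M. ?f x = 0" .
  then have "AE x in M. False" using fpos by eventually_elim auto
  then show False using not_AE_False[OF nonempty] by blast
qed

lemma ground_state_inequality:
  assumes n: "n \<ge> 1"
  obtains U :: "nat \<Rightarrow> real" where "\<And>j. j \<in> {1..n} \<Longrightarrow> U j > 0"
    "\<And>j. j \<in> {1..n} \<Longrightarrow> (\<mu> j - \<beta>) * U j + \<beta> * (\<Sum>k=1..n. U k) \<le> principal_eigenvalue \<Omega> + a j"
proof -
  obtain g v w where s: "\<And>j. j \<in> {1..n} \<Longrightarrow> H01_seq (v j) (w j) (u j) (g j)"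
    and pos: "\<And>j. j \<in> {1..n} \<Longrightarrow> AE x in M. u j x > 0"
    and cL: "\<And>j. j \<in> {1..n} \<Longrightarrow> c j \<in> L2 M"
    and eq: "\<And>j \<phi> \<psi>. j \<in> {1..n} \<Longrightarrow> test_pair \<Omega> \<phi> \<psi> \<Longrightarrow> (\<integral>x. g j x \<bullet> \<psi> x \<partial>M) = (\<integral>x. c j x * (u j x * \<phi> x) \<partial>M)"
    by (rule solution_weak_form) blast
  have one: "1 \<in> {1..n}" using n by simp
  have "(\<integral>x. (u 1 x)\<^sup>2 \<partial>M) \<noteq> 0"
  proof
    assume "(\<integral>x. (u 1 x)\<^sup>2 \<partial>M) = 0"
    then have "AE x in M. (u 1 x)\<^sup>2 = 0"
      using L2_integrable_norm[OF H01_seqD(4)[OF s[OF one]]]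
      by (subst (asm) integral_nonneg_eq_0_iff_AE) auto
    with pos[OF one] have "AE x in M. False" by eventually_elim simp
    then show False using not_AE_False[OF nonempty] by blast
  qed
  then obtain \<eta> \<xi> e d where t: "H01_seq \<eta> \<xi> e d" and e1: "(\<integral>x. (e x)\<^sup>2 \<partial>M) = 1"
    and d1: "(\<integral>x. (norm (d x))\<^sup>2 \<partial>M) \<le> principal_eigenvalue \<Omega>"
    by (rule H01_ground_state[OF s[OF one]])
  note T = H01_seqD[OF t] and e2 = H01_seq_fourth_power(1)[OF t card]
  have ei: "integrable M (\<lambda>x. (e x)\<^sup>2)" using L2_integrable_norm[OF T(4)] by simp
  define U where "U j = (\<integral>x. (u j x)\<^sup>2 * (e x)\<^sup>2 \<partial>M)" for j
  have Ui: "integrable M (\<lambda>x. (u j x)\<^sup>2 * (e x)\<^sup>2)" if "j \<in> {1..n}" for j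
    using L2_integrable_inner[OF H01_seq_fourth_power(1)[OF s[OF that] card] e2] by simp
  have Upos: "U j > 0" if j: "j \<in> {1..n}" for j
  proof -
    \<comment> \<open>As \<open>u j > 0\<close> almost everywhere, \<open>U j = 0\<close> would
      force \<open>e\<close> to vanish, against its normalisation.\<close>
    have "U j \<noteq> 0"
    proof
      assume "U j = 0"
      then have "AE x in M. (u j x)\<^sup>2 * (e x)\<^sup>2 = 0"
        unfolding U_def using Ui[OF j] by (subst (asm) integral_nonneg_eq_0_iff_AE) auto
      with pos[OF j] have "AE x in M. (e x)\<^sup>2 = 0" by eventually_elim simp
      then have "(\<integral>x. (e x)\<^sup>2 \<partial>M) = 0" by (rule integral_eq_zero_AE)
      then show False using e1 by simp
    qed
    moreover have "U j \<ge> 0" by (simp add: U_def)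
    ultimately show ?thesis by linarith
  qed
  have Si: "integrable M (\<lambda>x. \<Sum>k=1..n. (u k x)\<^sup>2 * (e x)\<^sup>2)"
    by (intro Bochner_Integration.integrable_sum Ui)
  have Sint: "(\<integral>x. (\<Sum>k=1..n. (u k x)\<^sup>2 * (e x)\<^sup>2) \<partial>M) = (\<Sum>k=1..n. U k)"
    unfolding U_def by (intro Bochner_Integration.integral_sum Ui)
  have ineq: "(\<mu> j - \<beta>) * U j + \<beta> * (\<Sum>k=1..n. U k) \<le> principal_eigenvalue \<Omega> + a j" if j: "j \<in> {1..n}" for j
  proof -
    have P: "(\<integral>x. c j x * (e x)\<^sup>2 \<partial>M) \<le> (\<integral>x. (norm (d x))\<^sup>2 \<partial>M)"
      by (rule weak_Picone_H01[OF s[OF j] pos[OF j] cL[OF j] eq[OF j] t card])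
    have "(\<integral>x. c j x * (e x)\<^sup>2 \<partial>M)
      = (\<integral>x. (\<mu> j - \<beta>) * ((u j x)\<^sup>2 * (e x)\<^sup>2) + \<beta> * (\<Sum>k=1..n. (u k x)\<^sup>2 * (e x)\<^sup>2) - a j * (e x)\<^sup>2 \<partial>M)"
      by (simp add: c_def algebra_simps sum_distrib_left sum_distrib_right)
    also have "\<dots> = (\<mu> j - \<beta>) * U j + \<beta> * (\<Sum>k=1..n. U k) - a j"
      using Ui[OF j] Si Sint ei e1 by (simp add: U_def)
    finally show ?thesis using d1 P by linarith
  qed
  show ?thesis by (rule that[OF Upos ineq])
qed

end

section \<open>The function g and the linear inequalities for the weighted masses\<close>

lemma gfun_summand:
  assumes "b < m" shows "b * (1 / (m - b)) = m / (m - b) - (1::real)"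
  using assms by (simp add: field_simps)

text \<open>In the form \<open>m / (m - b) - 1\<close> each summand visibly increases with
  \<open>b\<close>, as \<open>m > 0\<close>. This yields uniqueness of the negative root and
  positivity of g to its right.\<close>

lemma gfun_strict_mono:
  assumes foc: "focusing n \<mu>" and n: "n \<ge> 1" and bc: "b < c" "c \<le> 0"
  shows "gfun n \<mu> b < gfun n \<mu> c"
proof -
  have "b * (1 / (\<mu> j - b)) < c * (1 / (\<mu> j - c))" if "j \<in> {1..n}" for j
  proof -
    have m: "0 < \<mu> j" using foc that by (auto simp: focusing_def)
    then have "\<mu> j / (\<mu> j - b) < \<mu> j / (\<mu> j - c)" using bc by (intro divide_strict_left_mono mult_pos_pos) auto
    then show ?thesis using m bc by (simp only: gfun_summand)
  qed
  then have "(\<Sum>j=1..n. b * (1 / (\<mu> j - b))) < (\<Sum>j=1..n. c * (1 / (\<mu> j - c)))"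
    using n by (intro sum_strict_mono) auto
  then show ?thesis by (simp add: gfun_def sum_distrib_left)
qed

text \<open>The intermediate value theorem between \<open>-m\<close> and 0, where g equals 1,
  together with strict monotonicity for uniqueness.\<close>

lemma beta_bar_root:
  assumes foc: "focusing n \<mu>" and n: "n \<ge> 2"
  shows "beta_bar n \<mu> < 0" "gfun n \<mu> (beta_bar n \<mu>) = 0"
proof -
  \<comment> \<open>At \<open>-m\<close> each denominator is at most \<open>2 m\<close>, so g is at
    most \<open>1 - n/2\<close>, which is nonpositive for \<open>n \<ge> 2\<close>.\<close>
  define m where "m = Max (\<mu> ` {1..n})"
  have ne: "{1..n} \<noteq> {}" using n by simp
  have pos: "0 < \<mu> j" "\<mu> j \<le> m" if "j \<in> {1..n}" for j
    using foc that by (auto simp: focusing_def m_def)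
  have m: "m > 0" using pos[of 1] n by auto
  have "continuous_on {-m..0} (gfun n \<mu>)"
    unfolding gfun_def using pos(1) by (intro continuous_intros) force+
  moreover have "gfun n \<mu> (-m) \<le> 0"
  proof -
    have "(\<Sum>j=1..n. 1 / (2 * m)) \<le> (\<Sum>j=1..n. 1 / (\<mu> j - (-m)))"
      using pos m by (intro sum_mono divide_left_mono) (auto intro!: mult_pos_pos add_pos_pos)
    then have "m * (real n / (2 * m)) \<le> m * (\<Sum>j=1..n. 1 / (\<mu> j - (-m)))"
      using m by (intro mult_left_mono) auto
    moreover have "m * (real n / (2 * m)) = real n / 2" using m by simp
    ultimately show ?thesis using n by (simp add: gfun_def)
  qed
  moreover have g0: "gfun n \<mu> 0 = 1" by (simp add: gfun_def)
  ultimately obtain b where b: "-m \<le> b" "b \<le> 0" "gfun n \<mu> b = 0"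
    using IVT'[of "gfun n \<mu>" "-m" 0 0] m by auto
  then have b0: "b < 0" using g0 by (cases "b = 0") auto
  have "beta_bar n \<mu> = b"
    unfolding beta_bar_def
  proof (rule the_equality)
    fix b' assume b': "b' < 0 \<and> gfun n \<mu> b' = 0"
    show "b' = b"
    proof (rule ccontr)
      assume "b' \<noteq> b"
      then consider "b' < b" | "b < b'" by linarith
      then show False
        using gfun_strict_mono[OF foc, of b' b] gfun_strict_mono[OF foc, of b b'] b' b0 b n by cases auto
    qed
  qed (use b b0 in auto)
  then show "beta_bar n \<mu> < 0" "gfun n \<mu> (beta_bar n \<mu>) = 0" using b b0 by auto
qed

text \<open>\<open>d j\<close> stands for \<open>\<Lambda>_1 + a_j\<close>. Right of the root
  \<open>g(\<beta>)\<close> is positive, while the summed right sides are at most 0; at the root the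
  left side is 0, and the strict hypothesis makes some \<open>d i\<close> negative.\<close>

lemma focusing_contradiction:
  fixes U :: "nat \<Rightarrow> real"
  assumes foc: "focusing n \<mu>" and n: "n \<ge> 2" and neg: "\<beta> < 0" and ge: "\<beta> \<ge> beta_bar n \<mu>"
    and U: "\<And>j. j \<in> {1..n} \<Longrightarrow> U j > 0"
    and le: "\<And>j. j \<in> {1..n} \<Longrightarrow> (\<mu> j - \<beta>) * U j + \<beta> * (\<Sum>k=1..n. U k) \<le> d j"
    and d: "\<And>j. j \<in> {1..n} \<Longrightarrow> d j \<le> 0"
    and strict: "(\<exists>j\<in>{1..n}. d j < 0) \<or> \<beta> > beta_bar n \<mu>"
  shows False
proof -
  define T where "T = (\<Sum>k=1..n. U k)"
  have T: "T > 0" unfolding T_def using n U by (intro sum_pos) auto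
  have p: "0 < \<mu> j - \<beta>" if "j \<in> {1..n}" for j using foc that neg by (force simp: focusing_def)
  have each: "U j + \<beta> * (1 / (\<mu> j - \<beta>)) * T \<le> d j / (\<mu> j - \<beta>)" if j: "j \<in> {1..n}" for j
  proof -
    have "((\<mu> j - \<beta>) * U j + \<beta> * T) / (\<mu> j - \<beta>) \<le> d j / (\<mu> j - \<beta>)"
      using le[OF j] p[OF j] by (intro divide_right_mono) (auto simp: T_def)
    then show ?thesis using p[OF j] by (simp add: add_divide_distrib)
  qed
  have total: "(\<Sum>j=1..n. U j + \<beta> * (1 / (\<mu> j - \<beta>)) * T) = T * gfun n \<mu> \<beta>"
    unfolding sum.distrib sum_distrib_right[symmetric] T_def[symmetric] sum_distrib_left[symmetric] gfun_def
    by (simp add: algebra_simps)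
  have sum: "T * gfun n \<mu> \<beta> \<le> (\<Sum>j=1..n. d j / (\<mu> j - \<beta>))"
    unfolding total[symmetric] by (intro sum_mono each)
  have nonpos: "d j / (\<mu> j - \<beta>) \<le> 0" if "j \<in> {1..n}" for j
    using d[OF that] p[OF that] by (simp add: divide_nonpos_pos)
  note root = beta_bar_root[OF foc n]
  show False
  proof (cases "\<beta> > beta_bar n \<mu>")
    case True
    then have "gfun n \<mu> \<beta> > 0"
      using gfun_strict_mono[OF foc _ True] n neg root by simp
    then have "T * gfun n \<mu> \<beta> > 0" using T by simp
    moreover have "(\<Sum>j=1..n. d j / (\<mu> j - \<beta>)) \<le> 0" using nonpos by (intro sum_nonpos) auto
    ultimately show False using sum by linarith
  next
    case False
    then have "gfun n \<mu> \<beta> = 0" using ge root by simp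
    obtain i where i: "i \<in> {1..n}" "d i < 0" using strict False by auto
    have "(\<Sum>j=1..n. d j / (\<mu> j - \<beta>)) < (\<Sum>j=1..n. 0)"
      using nonpos i p[OF i(1)] by (intro sum_strict_mono_ex1) (auto simp: divide_neg_pos intro!: bexI[of _ i])
    then show False using sum \<open>gfun n \<mu> \<beta> = 0\<close> by simp
  qed
qed

text \<open>Separating \<open>U j\<close> from the rest \<open>R\<close> turns the left side into
  \<open>\<mu> j * U j + \<beta> * R\<close>. As \<open>n \<ge> 2\<close>, also
  \<open>R > 0\<close>, so a positive \<open>\<beta>\<close> suffices even when
  \<open>\<mu> j = 0\<close>, a borderline met in the mixed case.\<close>

lemma nonneg_coupling_contradiction:
  fixes U :: "nat \<Rightarrow> real"
  assumes U: "\<And>j. j \<in> {1..n} \<Longrightarrow> U j > 0" and j: "j \<in> {1..n}" and n: "n \<ge> 2"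
    and le: "(\<mu> j - \<beta>) * U j + \<beta> * (\<Sum>k=1..n. U k) \<le> 0"
    and pos: "\<mu> j \<ge> 0" "\<beta> \<ge> 0" "\<mu> j > 0 \<or> \<beta> > 0"
  shows False
proof -
  define R where "R = (\<Sum>k\<in>{1..n}-{j}. U k)"
  have "(if j = 1 then 2 else 1) \<in> {1..n} - {j}" using n by auto
  then have "{1..n} - {j} \<noteq> {}" by blast
  then have R: "R > 0" unfolding R_def using U by (intro sum_pos) auto
  have "(\<Sum>k=1..n. U k) = U j + R" using j by (simp add: sum.remove R_def)
  then have "\<mu> j * U j + \<beta> * R \<le> 0" using le by (simp add: algebra_simps)
  moreover have "0 \<le> \<mu> j * U j" "0 \<le> \<beta> * R" using pos U[OF j] R by auto
  moreover have "0 < \<mu> j * U j \<or> 0 < \<beta> * R" using pos(3) U[OF j] R by auto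
  ultimately show False by linarith
qed

section \<open>The four nonexistence cases\<close>

theorem theorem1p4:
  fixes \<Omega> :: "(real^'N) set" and n :: nat and a \<mu> :: "nat \<Rightarrow> real" and \<beta> :: real
  assumes "CARD('N) \<le> 3"
    and "smooth_bounded_domain \<Omega>"
    and "n \<ge> 2"
    and "\<forall>i j. 1 \<le> i \<longrightarrow> i \<le> j \<longrightarrow> j \<le> n \<longrightarrow> \<mu> i \<le> \<mu> j"
    and "((\<exists>j\<in>{1..n}. a j \<le> - principal_eigenvalue \<Omega> \<and> \<mu> j > 0) \<and> \<beta> \<ge> 0)
      \<or> (\<exists>i j. 1 \<le> i \<and> i < j \<and> j \<le> n \<and> a j \<le> a i \<and> \<mu> i \<le> \<beta> \<and> \<beta> \<le> \<mu> j
              \<and> (a j < a i \<or> \<mu> i < \<beta> \<or> \<beta> < \<mu> j))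
      \<or> (focusing n \<mu> \<and> (\<forall>j\<in>{1..n}. a j \<le> - principal_eigenvalue \<Omega>) \<and> \<beta> \<ge> beta_bar n \<mu>
              \<and> ((\<exists>j\<in>{1..n}. a j < - principal_eigenvalue \<Omega>) \<or> \<beta> > beta_bar n \<mu>))
      \<or> (mixed n \<mu> \<and> a n \<le> a 1 \<and> a 1 \<le> - principal_eigenvalue \<Omega> \<and> \<beta> \<ge> \<mu> 1
              \<and> (a n < a 1 \<or> a 1 < - principal_eigenvalue \<Omega> \<or> \<beta> > \<mu> 1))"
  shows "\<not> (\<exists>u. positive_solution \<Omega> n a \<mu> \<beta> u)"
proof
  assume "\<exists>u. positive_solution \<Omega> n a \<mu> \<beta> u"
  then obtain u where u: "positive_solution \<Omega> n a \<mu> \<beta> u" ..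
  interpret solution \<Omega> n a \<mu> \<beta> u
    using assms(1,2) u by unfold_locales (auto simp: smooth_bounded_domain_def)
  note n = \<open>n \<ge> 2\<close>
  let ?L = "principal_eigenvalue \<Omega>"
  obtain U :: "nat \<Rightarrow> real" where U: "\<And>j. j \<in> {1..n} \<Longrightarrow> U j > 0"
    and key: "\<And>j. j \<in> {1..n} \<Longrightarrow> (\<mu> j - \<beta>) * U j + \<beta> * (\<Sum>k=1..n. U k) \<le> ?L + a j"
    using ground_state_inequality n by (metis one_le_numeral order_trans)
  have mem: "1 \<in> {1..n}" "n \<in> {1..n}" using n by auto
  have case_i: False if "j \<in> {1..n}" "a j \<le> - ?L" "\<mu> j \<ge> 0" "\<beta> \<ge> 0" "\<mu> j > 0 \<or> \<beta> > 0" for j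
    using nonneg_coupling_contradiction[where \<mu>=\<mu> and U=U and j=j, OF U that(1) n _ that(3-5)]
      key[OF that(1)] that(2) by linarith
  consider (i) j where "j \<in> {1..n}" "a j \<le> - ?L" "\<mu> j > 0" "\<beta> \<ge> 0"
    | (ii) i j where "1 \<le> i" "i < j" "j \<le> n" "a j \<le> a i" "\<mu> i \<le> \<beta>" "\<beta> \<le> \<mu> j"
        "a j < a i \<or> \<mu> i < \<beta> \<or> \<beta> < \<mu> j"
    | (iii) "focusing n \<mu>" "\<forall>j\<in>{1..n}. a j \<le> - ?L" "\<beta> \<ge> beta_bar n \<mu>"
        "(\<exists>j\<in>{1..n}. a j < - ?L) \<or> \<beta> > beta_bar n \<mu>"
    | (iv) "mixed n \<mu>" "a n \<le> a 1" "a 1 \<le> - ?L" "\<beta> \<ge> \<mu> 1" "a n < a 1 \<or> a 1 < - ?L \<or> \<beta> > \<mu> 1"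
    using assms(5) by blast
  then show False
  proof cases
    case i
    then show False using case_i[of j] by simp
  next
    case ii
    then show False using cross_inequality[of i j] by simp
  next
    case iii
    show False
    proof (cases "\<beta> \<ge> 0")
      case True
      \<comment> \<open>In the focusing case \<open>\<mu> 1 > 0\<close>, so the first component
        alone is contradictory.\<close>
      then show False using case_i[of 1] iii mem by (auto simp: focusing_def less_imp_le)
    next
      case False
      have d: "?L + a j \<le> 0" if "j \<in> {1..n}" for j using iii(2) that by fastforce
      have lt: "?L + a j < 0 \<longleftrightarrow> a j < - ?L" for j by linarith
      have "(\<exists>j\<in>{1..n}. ?L + a j < 0) \<or> \<beta> > beta_bar n \<mu>"
        using iii(4) unfolding lt .
      with False show False
        by (intro focusing_contradiction[OF iii(1) n _ iii(3) U key d]) auto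
    qed
  next
    case iv
    have mono: "\<mu> 1 \<le> \<mu> j \<and> \<mu> j \<le> \<mu> n" if "j \<in> {1..n}" for j using assms(4) that by auto
    obtain k where k: "k \<in> {1..n}" "\<mu> k \<ge> 0"
      using iv(1) by (auto simp: mixed_def defocusing_def not_less)
    obtain l where l: "l \<in> {1..n}" "\<mu> l \<le> 0"
      using iv(1) by (auto simp: mixed_def focusing_def not_less)
    \<comment> \<open>Mixed means neither all positive nor all negative; with the ordering this says
      \<open>\<mu> 1 \<le> 0 \<le> \<mu> n\<close>.\<close>
    have mun: "\<mu> n \<ge> 0" and mu1: "\<mu> 1 \<le> 0" using mono[OF k(1)] mono[OF l(1)] k l by auto
    show False
    proof (cases "\<beta> > \<mu> n")
      case True
      \<comment> \<open>Here \<open>\<beta> > \<mu> n \<ge> 0\<close>, and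
        \<open>a n \<le> a 1\<close> brings the last component below the eigenvalue
        threshold.\<close>
      then show False using case_i[of n] mem iv mun by auto
    next
      case False
      show False
      proof (cases "a n < a 1 \<or> \<mu> 1 < \<beta> \<or> \<beta> < \<mu> n")
        case True
        then show False using cross_inequality[of 1 n] mem iv False by auto
      next
        \<comment> \<open>All of \<open>\<mu> 1\<close>, \<open>\<beta>\<close> and
          \<open>\<mu> n\<close> coincide, hence are 0 by their signs. Strictness is left to
          \<open>a 1\<close>, and the inequality for the first component reads
          \<open>0 \<le> \<Lambda>_1 + a_1\<close>.\<close>
        case eq: False
        then have "\<mu> 1 = 0" "\<beta> = 0" "a 1 < - ?L" using iv False mu1 mun by auto
        then show False using key[OF mem(1)] by simp
      qed
    qed
  qed
qed

end
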